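(* Let $n$ be even. Then $\mathrm{H}_b^q(\mathrm{GL}_n(\mathbb{R}),\mathbb{R}_\varepsilon)$ is one-dimensional for $q=n$ and vanishes for $q<n$.
   Context: $\mathrm{H}_b^\bullet$ is continuous bounded cohomology; $\mathbb{R}_\varepsilon$ is $\mathbb{R}$ with $g\in\mathrm{GL}_n(\mathbb{R})$ acting by multiplication by $\operatorname{sign}\det g$. *)

theory Defs
  imports "HOL-Analysis.Analysis"
begin

definition GLn :: "(real^'n^'n) set" where
  "GLn = {A. invertible A}"

definition eps :: "real^'n^'n \<Rightarrow> real" where
  "eps g = sgn (det g)"

text \<open>G^(q+1) as extensional tuples (x 0, ..., x q) with entries in GL_n(R), all other
  coordinates 0.  Subset of nat => real^'n^'n carrying the product topology,
  so the subspace topology is the product topology of G^(q+1).\<close>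

definition tuples :: "nat \<Rightarrow> (nat \<Rightarrow> real^'n^'n) set" where
  "tuples q = {x. (\<forall>i\<le>q. x i \<in> GLn) \<and> (\<forall>i>q. x i = 0)}"

definition left_mult :: "nat \<Rightarrow> real^'n^'n \<Rightarrow> (nat \<Rightarrow> real^'n^'n) \<Rightarrow> (nat \<Rightarrow> real^'n^'n)" where
  "left_mult q g x = (\<lambda>i. if i \<le> q then g ** x i else 0)"

definition cochains :: "nat \<Rightarrow> ((nat \<Rightarrow> real^'n^'n) \<Rightarrow> real) set" where
  "cochains q = {f. continuous_on (tuples q) f \<and> bounded (f ` tuples q) \<and>
      (\<forall>g\<in>GLn. \<forall>x\<in>tuples q. f (left_mult q g x) = eps g * f x)}"

definition omit :: "nat \<Rightarrow> (nat \<Rightarrow> 'a) \<Rightarrow> (nat \<Rightarrow> 'a)" where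
  "omit i x = (\<lambda>j. if j < i then x j else x (Suc j))"

definition cobd :: "nat \<Rightarrow> ((nat \<Rightarrow> real^'n^'n) \<Rightarrow> real) \<Rightarrow> (nat \<Rightarrow> real^'n^'n) \<Rightarrow> real" where
  "cobd q f x = (\<Sum>i\<le>Suc q. (-1) ^ i * f (omit i x))"

definition is_cocycle :: "nat \<Rightarrow> ((nat \<Rightarrow> real^'n^'n) \<Rightarrow> real) \<Rightarrow> bool" where
  "is_cocycle q f \<longleftrightarrow> f \<in> cochains q \<and> (\<forall>x\<in>tuples (Suc q). cobd q f x = 0)"

definition is_coboundary :: "nat \<Rightarrow> ((nat \<Rightarrow> real^'n^'n) \<Rightarrow> real) \<Rightarrow> bool" where
  "is_coboundary q f \<longleftrightarrow>
     (if q = 0 then (\<forall>x\<in>tuples 0. f x = 0)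
      else (\<exists>h\<in>cochains (q - 1). \<forall>x\<in>tuples q. f x = cobd (q - 1) h x))"

definition Hb_vanishes :: "('n::finite) itself \<Rightarrow> nat \<Rightarrow> bool" where
  "Hb_vanishes _ q \<longleftrightarrow>
     (\<forall>z::(nat \<Rightarrow> real^'n^'n) \<Rightarrow> real. is_cocycle q z \<longrightarrow> is_coboundary q z)"

definition Hb_one_dim :: "('n::finite) itself \<Rightarrow> nat \<Rightarrow> bool" where
  "Hb_one_dim _ q \<longleftrightarrow>
     (\<exists>c::(nat \<Rightarrow> real^'n^'n) \<Rightarrow> real. is_cocycle q c \<and> \<not> is_coboundary q c \<and>
        (\<forall>z. is_cocycle q z \<longrightarrow> (\<exists>t::real. is_coboundary q (\<lambda>x. z x - t * c x))))"

end

theory Submission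
  imports Defs
begin

text \<open>
  Write \<open>G = GL\<^sub>n(\<real>)\<close>. Let \<open>mixed k q\<close> be the space of continuous bounded \<open>\<epsilon>\<close>-equivariant functions of
  k points of projective space in general position and q + 1 elements of G; for k = 0 these are the
  usual cochains. Deleting points gives a differential in the k direction which is exact, because one
  can average over a random additional point, moved by the first group element to keep equivariance.

  For \<open>1 \<le> k \<le> n\<close> the complex in the q direction is exact as well. By transitivity it consists of
  the cochains on G equivariant under the stabilizer H of the first k coordinate lines, and H contains
  a reflection r with \<open>\<epsilon> r = -1\<close> that is central modulo the unipotent radical U of the stabilizer of the
  span L of these lines. Squeezing the orthogonal complement of L by a factor tending to 0 is an
  H-equivariant self-map of G, homotopic to the identity, which makes uniformly continuous cochains
  U-invariant in each variable in the limit; then composition with r is homotopic to the identity but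
  acts by -1. The homotopies are equicontinuous, so they have a continuous cluster point. Uniform
  continuity is achieved beforehand by convolution.

  For k = n + 1 and n even, G acts transitively on the configurations with stabilizer the scalars, so the
  invariants are spanned by one function, the product of the signs of the n + 1 maximal minors. It is
  a cocycle, which by Gale duality is a statement on points of the projective line. A diagram chase
  in the double complex gives the result.
\<close>

subsection \<open>Invertible matrices and tuples\<close>

text \<open>The stabilizer of k lines contains a copy of GL of size n - k, so in general it is not
  amenable and exactness of the columns cannot come from an invariant mean; it rests on the sign
  character being -1 on an element that is central modulo U. That element commutes with H only
  modulo U, so it is replaced by a reflection that varies with the base point. Squeezing stands in
  for averaging over U: it commutes with left translation, and its prism homotopies are bounded and
  equicontinuous uniformly in the squeezing factor. These homotopies are not shown to converge; a
  pointwise cluster point suffices, since continuity, equivariance and the coboundary relation can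
  be tested on finitely many points at a time. Parity of n enters only at n + 1 points: a scalar a
  has determinant a^n, so the sign is trivial on the stabilizer exactly for even n. Restricting to
  general position keeps the signs of the minors continuous, and costs nothing in the averaging
  because a random vector is generic almost surely.\<close>

lemma GLn_iff_det: "A \<in> GLn \<longleftrightarrow> det A \<noteq> 0"
  by (simp add: GLn_def invertible_det_nz)

lemma GLn_mult: "A \<in> GLn \<Longrightarrow> B \<in> GLn \<Longrightarrow> A ** B \<in> GLn"
  by (simp add: GLn_iff_det det_mul)

lemma GLn_one [simp]: "mat 1 \<in> GLn"
  by (simp add: GLn_iff_det)

lemma matrix_inv_right: "A \<in> GLn \<Longrightarrow> A ** matrix_inv A = mat 1"
  and matrix_inv_left: "A \<in> GLn \<Longrightarrow> matrix_inv A ** A = mat 1"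
  unfolding GLn_def invertible_def matrix_inv_def mem_Collect_eq by (drule someI_ex, blast)+

lemma GLnI: "A ** B = mat 1 \<Longrightarrow> A \<in> GLn"
  unfolding GLn_def invertible_def using matrix_left_right_inverse[of A B] by auto

lemma GLn_inv: "A \<in> GLn \<Longrightarrow> matrix_inv A \<in> GLn"
  by (rule GLnI, rule matrix_inv_left)

lemma matrix_inv_unique':
  fixes A B :: "real^'n^'n"
  assumes "A ** B = mat 1"
  shows "matrix_inv A = B"
proof -
  have "matrix_inv A = matrix_inv A ** (A ** B)" by (simp add: assms)
  also have "\<dots> = B" by (simp add: matrix_mul_assoc matrix_inv_left[OF GLnI[OF assms]])
  finally show ?thesis .
qed

lemma matrix_inv_cancel:
  fixes A :: "real^'n^'n"
  assumes "A \<in> GLn"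
  shows "A ** (matrix_inv A ** B) = B" "matrix_inv A ** (A ** B) = B"
    "(C ** A) ** matrix_inv A = C" "(C ** matrix_inv A) ** A = C"
  using matrix_mul_assoc[of A "matrix_inv A" B] matrix_mul_assoc[of "matrix_inv A" A B]
    matrix_mul_assoc[of C A "matrix_inv A"] matrix_mul_assoc[of C "matrix_inv A" A]
  by (simp_all add: matrix_inv_left[OF assms] matrix_inv_right[OF assms])

lemma matrix_inv_mult: "A \<in> GLn \<Longrightarrow> B \<in> GLn \<Longrightarrow> matrix_inv (A ** B) = matrix_inv B ** matrix_inv A"
  by (rule matrix_inv_unique') (simp add: matrix_mul_assoc matrix_inv_cancel matrix_inv_right)

lemma eps_mult: "eps (A ** B) = eps A * eps B"
  by (simp add: eps_def det_mul sgn_mult)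

lemma eps_one [simp]: "eps (mat 1) = 1"
  by (simp add: eps_def)

lemma eps_square: "A \<in> GLn \<Longrightarrow> eps A * eps A = 1"
  by (simp add: eps_def GLn_iff_det sgn_real_def)

lemma abs_eps: "A \<in> GLn \<Longrightarrow> \<bar>eps A\<bar> = 1"
  by (simp add: eps_def GLn_iff_det sgn_real_def)

section \<open>Continuity of determinant, inverse and sign\<close>

lemma tendsto_det:
  fixes A :: "'b \<Rightarrow> real^'n^'n"
  assumes "(A \<longlongrightarrow> L) F"
  shows "((\<lambda>x. det (A x)) \<longlongrightarrow> det L) F"
  unfolding det_def by (intro tendsto_intros assms)

lemma tendsto_matrix_iff:
  fixes A :: "'b \<Rightarrow> real^'n^'m"
  shows "(A \<longlongrightarrow> L) F \<longleftrightarrow> (\<forall>i j. ((\<lambda>x. A x $ i $ j) \<longlongrightarrow> L $ i $ j) F)"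
  by (auto intro: vec_tendstoI tendsto_vec_nth)

lemma tendsto_matrix_mult:
  fixes A :: "'b \<Rightarrow> real^'n^'m" and B :: "'b \<Rightarrow> real^'k^'n"
  assumes "(A \<longlongrightarrow> L) F" "(B \<longlongrightarrow> M) F"
  shows "((\<lambda>x. A x ** B x) \<longlongrightarrow> L ** M) F"
  unfolding tendsto_matrix_iff matrix_matrix_mult_def
  by (auto intro!: tendsto_intros assms)

lemma tendsto_matrix_vector_mult:
  fixes A :: "'b \<Rightarrow> real^'n^'m"
  assumes "(A \<longlongrightarrow> L) F" "(B \<longlongrightarrow> M) F"
  shows "((\<lambda>x. A x *v B x) \<longlongrightarrow> L *v M) F"
  unfolding matrix_vector_mult_def
  by (auto intro!: vec_tendstoI tendsto_intros assms)

lemma tendsto_transpose: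
  fixes A :: "'b \<Rightarrow> real^'n^'m"
  assumes "(A \<longlongrightarrow> L) F"
  shows "((\<lambda>x. transpose (A x)) \<longlongrightarrow> transpose L) F"
  unfolding tendsto_matrix_iff transpose_def
  by (auto intro!: tendsto_intros assms)

text \<open>Writes the entries of the inverse as quotients of determinants, from which
  \<open>tendsto_matrix_inv\<close> gets the continuity of inversion.\<close>

lemma matrix_inv_cramer:
  fixes A :: "real^'n^'n"
  assumes "A \<in> GLn"
  shows "matrix_inv A $ k $ j = det (\<chi> i l. if l = k then axis j 1 $ i else A $ i $ l) / det A"
proof -
  have "A *v (matrix_inv A *v axis j 1) = axis j 1"
    by (simp add: matrix_vector_mul_assoc matrix_inv_right[OF assms])
  then have "matrix_inv A *v axis j 1 = (\<chi> k. det (\<chi> i l. if l = k then axis j 1 $ i else A $ i $ l) / det A)"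
    using cramer[of A] assms by (simp add: GLn_iff_det)
  moreover have "(matrix_inv A *v axis j 1) $ k = matrix_inv A $ k $ j"
    by (simp add: matrix_vector_mult_basis column_def)
  ultimately show ?thesis by simp
qed

lemma eventually_GLn:
  fixes A :: "'b \<Rightarrow> real^'n^'n"
  assumes "(A \<longlongrightarrow> L) F" "L \<in> GLn"
  shows "eventually (\<lambda>x. A x \<in> GLn) F"
  using tendsto_imp_eventually_ne[OF tendsto_det[OF assms(1)], of 0] assms(2)
  by (simp add: GLn_iff_det)

lemma open_GLn: "open (GLn :: (real^'n^'n) set)"
proof -
  have "isCont (det :: real^'n^'n \<Rightarrow> real) A" for A
    unfolding isCont_def by (intro tendsto_det tendsto_ident_at)
  then have "continuous_on UNIV (det :: real^'n^'n \<Rightarrow> real)"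
    by (simp add: continuous_at_imp_continuous_on)
  then have "open {A :: real^'n^'n. det A \<noteq> 0}"
    by (intro open_Collect_neq continuous_intros)
  then show ?thesis by (simp add: GLn_iff_det GLn_def invertible_det_nz)
qed

lemma tendsto_matrix_inv:
  fixes A :: "'b \<Rightarrow> real^'n^'n"
  assumes A: "(A \<longlongrightarrow> L) F" and L: "L \<in> GLn"
  shows "((\<lambda>x. matrix_inv (A x)) \<longlongrightarrow> matrix_inv L) F"
proof -
  have "((\<lambda>x. matrix_inv (A x) $ k $ j) \<longlongrightarrow> matrix_inv L $ k $ j) F" for k j
  proof (rule Lim_transform_eventually)
    let ?C = "\<lambda>B::real^'n^'n. (\<chi> i l. if l = k then axis j 1 $ i else B $ i $ l) :: real^'n^'n"
    have "((\<lambda>x. ?C (A x) $ i $ l) \<longlongrightarrow> ?C L $ i $ l) F" for i l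
      by (cases "l = k") (auto intro!: tendsto_intros A)
    then have "((\<lambda>x. ?C (A x)) \<longlongrightarrow> ?C L) F"
      unfolding tendsto_matrix_iff by blast
    then show "((\<lambda>x. det (?C (A x)) / det (A x)) \<longlongrightarrow> matrix_inv L $ k $ j) F"
      unfolding matrix_inv_cramer[OF L]
      using L by (intro tendsto_divide tendsto_det A) (simp_all add: GLn_iff_det)
    show "\<forall>\<^sub>F x in F. det (?C (A x)) / det (A x) = matrix_inv (A x) $ k $ j"
      using eventually_GLn[OF A L] by eventually_elim (simp add: matrix_inv_cramer)
  qed
  then show ?thesis by (simp add: tendsto_matrix_iff)
qed

lemma tendsto_eps:
  fixes A :: "'b \<Rightarrow> real^'n^'n"
  assumes "(A \<longlongrightarrow> L) F" "L \<in> GLn"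
  shows "((\<lambda>x. eps (A x)) \<longlongrightarrow> eps L) F"
  unfolding eps_def using assms by (intro tendsto_sgn tendsto_det) (auto simp: GLn_iff_det)

text \<open>The product topology is that of pointwise convergence. Continuity claims on tuples and
  configurations thereby become statements about coordinatewise convergent sequences.\<close>

lemma tendsto_fun_iff:
  fixes f :: "'b \<Rightarrow> 'c \<Rightarrow> 'd::topological_space"
  shows "(f \<longlongrightarrow> l) F \<longleftrightarrow> (\<forall>i. ((\<lambda>x. f x i) \<longlongrightarrow> l i) F)"
  unfolding limitin_canonical_iff[symmetric] euclidean_product_topology[symmetric] limitin_componentwise
  by auto

section \<open>Tuples and their faces\<close>

lemma tuples_iff: "x \<in> tuples q \<longleftrightarrow> (\<forall>i\<le>q. x i \<in> GLn) \<and> (\<forall>i>q. x i = 0)"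
  by (simp add: tuples_def)

lemma left_mult_tuples: "g \<in> GLn \<Longrightarrow> x \<in> tuples q \<Longrightarrow> left_mult q g x \<in> tuples q"
  by (auto simp: tuples_def left_mult_def GLn_mult)

lemma left_mult_mult: "left_mult q g (left_mult q h x) = left_mult q (g ** h) x"
  by (auto simp: left_mult_def matrix_mul_assoc)

lemma left_mult_one: "x \<in> tuples q \<Longrightarrow> left_mult q (mat 1) x = x"
  by (auto simp: left_mult_def tuples_def)

lemma omit_tuples: "x \<in> tuples (Suc q) \<Longrightarrow> i \<le> Suc q \<Longrightarrow> omit i x \<in> tuples q"
  by (auto simp: tuples_def omit_def)

lemma omit_left_mult: "i \<le> Suc q \<Longrightarrow> omit i (left_mult (Suc q) g x) = left_mult q g (omit i x)"
  by (auto simp: left_mult_def omit_def)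

lemma omit_omit: "i \<le> j \<Longrightarrow> omit i (omit (Suc j) x) = omit j (omit i x)"
  by (auto simp: omit_def fun_eq_iff)

text \<open>The simplicial identity pairs each term with \<open>j < i\<close> with the term at
  \<open>(j, i - 1)\<close>, of opposite sign. It is kept generic in the entries so that it serves
  deletion of vectors as well as deletion of group elements.\<close>

lemma alternating_sum_omit_omit:
  fixes f :: "(nat \<Rightarrow> 'a) \<Rightarrow> real"
  shows "(\<Sum>i\<le>Suc k. (-1)^i * (\<Sum>j\<le>k. (-1)^j * f (omit j (omit i x)))) = 0"
proof -
  let ?t = "\<lambda>i j. (-1)^(i+j) * f (omit j (omit i x))"
  let ?S = "{..Suc k} \<times> {..k}"
  let ?A = "{(i,j). j < i \<and> i \<le> Suc k}"
  let ?B = "{(i,j). i \<le> j \<and> j \<le> k}"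
  have fin: "finite ?A" "finite ?B"
    by (auto intro: finite_subset[of _ "{..Suc k} \<times> {..Suc k}"])
  have "(\<Sum>i\<le>Suc k. (-1)^i * (\<Sum>j\<le>k. (-1)^j * f (omit j (omit i x)))) =
      (\<Sum>(i,j)\<in>?S. ?t i j)"
    unfolding sum.cartesian_product[symmetric] sum_distrib_left power_add mult.assoc ..
  also have "?S = ?A \<union> ?B" by auto
  also have "(\<Sum>(i,j)\<in>?A \<union> ?B. ?t i j) = (\<Sum>(i,j)\<in>?A. ?t i j) + (\<Sum>(i,j)\<in>?B. ?t i j)"
    by (rule sum.union_disjoint) (use fin in auto)
  also have "(\<Sum>(i,j)\<in>?A. ?t i j) = (\<Sum>(i,j)\<in>?B. - ?t i j)"
  proof (rule sum.reindex_bij_witness[of _ "\<lambda>(i,j). (Suc j, i)" "\<lambda>(i,j). (j, i - 1)"], goal_cases)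
    case (5 a)
    then obtain i j where a: "a = (Suc i, j)" "j \<le> i"
      by (cases a; cases "fst a") auto
    then show ?case by (simp add: omit_omit add.commute)
  qed auto
  also have "\<dots> + (\<Sum>(i,j)\<in>?B. ?t i j) = 0"
    by (simp add: sum_negf case_prod_unfold)
  finally show ?thesis .
qed

subsection \<open>Smoothing with a bump function on matrices\<close>

lemma nn_integral_lborel_translate:
  fixes f :: "'a::euclidean_space \<Rightarrow> ennreal"
  assumes [measurable]: "f \<in> borel_measurable borel"
  shows "(\<integral>\<^sup>+x. f (c + x) \<partial>lborel) = (\<integral>\<^sup>+x. f x \<partial>lborel)"
proof -
  have "(\<integral>\<^sup>+x. f x \<partial>lborel) = (\<integral>\<^sup>+x. f x \<partial>distr lborel borel ((+) c))"
    by (simp add: lborel_distr_plus)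
  also have "\<dots> = (\<integral>\<^sup>+x. f (c + x) \<partial>lborel)"
    by (subst nn_integral_distr) auto
  finally show ?thesis ..
qed

text \<open>Both sides compute the double integral of f(x) g(Ay + x): translation invariance of Lebesgue
  measure moves the mixed argument from one factor to the other.\<close>
lemma nn_integral_lborel_linear_product:
  fixes A :: "'a::euclidean_space \<Rightarrow> 'a" and f g :: "'a \<Rightarrow> ennreal"
  assumes A: "linear A" and B: "\<And>x. A (B x) = x"
    and [measurable]: "f \<in> borel_measurable borel" "g \<in> borel_measurable borel"
  shows "(\<integral>\<^sup>+x. f x \<partial>lborel) * (\<integral>\<^sup>+y. g (A y) \<partial>lborel) =
    (\<integral>\<^sup>+y. f (- A y) \<partial>lborel) * (\<integral>\<^sup>+x. g x \<partial>lborel)"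
proof -
  have [measurable]: "A \<in> borel_measurable borel"
    by (intro borel_measurable_continuous_onI linear_continuous_on)
       (simp add: A linear_conv_bounded_linear[symmetric])
  have A_shift: "A y + x = A (B x + y)" "x - A y = - A (- B x + y)" for x y
    by (simp_all add: linear_add[OF A] linear_diff[OF A] linear_neg[OF A] B algebra_simps)
  have "(\<integral>\<^sup>+x. f x \<partial>lborel) * (\<integral>\<^sup>+y. g (A y) \<partial>lborel) = (\<integral>\<^sup>+x. f x * (\<integral>\<^sup>+y. g (A y) \<partial>lborel) \<partial>lborel)"
    by (simp add: nn_integral_multc)
  also have "\<dots> = (\<integral>\<^sup>+x. (\<integral>\<^sup>+y. f x * g (A y + x) \<partial>lborel) \<partial>lborel)"
    unfolding A_shift
    by (simp add: nn_integral_cmult nn_integral_lborel_translate[where f = "\<lambda>y. g (A y)"])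
  also have "\<dots> = (\<integral>\<^sup>+y. (\<integral>\<^sup>+x. f x * g (A y + x) \<partial>lborel) \<partial>lborel)"
    by (rule lborel_pair.Fubini') simp
  also have "\<dots> = (\<integral>\<^sup>+y. (\<integral>\<^sup>+x. f (x - A y) * g x \<partial>lborel) \<partial>lborel)"
  proof (rule nn_integral_cong)
    fix y
    have [measurable]: "(\<lambda>x. f (x - A y) * g x) \<in> borel_measurable borel"
      by measurable
    show "(\<integral>\<^sup>+x. f x * g (A y + x) \<partial>lborel) = (\<integral>\<^sup>+x. f (x - A y) * g x \<partial>lborel)"
      using nn_integral_lborel_translate[where f = "\<lambda>x. f (x - A y) * g x" and c = "A y"] by simp
  qed
  also have "\<dots> = (\<integral>\<^sup>+x. (\<integral>\<^sup>+y. f (x - A y) * g x \<partial>lborel) \<partial>lborel)"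
    by (rule lborel_pair.Fubini'[symmetric]) simp
  also have "\<dots> = (\<integral>\<^sup>+x. (\<integral>\<^sup>+y. f (- A y) \<partial>lborel) * g x \<partial>lborel)"
  proof (rule nn_integral_cong)
    fix x
    have "(\<integral>\<^sup>+y. f (x - A y) \<partial>lborel) = (\<integral>\<^sup>+y. f (- A y) \<partial>lborel)"
      unfolding A_shift(2) by (rule nn_integral_lborel_translate[where f = "\<lambda>y. f (- A y)"]) measurable
    then show "(\<integral>\<^sup>+y. f (x - A y) * g x \<partial>lborel) = (\<integral>\<^sup>+y. f (- A y) \<partial>lborel) * g x"
      by (simp add: nn_integral_multc)
  qed
  also have "\<dots> = (\<integral>\<^sup>+y. f (- A y) \<partial>lborel) * (\<integral>\<^sup>+x. g x \<partial>lborel)"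
    by (simp add: nn_integral_cmult)
  finally show ?thesis .
qed

lemma emeasure_lborel_open_pos:
  fixes S :: "'a::euclidean_space set"
  assumes "open S" "x \<in> S"
  shows "emeasure lborel S > 0"
proof -
  have "\<not> negligible S" using assms open_not_negligible by blast
  then have "S \<notin> null_sets lborel"
    using null_sets_completionI by (auto simp: negligible_iff_null_sets)
  then show ?thesis using assms by (auto simp: null_sets_def intro: gr_zeroI)
qed

text \<open>By the product formula the ratio of the two integrals does not depend on the integrand,
  so it can be read off from the unit ball: \<open>c\<close> is the volume of its preimage divided
  by its own volume. Applied to left multiplication of matrices, this lets Lebesgue measure stand in
  for Haar measure, up to a constant factor for each translation.\<close>

lemma integral_lborel_linear:
  fixes A :: "'a::euclidean_space \<Rightarrow> 'a"
  assumes A: "linear A" and B: "\<And>x. A (B x) = x" and B': "\<And>x. B (A x) = x" 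
  obtains c :: real where "c > 0"
    "\<And>f :: 'a \<Rightarrow> real. f \<in> borel_measurable borel \<Longrightarrow>
      (\<integral>x. f (A x) \<partial>lborel) = c * (\<integral>x. f x \<partial>lborel)"
proof -
  have contA: "continuous_on UNIV A"
    by (intro linear_continuous_on) (simp add: A linear_conv_bounded_linear[symmetric])
  then have [measurable]: "A \<in> borel_measurable borel"
    by (intro borel_measurable_continuous_onI)
  have B_lin: "linear B"
  proof (rule linearI)
    show "B (x + y) = B x + B y" for x y
      using B'[of "B x + B y"] by (simp add: linear_add[OF A] B)
    show "B (r *\<^sub>R x) = r *\<^sub>R B x" for r x
      using B'[of "r *\<^sub>R B x"] by (simp add: linear_scale[OF A] B)
  qed
  have norm_B: "bounded_linear B"
    using B_lin by (simp add: linear_conv_bounded_linear)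
  define S :: "'a set" where "S = ball 0 1"
  have [measurable]: "S \<in> sets borel" by (simp add: S_def)
  let ?i = "indicator S :: 'a \<Rightarrow> ennreal"
  define v where "v = emeasure lborel S"
  define u where "u = emeasure lborel (A -` S)"
  have v: "v > 0" "v < \<infinity>"
    using emeasure_lborel_ball_finite[of "0::'a" 1] emeasure_lborel_open_pos[of S 0]
    by (auto simp: v_def S_def)
  have "open (A -` S)"
    using contA by (simp add: S_def open_vimage)
  moreover have "0 \<in> A -` S" by (simp add: S_def linear_0[OF A])
  moreover have "bounded (A -` S)"
  proof -
    have "A -` S \<subseteq> B ` S"
    proof
      fix x assume "x \<in> A -` S"
      then have "B (A x) \<in> B ` S" by blast
      then show "x \<in> B ` S" by (simp only: B')
    qed
    moreover have "bounded (B ` S)"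
      by (rule bounded_linear_image[OF _ norm_B]) (simp add: S_def)
    ultimately show ?thesis using bounded_subset by blast
  qed
  ultimately have u: "u > 0" "u < \<infinity>"
    using emeasure_lborel_open_pos[of "A -` S" 0] emeasure_bounded_finite[of "A -` S"]
    by (simp_all add: u_def)
  obtain a b where ab: "u = ennreal a" "v = ennreal b" "0 < a" "0 < b"
    using u v by (cases u; cases v) auto
  define c where "c = a / b"
  have "c > 0" using ab by (simp add: c_def)
  have sym: "?i (- y) = ?i y" for y by (simp add: S_def indicator_def)
  have nn: "(\<integral>\<^sup>+y. g (A y) \<partial>lborel) = ennreal c * (\<integral>\<^sup>+x. g x \<partial>lborel)"
    if [measurable]: "g \<in> borel_measurable borel" for g :: "'a \<Rightarrow> ennreal"
  proof -
    have "(\<integral>\<^sup>+x. ?i x \<partial>lborel) = v" by (simp add: v_def)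
    \<comment> \<open>The ball is symmetric, which removes the sign from the product
      formula.\<close>
    moreover have "(\<integral>\<^sup>+y. ?i (- A y) \<partial>lborel) = u"
    proof -
      have "(\<integral>\<^sup>+y. ?i (- A y) \<partial>lborel) = (\<integral>\<^sup>+y. indicator (A -` S) y \<partial>lborel)"
        by (intro nn_integral_cong) (simp add: S_def indicator_def)
      also have "\<dots> = u" unfolding u_def
        by (rule nn_integral_indicator) (use \<open>open (A -` S)\<close> in simp)
      finally show ?thesis .
    qed
    ultimately have "v * (\<integral>\<^sup>+y. g (A y) \<partial>lborel) = u * (\<integral>\<^sup>+x. g x \<partial>lborel)"
      using nn_integral_lborel_linear_product[OF A B, of ?i g] by simp
    then have "ennreal (1 / b) * (ennreal b * (\<integral>\<^sup>+y. g (A y) \<partial>lborel)) =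
        ennreal (1 / b) * (ennreal a * (\<integral>\<^sup>+x. g x \<partial>lborel))"
      by (simp add: ab)
    then show ?thesis
      using ab by (simp add: mult.assoc[symmetric] ennreal_mult[symmetric] c_def)
  qed
  have eq: "distr lborel borel A = density lborel (\<lambda>_. ennreal c)"
  proof (rule measure_eqI)
    fix X assume "X \<in> sets (distr lborel borel A)"
    then have [measurable]: "X \<in> sets borel" by simp
    have "emeasure (distr lborel borel A) X = (\<integral>\<^sup>+y. indicator X y \<partial>distr lborel borel A)"
      by simp
    also have "\<dots> = (\<integral>\<^sup>+y. indicator X (A y) \<partial>lborel)"
      by (subst nn_integral_distr) auto
    also have "\<dots> = emeasure (density lborel (\<lambda>_. ennreal c)) X"
      by (subst nn) (auto simp: emeasure_density nn_integral_cmult)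
    finally show "emeasure (distr lborel borel A) X = emeasure (density lborel (\<lambda>_. ennreal c)) X" .
  qed simp
  show ?thesis
  proof
    show "c > 0" by fact
    fix f :: "'a \<Rightarrow> real" assume [measurable]: "f \<in> borel_measurable borel"
    have "(\<integral>x. f (A x) \<partial>lborel) = (\<integral>x. f x \<partial>distr lborel borel A)"
      by (subst integral_distr) auto
    also have "\<dots> = c * (\<integral>x. f x \<partial>lborel)"
      unfolding eq using \<open>c > 0\<close> by (subst integral_density) auto
    finally show "(\<integral>x. f (A x) \<partial>lborel) = c * (\<integral>x. f x \<partial>lborel)" .
  qed
qed


lemma bounded_bilinear_matrix_mult:
  "bounded_bilinear ((**) :: real^'n^'n \<Rightarrow> real^'n^'n \<Rightarrow> real^'n^'n)"
proof -
  have "bilinear ((**) :: real^'n^'n \<Rightarrow> real^'n^'n \<Rightarrow> real^'n^'n)"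
    unfolding bilinear_def linear_iff
    by (simp add: matrix_matrix_mult_def vec_eq_iff sum.distrib sum_distrib_left algebra_simps)
  then show ?thesis by (simp add: bilinear_conv_bounded_bilinear)
qed

lemma linear_matrix_mult_left: "linear ((**) m :: real^'n^'n \<Rightarrow> real^'n^'n)"
  using bounded_bilinear.bounded_linear_right[OF bounded_bilinear_matrix_mult]
  by (simp add: linear_conv_bounded_linear)

text \<open>A normalized tent function around the identity matrix. Its support lies in a ball inside
  \<open>GLn\<close>, so functions controlled only on the group can be integrated against
  it.\<close>

lemma bump_exists:
  "\<exists>\<rho> :: real^'n^'n \<Rightarrow> real. continuous_on UNIV \<rho> \<and> (\<forall>k. 0 \<le> \<rho> k) \<and> (\<exists>M. \<forall>k. \<rho> k \<le> M) \<and>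
    (\<forall>k. \<rho> k \<noteq> 0 \<longrightarrow> k \<in> GLn) \<and> (\<exists>R. \<forall>k. \<rho> k \<noteq> 0 \<longrightarrow> norm k \<le> R) \<and>
    integrable lborel \<rho> \<and> integral\<^sup>L lborel \<rho> = 1"
proof -
  obtain r where r: "r > 0" "ball (mat 1) r \<subseteq> (GLn :: (real^'n^'n) set)"
    using open_GLn open_contains_ball GLn_one by metis
  define p :: "real^'n^'n \<Rightarrow> real" where "p k = max 0 (r - dist (mat 1) k)" for k
  have cont: "continuous_on S p" for S
    unfolding p_def by (intro continuous_intros)
  have p0: "p k \<noteq> 0 \<Longrightarrow> k \<in> ball (mat 1) r" for k
    by (auto simp: p_def max_def split: if_splits)
  have pnn: "0 \<le> p k" for k by (simp add: p_def)
  have pM: "p k \<le> r" for k using r by (simp add: p_def)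
  have "integrable lborel (\<lambda>k. indicator (cball (mat 1) r) k *\<^sub>R p k)"
    by (rule borel_integrable_compact) (auto intro: cont)
  moreover have "(\<lambda>k. indicator (cball (mat 1) r) k *\<^sub>R p k) = p"
    using p0 by (fastforce simp: indicator_def fun_eq_iff)
  ultimately have int: "integrable lborel p" by simp
  have pos: "integral\<^sup>L lborel p > 0"
  proof (rule ccontr)
    assume "\<not> ?thesis"
    then have "integral\<^sup>L lborel p = 0"
      using Bochner_Integration.integral_nonneg[of lborel p] pnn by (simp add: not_less order.eq_iff)
    then have "AE k in lborel. p k = 0"
      using integral_nonneg_eq_0_iff_AE[OF int] pnn by simp
    then have "AE k in lborel. k \<notin> ball (mat 1 :: real^'n^'n) r"
      by eventually_elim (simp add: p_def)
    then have "emeasure lborel (ball (mat 1 :: real^'n^'n) r) = 0"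
      using AE_iff_measurable[of "ball (mat 1 :: real^'n^'n) r" lborel "\<lambda>k. k \<notin> ball (mat 1) r"]
      by (simp add: ball_def)
    moreover have "emeasure lborel (ball (mat 1 :: real^'n^'n) r) > 0"
      by (rule emeasure_lborel_open_pos[of _ "mat 1"]) (use r in auto)
    ultimately show False by simp
  qed
  define I where "I = integral\<^sup>L lborel p"
  have I: "I > 0" using pos by (simp add: I_def)
  have nb: "norm k \<le> norm (mat 1 :: real^'n^'n) + r" if "p k \<noteq> 0" for k
    using p0[OF that] norm_triangle_ineq2[of k "mat 1"] by (auto simp: dist_norm norm_minus_commute)
  show ?thesis
  proof (intro exI[of _ "\<lambda>k. p k / I"] conjI allI impI)
    show "continuous_on UNIV (\<lambda>k. p k / I)" using I by (intro continuous_intros cont) auto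
    show "0 \<le> p k / I" for k using I pnn by simp
    show "\<exists>M. \<forall>k. p k / I \<le> M" using I pM by (intro exI[of _ "r / I"]) (simp add: divide_right_mono)
    show "k \<in> GLn" if "p k / I \<noteq> 0" for k using p0 r that by auto
    show "\<exists>R. \<forall>k. p k / I \<noteq> 0 \<longrightarrow> norm k \<le> R" using nb by auto
    show "integrable lborel (\<lambda>k. p k / I)" using int by simp
    show "integral\<^sup>L lborel (\<lambda>k. p k / I) = 1" using I int by (simp add: I_def[symmetric])
  qed
qed

definition bump :: "real^'n^'n \<Rightarrow> real" where
  "bump = (SOME \<rho>. continuous_on UNIV \<rho> \<and> (\<forall>k. 0 \<le> \<rho> k) \<and> (\<exists>M. \<forall>k. \<rho> k \<le> M) \<and>
    (\<forall>k. \<rho> k \<noteq> 0 \<longrightarrow> k \<in> GLn) \<and> (\<exists>R. \<forall>k. \<rho> k \<noteq> 0 \<longrightarrow> norm k \<le> R) \<and>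
    integrable lborel \<rho> \<and> integral\<^sup>L lborel \<rho> = 1)"

lemma continuous_bump: "continuous_on S bump"
  and bump_nonneg: "0 \<le> bump k"
  and bump_bounded: "\<exists>M. \<forall>k :: real^'n^'n. bump k \<le> M"
  and bump_GLn: "bump k \<noteq> 0 \<Longrightarrow> k \<in> GLn"
  and bump_support: "\<exists>R. \<forall>k :: real^'n^'n. bump k \<noteq> 0 \<longrightarrow> norm k \<le> R"
  and integrable_bump: "integrable lborel bump"
  and integral_bump: "integral\<^sup>L lborel bump = 1"
  using someI_ex[OF bump_exists, folded bump_def]
  by (auto intro: continuous_on_subset)

text \<open>\<open>\<phi>\<close> is controlled only on the open set \<open>GLn\<close>; as
  \<open>\<psi>\<close> vanishes off it, the product is measurable and dominated by
  \<open>C * \<bar>\<psi> k\<bar>\<close>.\<close>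

lemma integrable_mult_continuous_on_GLn:
  fixes \<phi> \<psi> :: "real^'n^'n \<Rightarrow> real"
  assumes \<psi>: "continuous_on UNIV \<psi>" "\<And>k. \<psi> k \<noteq> 0 \<Longrightarrow> k \<in> GLn" "integrable lborel \<psi>"
    and \<phi>: "continuous_on GLn \<phi>" "\<And>k. k \<in> GLn \<Longrightarrow> \<bar>\<phi> k\<bar> \<le> C"
  shows "(\<lambda>k. \<psi> k * \<phi> k) \<in> borel_measurable borel"
    and "integrable lborel (\<lambda>k. \<psi> k * \<phi> k)"
    and "\<bar>\<integral>k. \<psi> k * \<phi> k \<partial>lborel\<bar> \<le> C * (\<integral>k. \<bar>\<psi> k\<bar> \<partial>lborel)"
proof -
  have "(\<lambda>k. indicator GLn k *\<^sub>R (\<psi> k * \<phi> k)) \<in> borel_measurable borel"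
    using \<phi>(1) \<psi>(1) borel_open[OF open_GLn]
    by (intro borel_measurable_continuous_on_indicator continuous_intros) (auto intro: continuous_on_subset)
  moreover have "(\<lambda>k. indicator GLn k *\<^sub>R (\<psi> k * \<phi> k)) = (\<lambda>k. \<psi> k * \<phi> k)"
    using \<psi>(2) by (auto simp: indicator_def fun_eq_iff)
  ultimately show m: "(\<lambda>k. \<psi> k * \<phi> k) \<in> borel_measurable borel" by simp
  have bd: "\<bar>\<psi> k * \<phi> k\<bar> \<le> C * \<bar>\<psi> k\<bar>" for k
    using \<psi>(2)[of k] \<phi>(2)[of k] mult_right_mono[of "\<bar>\<phi> k\<bar>" C "\<bar>\<psi> k\<bar>"]
    by (cases "\<psi> k = 0") (auto simp: abs_mult mult.commute)
  have i: "integrable lborel (\<lambda>k. C * \<bar>\<psi> k\<bar>)" using \<psi>(3) by simp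
  show int: "integrable lborel (\<lambda>k. \<psi> k * \<phi> k)"
    by (rule Bochner_Integration.integrable_bound[OF i])
       (use m in simp, intro AE_I2, simp add: order_trans[OF bd abs_ge_self])
  have "\<bar>\<integral>k. \<psi> k * \<phi> k \<partial>lborel\<bar> \<le> (\<integral>k. \<bar>\<psi> k * \<phi> k\<bar> \<partial>lborel)" by (rule integral_abs_bound)
  also have "\<dots> \<le> (\<integral>k. C * \<bar>\<psi> k\<bar> \<partial>lborel)"
    using int i bd by (intro integral_mono) auto
  finally show "\<bar>\<integral>k. \<psi> k * \<phi> k \<partial>lborel\<bar> \<le> C * (\<integral>k. \<bar>\<psi> k\<bar> \<partial>lborel)" by simp
qed


text \<open>Dominated convergence: the \<open>m i\<close> form a bounded sequence, so the supports
  of all translates lie in one ball.\<close>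

lemma tendsto_bump_translate_L1:
  fixes m :: "nat \<Rightarrow> real^'n^'n"
  assumes m: "m \<longlonglongrightarrow> mat 1" and mG: "\<And>i. m i \<in> GLn"
  shows "(\<lambda>i. \<integral>k. \<bar>bump (matrix_inv (m i) ** k) - bump k\<bar> \<partial>lborel) \<longlonglongrightarrow> 0"
proof -
  obtain M :: real where M: "\<And>k :: real^'n^'n. bump k \<le> M" using bump_bounded by blast
  obtain R where R: "\<And>k :: real^'n^'n. bump k \<noteq> 0 \<Longrightarrow> norm k \<le> R"
    using bump_support[where 'n = 'n] by metis
  obtain K where K: "K > 0" "\<And>(a :: real^'n^'n) (b :: real^'n^'n). norm (a ** b) \<le> norm a * norm b * K"
    using bounded_bilinear.pos_bounded[OF bounded_bilinear_matrix_mult[where 'n = 'n]] by metis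
  obtain B where B: "B > 0" "\<And>i. norm (m i) \<le> B"
    using convergent_imp_Bseq[OF convergentI[OF m]] by (rule BseqE) blast
  define N where "N = B * R * K"
  have supp: "norm k \<le> N" if "bump (matrix_inv (m i) ** k) \<noteq> 0" for i k
  proof -
    have "norm k = norm (m i ** (matrix_inv (m i) ** k))" by (simp add: matrix_inv_cancel mG)
    also have "\<dots> \<le> norm (m i) * norm (matrix_inv (m i) ** k) * K" by (rule K)
    also have "\<dots> \<le> N" unfolding N_def
    proof (rule mult_right_mono)
      show "norm (m i) * norm (matrix_inv (m i) ** k) \<le> B * R"
        by (rule mult_mono[OF B(2) R[OF that]]) (use B(1) in simp_all)
    qed (use K(1) in simp)
    finally show ?thesis .
  qed
  define w where "w k = M * indicator (cball 0 N) k + bump k" for k :: "real^'n^'n"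
  have cm: "continuous_on UNIV (\<lambda>k. bump (matrix_inv (m i) ** k))" for i
    by (rule continuous_on_compose2[OF continuous_bump[of UNIV]
          linear_continuous_on[OF linear_matrix_mult_left[unfolded linear_conv_bounded_linear]]]) auto
  have "(\<lambda>i. \<integral>k. \<bar>bump (matrix_inv (m i) ** k) - bump k\<bar> \<partial>lborel) \<longlonglongrightarrow> (\<integral>k. (0::real) \<partial>(lborel :: (real^'n^'n) measure))"
  proof (rule integral_dominated_convergence[where w = w])
    have "integrable lborel (\<lambda>k::real^'n^'n. indicator (cball 0 N) k :: real)"
      by (rule integrable_real_indicator) (use emeasure_lborel_cball_finite[of "0 :: real^'n^'n" N] in auto)
    then show "integrable lborel w"
      unfolding w_def by (intro Bochner_Integration.integrable_add integrable_bump integrable_mult_right)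
    show "AE k in lborel. (\<lambda>i. \<bar>bump (matrix_inv (m i) ** k) - bump k\<bar>) \<longlonglongrightarrow> 0"
    proof (rule AE_I2)
      fix k :: "real^'n^'n"
      have inv1: "matrix_inv (mat 1) = (mat 1 :: real^'n^'n)" by (rule matrix_inv_unique') simp
      have "(\<lambda>i. matrix_inv (m i) ** k) \<longlonglongrightarrow> matrix_inv (mat 1) ** k"
        by (intro tendsto_matrix_mult tendsto_matrix_inv m tendsto_const) simp
      then have "(\<lambda>i. matrix_inv (m i) ** k) \<longlonglongrightarrow> k" by (simp add: inv1)
      moreover have "isCont bump k"
        using continuous_bump[of "UNIV :: (real^'n^'n) set"] by (simp add: continuous_on_eq_continuous_at)
      ultimately have "(\<lambda>i. bump (matrix_inv (m i) ** k)) \<longlonglongrightarrow> bump k"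
        by (rule isCont_tendsto_compose[rotated])
      then show "(\<lambda>i. \<bar>bump (matrix_inv (m i) ** k) - bump k\<bar>) \<longlonglongrightarrow> 0"
        by (intro tendsto_rabs_zero) (simp add: LIM_zero)
    qed
    show "AE k in lborel. norm \<bar>bump (matrix_inv (m i) ** k) - bump k\<bar> \<le> w k" for i
    proof (rule AE_I2)
      fix k :: "real^'n^'n"
      have "bump (matrix_inv (m i) ** k) \<le> M * indicator (cball 0 N) k"
        using supp[of i k] M[of "matrix_inv (m i) ** k"]
        by (cases "bump (matrix_inv (m i) ** k) = 0")
           (use M[of 0] bump_nonneg[of "0::real^'n^'n"] in \<open>auto simp: indicator_def\<close>)
      then show "norm \<bar>bump (matrix_inv (m i) ** k) - bump k\<bar> \<le> w k"
        using bump_nonneg[of k] bump_nonneg[of "matrix_inv (m i) ** k"] unfolding w_def by auto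
    qed
    have "continuous_on UNIV (\<lambda>k. \<bar>bump (matrix_inv (m i) ** k) - bump k\<bar>)" for i
      by (intro continuous_on_rabs continuous_on_diff cm continuous_bump)
    then show "(\<lambda>k. \<bar>bump (matrix_inv (m i) ** k) - bump k\<bar>) \<in> borel_measurable lborel" for i
      by (simp add: borel_measurable_continuous_onI)
  qed simp
  then show ?thesis by simp
qed

text \<open>Moving \<open>m\<close> from \<open>\<phi>\<close> to the bump leaves the L1 distance of
  two bumps. The estimate sees \<open>\<phi>\<close> only through its supremum, so it becomes a
  modulus of continuity of convolutions that is uniform over all base points.\<close>

lemma bump_translate:
  fixes e :: real
  assumes "e > 0"
  obtains d where "d > 0"
    "\<And>m :: real^'n^'n. norm (m - mat 1) < d \<Longrightarrow> m \<in> GLn"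
    "\<And>(m :: real^'n^'n) (\<phi> :: real^'n^'n \<Rightarrow> real) C. \<lbrakk>norm (m - mat 1) < d; continuous_on GLn \<phi>; \<And>k. k \<in> GLn \<Longrightarrow> \<bar>\<phi> k\<bar> \<le> C\<rbrakk> \<Longrightarrow>
      \<bar>(\<integral>k. bump k * \<phi> (m ** k) \<partial>lborel) - (\<integral>k. bump k * \<phi> k \<partial>lborel)\<bar> \<le> C * e"
proof -
  define V where "V m = (\<integral>k. \<bar>bump (matrix_inv m ** k) - bump k\<bar> \<partial>lborel)" for m :: "real^'n^'n"
  \<comment> \<open>\<open>1/2\<close> keeps the mass of the translated bump at least 1/2;
    \<open>e / 4\<close> pays for two errors of size \<open>C * V m\<close>, each at most doubled by
    dividing by that mass.\<close>
  define e' where "e' = min (1/2) (e / 4)"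
  have "e' > 0" using assms by (simp add: e'_def)
  have "eventually (\<lambda>m. V m < e') (inf (nhds (mat 1)) (principal GLn))"
  proof (rule sequentially_imp_eventually_nhds_within, intro allI impI, elim conjE)
    fix m :: "nat \<Rightarrow> real^'n^'n" assume "\<forall>n. m n \<in> GLn" "m \<longlonglongrightarrow> mat 1"
    then have "(\<lambda>i. V (m i)) \<longlonglongrightarrow> 0" unfolding V_def by (intro tendsto_bump_translate_L1) auto
    then show "eventually (\<lambda>i. V (m i) < e') sequentially" using \<open>e' > 0\<close> by (rule order_tendstoD)
  qed
  then obtain d1 where d1: "d1 > 0" "\<And>m. dist m (mat 1) < d1 \<Longrightarrow> m \<in> GLn \<Longrightarrow> V m < e'"
    unfolding eventually_inf_principal eventually_nhds_metric by blast
  obtain d2 where d2: "d2 > 0" "ball (mat 1) d2 \<subseteq> (GLn :: (real^'n^'n) set)"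
    using open_GLn open_contains_ball GLn_one by metis
  show ?thesis
  proof (rule that[of "min d1 d2"])
    show "min d1 d2 > 0" using d1 d2 by simp
    show G: "m \<in> GLn" if "norm (m - mat 1) < min d1 d2" for m :: "real^'n^'n"
      using that d2 by (auto simp: subset_iff dist_norm norm_minus_commute)
    fix m :: "real^'n^'n" and \<phi> :: "real^'n^'n \<Rightarrow> real" and C
    assume md: "norm (m - mat 1) < min d1 d2" and \<phi>: "continuous_on GLn \<phi>" "\<And>k. k \<in> GLn \<Longrightarrow> \<bar>\<phi> k\<bar> \<le> C"
    have mG: "m \<in> GLn" by (rule G[OF md])
    have Vm: "V m < e'" using d1(2)[OF _ mG] md by (simp add: dist_norm)
    have "C \<ge> 0" using \<phi>(2)[OF GLn_one] by linarith
    obtain c where c: "c > 0" "\<And>f :: real^'n^'n \<Rightarrow> real. f \<in> borel_measurable borel \<Longrightarrow>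
      (\<integral>x. f (m ** x) \<partial>lborel) = c * (\<integral>x. f x \<partial>lborel)"
      by (rule integral_lborel_linear[OF linear_matrix_mult_left, of m "(**) (matrix_inv m)"])
         (use mG in \<open>auto simp: matrix_inv_cancel\<close>)
    define \<psi> where "\<psi> k = bump (matrix_inv m ** k)" for k
    have \<psi>c: "continuous_on UNIV \<psi>" unfolding \<psi>_def
      by (rule continuous_on_compose2[OF continuous_bump[of UNIV]
          linear_continuous_on[OF linear_matrix_mult_left[unfolded linear_conv_bounded_linear]]]) auto
    have \<psi>G: "k \<in> GLn" if "\<psi> k \<noteq> 0" for k
      using GLn_mult[OF mG bump_GLn[of "matrix_inv m ** k"]] that mG by (simp add: \<psi>_def matrix_inv_cancel)
    have \<psi>m: "\<psi> (m ** k) = bump k" for k by (simp add: \<psi>_def matrix_inv_cancel mG)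
    \<comment> \<open>Testing the scaling law on the translated bump identifies \<open>c\<close> as
      the inverse of its mass.\<close>
    have 1: "1 = c * (\<integral>k. \<psi> k \<partial>lborel)"
      using c(2)[of \<psi>] \<psi>c by (simp add: \<psi>m integral_bump borel_measurable_continuous_onI)
    \<comment> \<open>A function that is not integrable has integral 0, against the preceding
      equation.\<close>
    have \<psi>i: "integrable lborel \<psi>"
      using 1 not_integrable_integral_eq by force
    define I where "I = (\<integral>k. \<psi> k \<partial>lborel)"
    define D where "D k = \<psi> k - bump k" for k
    have D: "continuous_on UNIV D" "\<And>k. D k \<noteq> 0 \<Longrightarrow> k \<in> GLn" "integrable lborel D"
    proof -
      show "continuous_on UNIV D" unfolding D_def by (intro continuous_intros \<psi>c continuous_bump)
      show "k \<in> GLn" if "D k \<noteq> 0" for k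
        using that \<psi>G[of k] bump_GLn[of k] by (cases "\<psi> k = 0") (auto simp: D_def)
      show "integrable lborel D"
        unfolding D_def by (intro Bochner_Integration.integrable_diff \<psi>i integrable_bump)
    qed
    have V_D: "V m = (\<integral>k. \<bar>D k\<bar> \<partial>lborel)" by (simp add: V_def D_def \<psi>_def)
    have I1: "\<bar>I - 1\<bar> \<le> V m"
    proof -
      have "I - 1 = (\<integral>k. D k \<partial>lborel)"
        unfolding D_def I_def using Bochner_Integration.integral_diff[OF \<psi>i integrable_bump]
        by (simp add: integral_bump)
      then show ?thesis unfolding V_D by (simp add: integral_abs_bound)
    qed
    have "V m < 1/2" using Vm by (simp add: e'_def)
    then have Ih: "I \<ge> 1/2" using I1 by linarith
    have cI: "c = 1 / I" using 1 Ih by (simp add: I_def[symmetric] field_simps)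
    note [simp] = integrable_mult_continuous_on_GLn(2)[OF \<psi>c \<psi>G \<psi>i \<phi>]
      integrable_mult_continuous_on_GLn(2)[OF continuous_bump bump_GLn integrable_bump \<phi>]
    define X where "X = (\<integral>k. bump k * \<phi> k \<partial>lborel)"
    have X: "\<bar>X\<bar> \<le> C"
      using integrable_mult_continuous_on_GLn(3)[OF continuous_bump bump_GLn integrable_bump \<phi>]
      by (simp add: X_def abs_of_nonneg[OF bump_nonneg] integral_bump)
    have DX: "\<bar>(\<integral>k. \<psi> k * \<phi> k \<partial>lborel) - X\<bar> \<le> C * V m"
    proof -
      have "(\<integral>k. \<psi> k * \<phi> k \<partial>lborel) - X = (\<integral>k. D k * \<phi> k \<partial>lborel)"
        unfolding X_def D_def by (simp add: left_diff_distrib)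
      then show ?thesis
        using integrable_mult_continuous_on_GLn(3)[OF D \<phi>] V_D by simp
    qed
    have "(\<integral>k. bump k * \<phi> (m ** k) \<partial>lborel) = c * (\<integral>k. \<psi> k * \<phi> k \<partial>lborel)"
      using c(2)[OF integrable_mult_continuous_on_GLn(1)[OF \<psi>c \<psi>G \<psi>i \<phi>]] by (simp add: \<psi>m)
    then have "(\<integral>k. bump k * \<phi> (m ** k) \<partial>lborel) - X = ((\<integral>k. \<psi> k * \<phi> k \<partial>lborel) - X + (1 - I) * X) / I"
      using Ih by (simp add: cI diff_divide_distrib add_divide_distrib left_diff_distrib)
    then have "\<bar>(\<integral>k. bump k * \<phi> (m ** k) \<partial>lborel) - X\<bar> = \<bar>((\<integral>k. \<psi> k * \<phi> k \<partial>lborel) - X) + (1 - I) * X\<bar> / I"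
      using Ih by (simp add: abs_divide)
    also have "\<dots> \<le> (C * V m + V m * C) / I"
    proof (rule divide_right_mono)
      have "\<bar>(1 - I) * X\<bar> \<le> V m * C"
        unfolding abs_mult using I1 X by (intro mult_mono) auto
      then show "\<bar>((\<integral>k. \<psi> k * \<phi> k \<partial>lborel) - X) + (1 - I) * X\<bar> \<le> C * V m + V m * C"
        using DX by linarith
    qed (use Ih in simp)
    also have "\<dots> \<le> (C * V m + V m * C) / (1/2)"
      using Ih \<open>C \<ge> 0\<close> I1 by (intro divide_left_mono) auto
    also have "\<dots> \<le> C * e"
      using mult_left_mono[of "4 * V m" e C] Vm \<open>C \<ge> 0\<close> by (simp add: e'_def algebra_simps)
    finally show "\<bar>(\<integral>k. bump k * \<phi> (m ** k) \<partial>lborel) - (\<integral>k. bump k * \<phi> k \<partial>lborel)\<bar> \<le> C * e"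
      unfolding X_def .
  qed
qed

subsection \<open>Prism homotopies\<close>

definition dup :: "nat \<Rightarrow> (nat \<Rightarrow> 'a) \<Rightarrow> nat \<Rightarrow> 'a" where
  "dup i x = (\<lambda>j. if j \<le> i then x j else x (j - 1))"

definition act :: "(('a \<Rightarrow> real) \<Rightarrow> 'a \<Rightarrow> real) \<Rightarrow> nat \<Rightarrow> ((nat \<Rightarrow> 'a) \<Rightarrow> real) \<Rightarrow> (nat \<Rightarrow> 'a) \<Rightarrow> real" where
  "act T j f x = T (\<lambda>y. f (x(j := y))) (x j)"

fun act_from :: "(('a \<Rightarrow> real) \<Rightarrow> 'a \<Rightarrow> real) \<Rightarrow> nat \<Rightarrow> nat \<Rightarrow> ((nat \<Rightarrow> 'a) \<Rightarrow> real) \<Rightarrow> (nat \<Rightarrow> 'a) \<Rightarrow> real" where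
  "act_from T j 0 f = f"
| "act_from T j (Suc m) f = act T j (act_from T (Suc j) m f)"

text \<open>For \<open>T\<close> the pullback along a map \<Phi> this is the classical alternating
  sum of \<open>f(x_0, ..., x_i, \<Phi> x_i, ..., \<Phi> x_p)\<close>. Taking an operator instead of
  a map lets convolution be treated in the same way.\<close>

definition prism :: "(('a \<Rightarrow> real) \<Rightarrow> 'a \<Rightarrow> real) \<Rightarrow> nat \<Rightarrow> ((nat \<Rightarrow> 'a) \<Rightarrow> real) \<Rightarrow> (nat \<Rightarrow> 'a) \<Rightarrow> real" where
  "prism T p f x = (\<Sum>i\<le>p. (-1) ^ i * act_from T (Suc i) (Suc p - i) f (dup i x))"

lemma dup_tuples: "x \<in> tuples p \<Longrightarrow> i \<le> p \<Longrightarrow> dup i x \<in> tuples (Suc p)"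
  by (auto simp: tuples_def dup_def)

lemma omit_dup_same: "omit i (dup i x) = x" "omit (Suc i) (dup i x) = x"
  by (auto simp: omit_def dup_def fun_eq_iff)

lemma omit_dup_less: "j \<le> i \<Longrightarrow> omit j (dup (Suc i) x) = dup i (omit j x)"
  by (auto simp: omit_def dup_def fun_eq_iff)

lemma omit_dup_greater: "i < j \<Longrightarrow> omit (Suc j) (dup i x) = dup i (omit j x)"
  by (auto simp: omit_def dup_def fun_eq_iff)

lemma dup_left_mult: "i \<le> p \<Longrightarrow> dup i (left_mult p g x) = left_mult (Suc p) g (dup i x)"
  by (auto simp: dup_def left_mult_def fun_eq_iff)

lemma act_omit_less:
  assumes "i \<le> j"
  shows "act T (Suc j) (\<lambda>x. f (omit i x)) = (\<lambda>x. act T j f (omit i x))"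
proof (rule ext)
  fix x :: "nat \<Rightarrow> 'a"
  have "omit i (x(Suc j := y)) = (omit i x)(j := y)" for y
    using assms by (auto simp: omit_def fun_eq_iff)
  then show "act T (Suc j) (\<lambda>x. f (omit i x)) x = act T j f (omit i x)"
    using assms by (simp add: act_def) (simp add: omit_def)
qed

lemma act_omit_greater:
  assumes "j < i"
  shows "act T j (\<lambda>x. f (omit i x)) = (\<lambda>x. act T j f (omit i x))"
proof (rule ext)
  fix x :: "nat \<Rightarrow> 'a"
  have "omit i (x(j := y)) = (omit i x)(j := y)" for y
    using assms by (auto simp: omit_def fun_eq_iff)
  then show "act T j (\<lambda>x. f (omit i x)) x = act T j f (omit i x)"
    using assms by (simp add: act_def) (simp add: omit_def)
qed

text \<open>The function does not depend on the omitted variable, and \<open>T\<close> fixes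
  constants.\<close>

lemma act_omit_same:
  assumes "\<And>c y. T (\<lambda>_. c) y = c"
  shows "act T i (\<lambda>x. f (omit i x)) = (\<lambda>x. f (omit i x))"
proof (rule ext)
  fix x :: "nat \<Rightarrow> 'a"
  have "omit i (x(i := y)) = omit i x" for y
    by (auto simp: omit_def fun_eq_iff)
  then show "act T i (\<lambda>x. f (omit i x)) x = f (omit i x)"
    by (simp add: act_def assms)
qed

lemma act_from_omit_less:
  "i \<le> a \<Longrightarrow> act_from T (Suc a) m (\<lambda>x. f (omit i x)) = (\<lambda>x. act_from T a m f (omit i x))"
  by (induction m arbitrary: a) (simp_all add: act_omit_less)

text \<open>Of the \<open>m + 1\<close> variables acted on, one is the omitted variable and
  contributes nothing; the others form a block of \<open>m\<close> after renumbering.\<close>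

lemma act_from_omit_mid:
  assumes c: "\<And>c y. T (\<lambda>_. c) y = c" and "a \<le> i" "i \<le> a + m"
  shows "act_from T a (Suc m) (\<lambda>x. f (omit i x)) = (\<lambda>x. act_from T a m f (omit i x))"
  using assms(2,3)
proof (induction m arbitrary: a)
  case 0
  then show ?case by (simp add: act_omit_same[of T, OF c])
next
  case (Suc m)
  show ?case
  proof (cases "i = a")
    case True
    then have "act_from T (Suc a) (Suc m) (\<lambda>x. f (omit i x)) = (\<lambda>x. act_from T a (Suc m) f (omit i x))"
      by (intro act_from_omit_less) simp
    then show ?thesis
      using True act_from.simps(2)[of T a "Suc m"] act_omit_same[of T, OF c, of i "act_from T a (Suc m) f"]
      by simp
  next
    case False
    then have "act_from T (Suc a) (Suc m) (\<lambda>x. f (omit i x)) = (\<lambda>x. act_from T (Suc a) m f (omit i x))"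
      using Suc.prems by (intro Suc.IH) auto
    then show ?thesis
      using False Suc.prems act_from.simps(2)[of T a "Suc m"] by (simp add: act_omit_greater)
  qed
qed

text \<open>The combinatorics of the prism, free of cochains: the diagonal and its upper neighbour
  telescope to the two ends, and the two remaining triangles fit together to the rectangle that is
  the coboundary of the prism.\<close>

lemma prism_sum:
  fixes a k :: "nat \<Rightarrow> nat \<Rightarrow> real"
  assumes zero: "\<And>i. i \<le> Suc p \<Longrightarrow> (\<Sum>j\<le>Suc (Suc p). (-1)^j * a i j) = 0"
    and diag: "\<And>i. i \<le> Suc p \<Longrightarrow> a i i = F i" "\<And>i. i \<le> Suc p \<Longrightarrow> a i (Suc i) = F (Suc i)"
    and low: "\<And>i j. j \<le> i \<Longrightarrow> i \<le> p \<Longrightarrow> a (Suc i) j = k i j"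
    and up: "\<And>i j. i < j \<Longrightarrow> j \<le> Suc p \<Longrightarrow> a i (Suc j) = k i j"
  shows "F 0 - F (Suc (Suc p)) = (\<Sum>j\<le>Suc p. (-1)^j * (\<Sum>i\<le>p. (-1)^i * k i j))"
proof -
  let ?t = "\<lambda>(i,j). (-1)^(i+j) * a i j"
  let ?s = "\<lambda>(i,j). (-1)^(i+j) * k i j"
  let ?D = "{(i,j). i \<le> Suc p \<and> j = i}" and ?D' = "{(i,j). i \<le> Suc p \<and> j = Suc i}"
  let ?L = "{(i,j). j < i \<and> i \<le> Suc p}" and ?U = "{(i,j). Suc i < j \<and> j \<le> Suc (Suc p)}"
  let ?L' = "{(i,j). j \<le> i \<and> i \<le> p}" and ?U' = "{(i,j). i < j \<and> j \<le> Suc p}"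
  have fin: "finite ?D" "finite ?D'" "finite ?L" "finite ?U" "finite ?L'" "finite ?U'"
    by (auto intro: finite_subset[of _ "{..Suc (Suc p)} \<times> {..Suc (Suc p)}"])
  have "0 = (\<Sum>i\<le>Suc p. (-1)^i * (\<Sum>j\<le>Suc (Suc p). (-1)^j * a i j))"
    by (rule sym, rule sum.neutral) (use zero in auto)
  also have "\<dots> = sum ?t ({..Suc p} \<times> {..Suc (Suc p)})"
    unfolding sum.cartesian_product[symmetric] sum_distrib_left power_add mult.assoc ..
  also have "{..Suc p} \<times> {..Suc (Suc p)} = (?D \<union> ?D') \<union> (?L \<union> ?U)" by auto
  also have "sum ?t \<dots> = (sum ?t ?D + sum ?t ?D') + (sum ?t ?L + sum ?t ?U)"
    by (subst sum.union_disjoint; (use fin in auto)?)+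
  also have "sum ?t ?D = (\<Sum>i\<le>Suc p. F i)"
    by (rule sum.reindex_bij_witness[of _ "\<lambda>i. (i,i)" fst]) (auto simp: diag power_add[symmetric] simp flip: mult_2)
  also have "sum ?t ?D' = (\<Sum>i\<le>Suc p. - F (Suc i))"
    by (rule sum.reindex_bij_witness[of _ "\<lambda>i. (i,Suc i)" fst]) (auto simp: diag power_add[symmetric] simp flip: mult_2)
  also have "(\<Sum>i\<le>Suc p. F i) + (\<Sum>i\<le>Suc p. - F (Suc i)) = F 0 - F (Suc (Suc p))"
    unfolding sum_negf using sum_telescope[of F "Suc p"] by (simp add: sum_subtractf)
  also have "sum ?t ?L = - sum ?s ?L'"
    unfolding sum_negf[symmetric]
  proof (rule sum.reindex_bij_witness[of _ "\<lambda>(i,j). (Suc i,j)" "\<lambda>(i,j). (i-1,j)"], goal_cases)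
    case (5 b)
    then obtain i j where "b = (Suc i, j)" "j \<le> i" "i \<le> p"
      by (cases b; cases "fst b") auto
    then show ?case by (simp add: low)
  qed auto
  also have "sum ?t ?U = - sum ?s ?U'"
    unfolding sum_negf[symmetric]
  proof (rule sum.reindex_bij_witness[of _ "\<lambda>(i,j). (i,Suc j)" "\<lambda>(i,j). (i,j-1)"], goal_cases)
    case (5 b)
    then obtain i j where "b = (i, Suc j)" "i < j" "j \<le> Suc p"
      by (cases b; cases "snd b") auto
    then show ?case by (simp add: up)
  qed auto
  also have "- sum ?s ?L' + - sum ?s ?U' = - sum ?s (?L' \<union> ?U')"
    by (subst sum.union_disjoint) (use fin in auto)
  also have "?L' \<union> ?U' = {..p} \<times> {..Suc p}" by auto
  also have "sum ?s \<dots> = (\<Sum>i\<le>p. \<Sum>j\<le>Suc p. (-1)^j * ((-1)^i * k i j))"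
    unfolding sum.cartesian_product[symmetric] by (simp only: power_add ac_simps)
  also have "\<dots> = (\<Sum>j\<le>Suc p. (-1)^j * (\<Sum>i\<le>p. (-1)^i * k i j))"
    unfolding sum_distrib_left by (rule sum.swap)
  finally show ?thesis by simp
qed

section \<open>Continuous bounded cochains and operators on a single variable\<close>

definition CB :: "nat \<Rightarrow> ((nat \<Rightarrow> real^'n^'n) \<Rightarrow> real) set" where
  "CB q = {f. continuous_on (tuples q) f \<and> (\<exists>C. \<forall>x\<in>tuples q. \<bar>f x\<bar> \<le> C)}"

lemma CB_I:
  fixes f :: "(nat \<Rightarrow> real^'n^'n) \<Rightarrow> real"
  assumes "\<And>u x. (\<And>n. u n \<in> tuples q) \<Longrightarrow> x \<in> tuples q \<Longrightarrow> (\<And>i. (\<lambda>n. u n i) \<longlonglongrightarrow> x i) \<Longrightarrow> (\<lambda>n. f (u n)) \<longlonglongrightarrow> f x"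
    and "\<And>x. x \<in> tuples q \<Longrightarrow> \<bar>f x\<bar> \<le> C"
  shows "f \<in> CB q"
  unfolding CB_def using assms
  by (auto intro!: continuous_on_sequentiallyI simp: tendsto_fun_iff)

lemma CB_tendsto:
  fixes f :: "(nat \<Rightarrow> real^'n^'n) \<Rightarrow> real"
  assumes "f \<in> CB q" "\<And>n. u n \<in> tuples q" "x \<in> tuples q" "\<And>i. (\<lambda>n. u n i) \<longlonglongrightarrow> x i"
  shows "(\<lambda>n. f (u n)) \<longlonglongrightarrow> f x"
proof -
  have "continuous_on (tuples q) f" using assms(1) by (simp add: CB_def)
  moreover have "u \<longlonglongrightarrow> x" using assms(4) by (simp add: tendsto_fun_iff)
  ultimately show ?thesis
    using assms(2,3) unfolding continuous_on_sequentially comp_def by blast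
qed

lemma CB_bound:
  assumes "f \<in> CB q"
  obtains C where "\<And>x. x \<in> tuples q \<Longrightarrow> \<bar>f x\<bar> \<le> C"
  using assms by (auto simp: CB_def)

lemma CB_compose:
  fixes f :: "(nat \<Rightarrow> real^'n^'n) \<Rightarrow> real"
  assumes f: "f \<in> CB q" and s: "\<And>x. x \<in> tuples p \<Longrightarrow> s x \<in> tuples q"
    and c: "\<And>u x. (\<And>n. u n \<in> tuples p) \<Longrightarrow> x \<in> tuples p \<Longrightarrow> (\<And>i. (\<lambda>n. u n i) \<longlonglongrightarrow> x i) \<Longrightarrow>
        (\<And>i. (\<lambda>n. s (u n) i) \<longlonglongrightarrow> s x i)"
  shows "(\<lambda>x. f (s x)) \<in> CB p"
proof -
  obtain C where C: "\<And>x. x \<in> tuples q \<Longrightarrow> \<bar>f x\<bar> \<le> C" using CB_bound[OF f] by blast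
  show ?thesis
    by (rule CB_I[where C = C]) (use C s in \<open>auto intro!: CB_tendsto[OF f] c\<close>)
qed

lemma CB_lin:
  fixes f :: "(nat \<Rightarrow> real^'n^'n) \<Rightarrow> real"
  shows "f \<in> CB q \<Longrightarrow> g \<in> CB q \<Longrightarrow> (\<lambda>x. a * f x + b * g x) \<in> CB q"
proof -
  assume f: "f \<in> CB q" and g: "g \<in> CB q"
  obtain C where C: "\<And>x. x \<in> tuples q \<Longrightarrow> \<bar>f x\<bar> \<le> C" using CB_bound[OF f] by blast
  obtain D where D: "\<And>x. x \<in> tuples q \<Longrightarrow> \<bar>g x\<bar> \<le> D" using CB_bound[OF g] by blast
  show ?thesis
  proof (rule CB_I[where C = "\<bar>a\<bar> * C + \<bar>b\<bar> * D"])
    fix x :: "nat \<Rightarrow> real^'n^'n" assume x: "x \<in> tuples q"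
    have "\<bar>a * f x + b * g x\<bar> \<le> \<bar>a\<bar> * \<bar>f x\<bar> + \<bar>b\<bar> * \<bar>g x\<bar>"
      using abs_triangle_ineq[of "a * f x" "b * g x"] by (simp add: abs_mult)
    also have "\<dots> \<le> \<bar>a\<bar> * C + \<bar>b\<bar> * D"
      by (intro add_mono mult_left_mono C D x) auto
    finally show "\<bar>a * f x + b * g x\<bar> \<le> \<bar>a\<bar> * C + \<bar>b\<bar> * D" .
  qed (intro tendsto_intros CB_tendsto[OF f] CB_tendsto[OF g])
qed

lemma CB_zero: "(\<lambda>_. 0) \<in> CB q"
  by (auto simp: CB_def)

lemma CB_sum: "(\<And>i. i \<in> I \<Longrightarrow> f i \<in> CB q) \<Longrightarrow> (\<lambda>x. \<Sum>i\<in>I. c i * f i x) \<in> CB q"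
proof (induction I rule: infinite_finite_induct)
  case (insert i I)
  then have "(\<lambda>x. c i * f i x + 1 * (\<Sum>i\<in>I. c i * f i x)) \<in> CB q" by (intro CB_lin) auto
  then show ?case using insert by simp
qed (auto simp: CB_zero)

lemma CB_omit: "f \<in> CB q \<Longrightarrow> i \<le> Suc q \<Longrightarrow> (\<lambda>x. f (omit i x)) \<in> CB (Suc q)"
  by (rule CB_compose, assumption, erule omit_tuples, assumption, simp add: omit_def)

lemma CB_dup: "f \<in> CB (Suc q) \<Longrightarrow> i \<le> q \<Longrightarrow> (\<lambda>x. f (dup i x)) \<in> CB q"
  by (rule CB_compose, assumption, erule dup_tuples, assumption, simp add: dup_def)

lemma update_tuples: "x \<in> tuples q \<Longrightarrow> j \<le> q \<Longrightarrow> y \<in> GLn \<Longrightarrow> x(j := y) \<in> tuples q"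
  by (auto simp: tuples_def)

lemma CB_slice:
  fixes f :: "(nat \<Rightarrow> real^'n^'n) \<Rightarrow> real"
  assumes f: "f \<in> CB q" and x: "x \<in> tuples q" "j \<le> q"
  shows "continuous_on GLn (\<lambda>y. f (x(j := y)))"
    and "\<exists>C. \<forall>y\<in>GLn. \<bar>f (x(j := y))\<bar> \<le> C"
proof -
  show "continuous_on GLn (\<lambda>y. f (x(j := y)))"
    by (rule continuous_on_sequentiallyI, rule CB_tendsto[OF f]) (use x in \<open>auto intro!: update_tuples\<close>)
  show "\<exists>C. \<forall>y\<in>GLn. \<bar>f (x(j := y))\<bar> \<le> C"
    using CB_bound[OF f] update_tuples[OF x] by metis
qed

definition CH :: "(real^'n^'n) set \<Rightarrow> nat \<Rightarrow> ((nat \<Rightarrow> real^'n^'n) \<Rightarrow> real) set" where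
  "CH H q = {f \<in> CB q. \<forall>h\<in>H. \<forall>x\<in>tuples q. f (left_mult q h x) = eps h * f x}"

text \<open>The common ground of pullback along a self-map and convolution. \<open>T_const\<close>
  gives compatibility with the faces, \<open>T_lin\<close> asks for linearity on bounded continuous
  functions so that integrals are covered, and \<open>T_equiv\<close> makes \<open>T\<close>
  preserve equivariance under \<open>H\<close>.\<close>

locale vertex_operator =
  fixes T :: "(real^'n^'n \<Rightarrow> real) \<Rightarrow> real^'n^'n \<Rightarrow> real" and H :: "(real^'n^'n) set"
  assumes H: "H \<subseteq> GLn"
    and T_const: "T (\<lambda>_. c) y = c"
    and T_cong: "(\<And>y. y \<in> GLn \<Longrightarrow> \<phi> y = \<psi> y) \<Longrightarrow> x \<in> GLn \<Longrightarrow> T \<phi> x = T \<psi> x"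
    and T_lin: "continuous_on GLn \<phi> \<Longrightarrow> \<exists>C. \<forall>y\<in>GLn. \<bar>\<phi> y\<bar> \<le> C \<Longrightarrow>
      continuous_on GLn \<psi> \<Longrightarrow> \<exists>C. \<forall>y\<in>GLn. \<bar>\<psi> y\<bar> \<le> C \<Longrightarrow> x \<in> GLn \<Longrightarrow>
      T (\<lambda>y. a * \<phi> y + b * \<psi> y) x = a * T \<phi> x + b * T \<psi> x"
    and T_CB: "f \<in> CB q \<Longrightarrow> j \<le> q \<Longrightarrow> act T j f \<in> CB q"
    and T_equiv: "h \<in> H \<Longrightarrow> y \<in> GLn \<Longrightarrow> T \<phi> (h ** y) = T (\<lambda>z. \<phi> (h ** z)) y"
begin

lemma act_cong:
  "(\<And>x. x \<in> tuples q \<Longrightarrow> f x = g x) \<Longrightarrow> x \<in> tuples q \<Longrightarrow> j \<le> q \<Longrightarrow> act T j f x = act T j g x"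
  unfolding act_def by (rule T_cong) (auto intro: update_tuples simp: tuples_iff)

lemma act_lin:
  "f \<in> CB q \<Longrightarrow> g \<in> CB q \<Longrightarrow> x \<in> tuples q \<Longrightarrow> j \<le> q \<Longrightarrow>
    act T j (\<lambda>x. a * f x + b * g x) x = a * act T j f x + b * act T j g x"
  unfolding act_def by (rule T_lin) (auto intro: CB_slice simp: tuples_iff)

lemma act_zero: "act T j (\<lambda>_. 0) = (\<lambda>_. 0)"
  by (simp add: act_def T_const fun_eq_iff)

lemma act_from_CB: "f \<in> CB q \<Longrightarrow> a + m \<le> Suc q \<Longrightarrow> act_from T a m f \<in> CB q"
  by (induction m arbitrary: a) (auto intro: T_CB)

lemma act_from_cong:
  "(\<And>x. x \<in> tuples q \<Longrightarrow> f x = g x) \<Longrightarrow> x \<in> tuples q \<Longrightarrow> a + m \<le> Suc q \<Longrightarrow>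
    act_from T a m f x = act_from T a m g x"
proof (induction m arbitrary: a x)
  case (Suc m)
  show ?case
    unfolding act_from.simps
    by (rule act_cong[of q]) (use Suc in auto)
qed simp

lemma act_from_zero: "act_from T a m (\<lambda>_. 0) = (\<lambda>_. 0)"
  by (induction m arbitrary: a) (simp_all add: act_zero)

lemma act_from_lin:
  assumes f: "f \<in> CB q" and g: "g \<in> CB q"
  shows "x \<in> tuples q \<Longrightarrow> k + m \<le> Suc q \<Longrightarrow>
    act_from T k m (\<lambda>x. a * f x + b * g x) x = a * act_from T k m f x + b * act_from T k m g x"
proof (induction m arbitrary: k x)
  case (Suc m)
  have "act_from T k (Suc m) (\<lambda>x. a * f x + b * g x) x =
      act T k (\<lambda>x. a * act_from T (Suc k) m f x + b * act_from T (Suc k) m g x) x"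
    unfolding act_from.simps by (rule act_cong[of q]) (use Suc in auto)
  also have "\<dots> = a * act_from T k (Suc m) f x + b * act_from T k (Suc m) g x"
    unfolding act_from.simps by (rule act_lin[of _ q]) (use Suc.prems in \<open>auto intro!: act_from_CB f g\<close>)
  finally show ?case .
qed simp

lemma act_from_sum:
  assumes "finite I" "\<And>i. i \<in> I \<Longrightarrow> f i \<in> CB q" "x \<in> tuples q" "k + m \<le> Suc q"
  shows "act_from T k m (\<lambda>x. \<Sum>i\<in>I. c i * f i x) x = (\<Sum>i\<in>I. c i * act_from T k m (f i) x)"
  using assms
proof (induction I rule: finite_induct)
  case (insert i I)
  have "act_from T k m (\<lambda>x. c i * f i x + 1 * (\<Sum>i\<in>I. c i * f i x)) x =
     c i * act_from T k m (f i) x + 1 * act_from T k m (\<lambda>x. \<Sum>i\<in>I. c i * f i x) x"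
    by (rule act_from_lin) (use insert in \<open>auto intro!: CB_sum\<close>)
  then show ?case using insert by simp
qed (simp add: act_from_zero)

lemma prism_CB: "f \<in> CB (Suc p) \<Longrightarrow> prism T p f \<in> CB p"
  unfolding prism_def[abs_def] by (intro CB_sum CB_dup act_from_CB) auto

text \<open>Take the cocycle relation at the degenerate tuple \<open>dup i x\<close>, with
  \<open>T\<close> applied to the variables after the i-th, and sum over \<open>i\<close> with
  signs. What is left is a primitive of the change that \<open>T\<close> makes to the
  cocycle.\<close>

lemma prism_homotopy:
  assumes f: "f \<in> CB (Suc p)" and z: "\<And>x. x \<in> tuples (Suc (Suc p)) \<Longrightarrow> cobd (Suc p) f x = 0"
    and x: "x \<in> tuples (Suc p)"
  shows "act_from T 0 (Suc (Suc p)) f x - f x = cobd p (prism T p f) x"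
proof -
  define a where "a i j = act_from T (Suc i) (Suc (Suc p) - i) (\<lambda>x. f (omit j x)) (dup i x)" for i j
  \<comment> \<open>\<open>F i\<close> has \<open>T\<close> in the variables from \<open>i\<close>
    on: \<open>F 0\<close> in all of them, \<open>F (Suc (Suc p))\<close> in none.\<close>
  define F where "F i = act_from T i (Suc (Suc p) - i) f x" for i
  define k where "k i j = act_from T (Suc i) (Suc p - i) f (dup i (omit j x))" for i j
  have "F 0 - F (Suc (Suc p)) = (\<Sum>j\<le>Suc p. (-1)^j * (\<Sum>i\<le>p. (-1)^i * k i j))"
  proof (rule prism_sum[where a = a])
    fix i assume i: "i \<le> Suc p"
    have "(\<Sum>j\<le>Suc (Suc p). (-1)^j * a i j) = act_from T (Suc i) (Suc (Suc p) - i) (cobd (Suc p) f) (dup i x)"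
      unfolding a_def cobd_def[abs_def]
      by (rule act_from_sum[symmetric]) (use i x in \<open>auto intro!: CB_omit f dup_tuples\<close>)
    also have "\<dots> = act_from T (Suc i) (Suc (Suc p) - i) (\<lambda>_. 0) (dup i x)"
      by (rule act_from_cong[of "Suc (Suc p)"]) (use i x z in \<open>auto intro!: dup_tuples\<close>)
    finally show "(\<Sum>j\<le>Suc (Suc p). (-1)^j * a i j) = 0" by (simp add: act_from_zero)
    show "a i i = F i"
      unfolding a_def F_def by (simp add: act_from_omit_less omit_dup_same)
    have "act_from T (Suc i) (Suc (Suc p - i)) (\<lambda>x. f (omit (Suc i) x)) = (\<lambda>x. act_from T (Suc i) (Suc p - i) f (omit (Suc i) x))"
      by (rule act_from_omit_mid[of T, OF T_const]) (use i in auto)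
    then show "a i (Suc i) = F (Suc i)"
      unfolding a_def F_def using i by (simp add: omit_dup_same Suc_diff_le del: act_from.simps)
  next
    fix i j assume "j \<le> i" "i \<le> p"
    then show "a (Suc i) j = k i j"
      unfolding a_def k_def by (simp add: act_from_omit_less omit_dup_less del: act_from.simps)
  next
    fix i j assume ij: "i < j" "j \<le> Suc p"
    have "act_from T (Suc i) (Suc (Suc p - i)) (\<lambda>x. f (omit (Suc j) x)) = (\<lambda>x. act_from T (Suc i) (Suc p - i) f (omit (Suc j) x))"
      by (rule act_from_omit_mid[of T, OF T_const]) (use ij in auto)
    then show "a i (Suc j) = k i j"
      unfolding a_def k_def using ij by (simp add: omit_dup_greater Suc_diff_le del: act_from.simps)
  qed
  then show ?thesis
    by (simp add: F_def k_def cobd_def prism_def del: act_from.simps(2) sum.atMost_Suc)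
qed

lemma act_CH:
  assumes f: "f \<in> CH H q" and j: "j \<le> q"
  shows "act T j f \<in> CH H q"
proof -
  have fC: "f \<in> CB q" using f by (simp add: CH_def)
  have "act T j f (left_mult q h x) = eps h * act T j f x" if h: "h \<in> H" and x: "x \<in> tuples q" for h x
  proof -
    have hG: "h \<in> GLn" using H h by blast
    have upd: "(left_mult q h x)(j := h ** y) = left_mult q h (x(j := y))" for y
      using j by (auto simp: left_mult_def fun_eq_iff)
    have "act T j f (left_mult q h x) = T (\<lambda>y. f ((left_mult q h x)(j := y))) (h ** x j)"
      using j by (simp add: act_def left_mult_def)
    also have "\<dots> = T (\<lambda>y. f ((left_mult q h x)(j := h ** y))) (x j)"
      using x j by (intro T_equiv h) (auto simp: tuples_iff)
    also have "\<dots> = act T j (\<lambda>x. f (left_mult q h x)) x"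
      by (simp add: upd act_def)
    also have "\<dots> = act T j (\<lambda>x. eps h * f x + 0 * f x) x"
      by (rule act_cong[of q]) (use f h x j in \<open>auto simp: CH_def\<close>)
    also have "\<dots> = eps h * act T j f x"
      by (subst act_lin[OF fC fC x j]) simp
    finally show ?thesis .
  qed
  then show ?thesis using T_CB[OF fC j] by (simp add: CH_def)
qed

lemma act_from_CH: "f \<in> CH H q \<Longrightarrow> a + m \<le> Suc q \<Longrightarrow> act_from T a m f \<in> CH H q"
  by (induction m arbitrary: a) (auto intro: act_CH)

lemma prism_CH:
  assumes f: "f \<in> CH H (Suc p)"
  shows "prism T p f \<in> CH H p"
proof -
  have "prism T p f (left_mult p h x) = eps h * prism T p f x" if h: "h \<in> H" and x: "x \<in> tuples p" for h x
  proof -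
    have "act_from T (Suc i) (Suc p - i) f (dup i (left_mult p h x)) =
        eps h * act_from T (Suc i) (Suc p - i) f (dup i x)" if i: "i \<le> p" for i
      using act_from_CH[OF f, of "Suc i" "Suc p - i"] i h x
      by (auto simp: dup_left_mult CH_def intro!: dup_tuples)
    then show ?thesis
      unfolding prism_def sum_distrib_left by (intro sum.cong) auto
  qed
  moreover have "prism T p f \<in> CB p" using f by (intro prism_CB) (simp add: CH_def)
  ultimately show ?thesis by (simp add: CH_def)
qed

end

lemma vertex_operator_map:
  fixes \<Phi> :: "real^'n^'n \<Rightarrow> real^'n^'n"
  assumes H: "H \<subseteq> GLn" and G: "\<And>x. x \<in> GLn \<Longrightarrow> \<Phi> x \<in> GLn"
    and equiv: "\<And>h x. h \<in> H \<Longrightarrow> x \<in> GLn \<Longrightarrow> \<Phi> (h ** x) = h ** \<Phi> x"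
    and cont: "\<And>u x. (\<And>n. u n \<in> GLn) \<Longrightarrow> x \<in> GLn \<Longrightarrow> u \<longlonglongrightarrow> x \<Longrightarrow> (\<lambda>n. \<Phi> (u n)) \<longlonglongrightarrow> \<Phi> x"
  shows "vertex_operator (\<lambda>\<phi> x. \<phi> (\<Phi> x)) H"
proof
  fix f :: "(nat \<Rightarrow> real^'n^'n) \<Rightarrow> real" and q j
  assume f: "f \<in> CB q" and j: "j \<le> q"
  show "act (\<lambda>\<phi> x. \<phi> (\<Phi> x)) j f \<in> CB q"
    unfolding act_def[abs_def]
  proof (rule CB_compose[OF f])
    show "x(j := \<Phi> (x j)) \<in> tuples q" if "x \<in> tuples q" for x
      using that j by (auto simp: tuples_iff G)
    fix u :: "nat \<Rightarrow> nat \<Rightarrow> real^'n^'n" and x i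
    assume "\<And>n. u n \<in> tuples q" "x \<in> tuples q" "\<And>i. (\<lambda>n. u n i) \<longlonglongrightarrow> x i"
    then show "(\<lambda>n. ((u n)(j := \<Phi> (u n j))) i) \<longlonglongrightarrow> (x(j := \<Phi> (x j))) i"
      using j by (auto intro!: cont simp: tuples_iff)
  qed
qed (use H G equiv in auto)

lemma act_from_map:
  "act_from (\<lambda>\<phi> x. \<phi> (\<Phi> x)) a m f x = f (\<lambda>j. if a \<le> j \<and> j < a + m then \<Phi> (x j) else x j)"
proof (induction m arbitrary: a x)
  case (Suc m)
  have "(\<lambda>j. if Suc a \<le> j \<and> j < Suc a + m then \<Phi> ((x(a := \<Phi> (x a))) j) else (x(a := \<Phi> (x a))) j) =
    (\<lambda>j. if a \<le> j \<and> j < a + Suc m then \<Phi> (x j) else x j)"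
    by (auto simp: fun_eq_iff)
  then show ?case by (simp add: act_def Suc)
next
  case 0
  have "(\<lambda>j. if a \<le> j \<and> j < a + 0 then \<Phi> (x j) else x j) = x" by (auto simp: fun_eq_iff)
  then show ?case by (simp only: act_from.simps)
qed

section \<open>Convolution and uniform continuity\<close>

definition smooth :: "(real^'n^'n \<Rightarrow> real) \<Rightarrow> real^'n^'n \<Rightarrow> real" where
  "smooth \<phi> x = (\<integral>k. bump k * \<phi> (x ** k) \<partial>lborel)"

lemma integrable_bump_mult:
  fixes \<phi> :: "real^'n^'n \<Rightarrow> real"
  assumes "continuous_on GLn \<phi>" "\<And>k. k \<in> GLn \<Longrightarrow> \<bar>\<phi> k\<bar> \<le> C"
  shows "(\<lambda>k. bump k * \<phi> k) \<in> borel_measurable borel"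
    and "integrable lborel (\<lambda>k. bump k * \<phi> k)"
    and "\<bar>\<integral>k. bump k * \<phi> k \<partial>lborel\<bar> \<le> C"
proof -
  note * = integrable_mult_continuous_on_GLn[where \<psi> = "bump :: real^'n^'n \<Rightarrow> real", OF continuous_bump _ integrable_bump assms]
  show "(\<lambda>k. bump k * \<phi> k) \<in> borel_measurable borel" "integrable lborel (\<lambda>k. bump k * \<phi> k)"
    by (rule *; simp add: bump_GLn)+
  show "\<bar>\<integral>k. bump k * \<phi> k \<partial>lborel\<bar> \<le> C"
    using *(3) by (simp add: bump_GLn abs_of_nonneg[OF bump_nonneg] integral_bump)
qed

lemma continuous_on_mult_GLn:
  assumes "continuous_on GLn \<phi>" "(x :: real^'n^'n) \<in> GLn"
  shows "continuous_on GLn (\<lambda>k. \<phi> (x ** k))"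
proof (rule continuous_on_compose2[OF assms(1)])
  show "continuous_on GLn ((**) x)"
    by (rule linear_continuous_on) (use linear_matrix_mult_left[of x] in \<open>simp add: linear_conv_bounded_linear\<close>)
qed (use assms in \<open>auto intro: GLn_mult\<close>)

text \<open>The integration variable multiplies on the right, so left translation passes through the
  integral and equivariance survives for every \<open>H\<close>.\<close>

lemma vertex_operator_smooth:
  assumes H: "H \<subseteq> (GLn :: (real^'n^'n) set)"
  shows "vertex_operator smooth H"
proof
  show "smooth (\<lambda>_. c) y = c" for c and y :: "real^'n^'n"
    by (simp add: smooth_def integral_bump)
  show "smooth \<phi> x = smooth \<psi> x" if "\<And>y. y \<in> GLn \<Longrightarrow> \<phi> y = \<psi> y" "x \<in> GLn" for \<phi> \<psi> and x :: "real^'n^'n"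
    unfolding smooth_def
  proof (rule Bochner_Integration.integral_cong[OF refl])
    fix k :: "real^'n^'n"
    show "bump k * \<phi> (x ** k) = bump k * \<psi> (x ** k)"
      using that bump_GLn[of k] by (cases "bump k = 0") (auto simp: GLn_mult)
  qed
  show "smooth (\<lambda>y. a * \<phi> y + b * \<psi> y) x = a * smooth \<phi> x + b * smooth \<psi> x"
    if "continuous_on GLn \<phi>" "\<exists>C. \<forall>y\<in>GLn. \<bar>\<phi> y\<bar> \<le> C" "continuous_on GLn \<psi>" "\<exists>C. \<forall>y\<in>GLn. \<bar>\<psi> y\<bar> \<le> C" and x: "x \<in> GLn"
    for \<phi> \<psi> a b and x :: "real^'n^'n"
  proof -
    have *: "integrable lborel (\<lambda>k. bump k * \<theta> (x ** k))"
      if \<theta>: "continuous_on GLn \<theta>" "\<exists>C. \<forall>y\<in>GLn. \<bar>\<theta> y\<bar> \<le> C" for \<theta>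
    proof -
      obtain C where C: "\<And>y. y \<in> GLn \<Longrightarrow> \<bar>\<theta> y\<bar> \<le> C" using \<theta>(2) by blast
      show ?thesis
        by (rule integrable_bump_mult(2)[where C = C, OF continuous_on_mult_GLn[OF \<theta>(1) x]])
           (auto intro!: C GLn_mult x)
    qed
    have "smooth (\<lambda>y. a * \<phi> y + b * \<psi> y) x =
        (\<integral>k. a * (bump k * \<phi> (x ** k)) + b * (bump k * \<psi> (x ** k)) \<partial>lborel)"
      unfolding smooth_def by (simp add: algebra_simps)
    also have "\<dots> = a * smooth \<phi> x + b * smooth \<psi> x"
      unfolding smooth_def using *[OF that(1,2)] *[OF that(3,4)] by simp
    finally show ?thesis .
  qed
  show "act smooth j f \<in> CB q" if f: "f \<in> CB q" and j: "j \<le> q"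
    for f :: "(nat \<Rightarrow> real^'n^'n) \<Rightarrow> real" and q j
  proof -
    obtain C where C: "\<And>x. x \<in> tuples q \<Longrightarrow> \<bar>f x\<bar> \<le> C" using CB_bound[OF f] by blast
    have ct: "continuous_on GLn (\<lambda>k. f (x(j := x j ** k)))" if x: "x \<in> tuples q" for x
      using continuous_on_mult_GLn[OF CB_slice(1)[OF f x j], of "x j"] x j by (simp add: tuples_iff)
    have tt: "x(j := x j ** k) \<in> tuples q" if "x \<in> tuples q" "k \<in> GLn" for x k
      using that j by (auto intro!: update_tuples GLn_mult simp: tuples_iff)
    have bd: "\<bar>bump k * f (x(j := x j ** k))\<bar> \<le> C * bump k" if "x \<in> tuples q" for x k
    proof (cases "bump k = 0")
      case False
      then show ?thesis
        using mult_right_mono[OF C[OF tt[OF that bump_GLn[OF False]]] bump_nonneg[of k]]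
        by (simp add: abs_mult abs_of_nonneg[OF bump_nonneg] mult.commute)
    qed simp
    note M = integrable_bump_mult[where C = C, OF ct]
    show ?thesis
    proof (rule CB_I[where C = C])
      fix x :: "nat \<Rightarrow> real^'n^'n" assume x: "x \<in> tuples q"
      show "\<bar>act smooth j f x\<bar> \<le> C"
        using M(3)[OF x] C[OF tt[OF x]] by (simp add: act_def smooth_def)
    next
      fix u :: "nat \<Rightarrow> nat \<Rightarrow> real^'n^'n" and x
      assume u: "\<And>n. u n \<in> tuples q" and x: "x \<in> tuples q" and lim: "\<And>i. (\<lambda>n. u n i) \<longlonglongrightarrow> x i"
      show "(\<lambda>n. act smooth j f (u n)) \<longlonglongrightarrow> act smooth j f x"
        unfolding act_def smooth_def
      proof (rule integral_dominated_convergence[where w = "\<lambda>k. C * bump k"])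
        show "(\<lambda>k. bump k * f (x(j := x j ** k))) \<in> borel_measurable lborel"
          using M(1)[OF x] C[OF tt[OF x]] by simp
        show "(\<lambda>k. bump k * f ((u n)(j := u n j ** k))) \<in> borel_measurable lborel" for n
          using M(1)[OF u] C[OF tt[OF u]] by simp
        show "integrable lborel (\<lambda>k::real^'n^'n. C * bump k)" by (intro integrable_mult_right integrable_bump)
        show "AE k in lborel. (\<lambda>n. bump k * f ((u n)(j := u n j ** k))) \<longlonglongrightarrow> bump k * f (x(j := x j ** k))"
        proof (rule AE_I2)
          fix k :: "real^'n^'n"
          show "(\<lambda>n. bump k * f ((u n)(j := u n j ** k))) \<longlonglongrightarrow> bump k * f (x(j := x j ** k))"
          proof (cases "bump k = 0")
            case False
            then have k: "k \<in> GLn" by (rule bump_GLn)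
            show ?thesis
              by (intro tendsto_mult tendsto_const CB_tendsto[OF f] tt u x k)
                 (auto intro!: tendsto_matrix_mult lim)
          qed simp
        qed
        show "AE k in lborel. norm (bump k * f ((u n)(j := u n j ** k))) \<le> C * bump k" for n
          using bd[OF u] by simp
      qed
    qed
  qed
qed (use H in \<open>auto simp: smooth_def matrix_mul_assoc\<close>)

text \<open>Closeness of two entries is measured by the right factor \<open>m\<close>, a notion
  unchanged by left translation. It is also the one for which the squeezing maps are equicontinuous
  uniformly in the squeezing factor.\<close>

definition uniform_at :: "nat \<Rightarrow> nat \<Rightarrow> ((nat \<Rightarrow> real^'n^'n) \<Rightarrow> real) \<Rightarrow> bool" where
  "uniform_at q j f \<longleftrightarrow> (\<forall>e>0. \<exists>d>0. \<forall>x\<in>tuples q. \<forall>m\<in>GLn. norm (m - mat 1) < d \<longrightarrow>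
     \<bar>f (x(j := x j ** m)) - f x\<bar> \<le> e)"

text \<open>\<open>bump_translate\<close> is applied to \<open>f\<close> as a function of its j-th
  entry. Its bound involves only the supremum of \<open>f\<close>, so \<open>d\<close> does not
  depend on the tuple.\<close>

lemma uniform_at_smooth_same:
  fixes f :: "(nat \<Rightarrow> real^'n^'n) \<Rightarrow> real"
  assumes f: "f \<in> CB q" and j: "j \<le> q"
  shows "uniform_at q j (act smooth j f)"
  unfolding uniform_at_def
proof (intro allI impI)
  fix e :: real assume "e > 0"
  obtain C0 where C0: "\<And>x. x \<in> tuples q \<Longrightarrow> \<bar>f x\<bar> \<le> C0" using CB_bound[OF f] by blast
  \<comment> \<open>Enlarged to be positive, so that it can be divided by.\<close>
  define C where "C = \<bar>C0\<bar> + 1"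
  have C: "\<bar>f x\<bar> \<le> C" if "x \<in> tuples q" for x using C0[OF that] by (simp add: C_def)
  have "C > 0" by (simp add: C_def)
  then have "e / C > 0" using \<open>e > 0\<close> by simp
  then show "\<exists>d>0. \<forall>x\<in>tuples q. \<forall>m\<in>GLn. norm (m - mat 1) < d \<longrightarrow>
     \<bar>act smooth j f (x(j := x j ** m)) - act smooth j f x\<bar> \<le> e"
  proof (rule bump_translate[where 'n = 'n])
    fix d :: real
    assume d: "d > 0" "\<And>(m :: real^'n^'n) (\<phi> :: real^'n^'n \<Rightarrow> real) C'.
      \<lbrakk>norm (m - mat 1) < d; continuous_on GLn \<phi>; \<And>k. k \<in> GLn \<Longrightarrow> \<bar>\<phi> k\<bar> \<le> C'\<rbrakk> \<Longrightarrow>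
      \<bar>(\<integral>k. bump k * \<phi> (m ** k) \<partial>lborel) - (\<integral>k. bump k * \<phi> k \<partial>lborel)\<bar> \<le> C' * (e / C)"
    show ?thesis
    proof (intro exI[of _ d] conjI ballI impI)
      fix x :: "nat \<Rightarrow> real^'n^'n" and m :: "real^'n^'n" assume x: "x \<in> tuples q" and m: "m \<in> GLn" "norm (m - mat 1) < d"
      have xj: "x j \<in> GLn" using x j by (simp add: tuples_iff)
      have "\<bar>(\<integral>k. bump k * f (x(j := x j ** (m ** k))) \<partial>lborel) - (\<integral>k. bump k * f (x(j := x j ** k)) \<partial>lborel)\<bar> \<le> C * (e / C)"
        by (rule d(2)[OF m(2), of "\<lambda>k. f (x(j := x j ** k))"])
           (use xj in \<open>auto intro!: C update_tuples x j GLn_mult continuous_on_mult_GLn[OF CB_slice(1)[OF f x j]]\<close>)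
      then show "\<bar>act smooth j f (x(j := x j ** m)) - act smooth j f x\<bar> \<le> e"
        using \<open>C > 0\<close> by (simp add: act_def smooth_def matrix_mul_assoc)
    qed (use d in simp)
  qed
qed

text \<open>Averaging in one variable does not worsen a modulus of continuity in another, so
  smoothing the variables in turn keeps what was gained.\<close>

lemma uniform_at_smooth_other:
  fixes f :: "(nat \<Rightarrow> real^'n^'n) \<Rightarrow> real"
  assumes f: "f \<in> CB q" and j: "j \<le> q" and i: "i \<le> q" "i \<noteq> j" and u: "uniform_at q i f"
  shows "uniform_at q i (act smooth j f)"
  unfolding uniform_at_def
proof (intro allI impI)
  fix e :: real assume "e > 0"
  then obtain d where d: "d > 0" "\<And>x m. x \<in> tuples q \<Longrightarrow> m \<in> GLn \<Longrightarrow> norm (m - mat 1) < d \<Longrightarrow>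
     \<bar>f (x(i := x i ** m)) - f x\<bar> \<le> e"
    using u unfolding uniform_at_def by metis
  obtain C where C: "\<And>x. x \<in> tuples q \<Longrightarrow> \<bar>f x\<bar> \<le> C" using CB_bound[OF f] by blast
  show "\<exists>d>0. \<forall>x\<in>tuples q. \<forall>m\<in>GLn. norm (m - mat 1) < d \<longrightarrow>
     \<bar>act smooth j f (x(i := x i ** m)) - act smooth j f x\<bar> \<le> e"
  proof (intro exI[of _ d] conjI ballI impI)
    fix x :: "nat \<Rightarrow> real^'n^'n" and m :: "real^'n^'n" assume x: "x \<in> tuples q" and m: "m \<in> GLn" "norm (m - mat 1) < d"
    let ?x = "x(i := x i ** m)"
    have x': "?x \<in> tuples q" using x m i by (auto intro!: update_tuples GLn_mult simp: tuples_iff)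
    have xj: "x j \<in> GLn" using x j by (simp add: tuples_iff)
    have c: "continuous_on GLn (\<lambda>k. f (x(j := x j ** k)))" "continuous_on GLn (\<lambda>k. f (?x(j := x j ** k)))"
      using continuous_on_mult_GLn[OF CB_slice(1)[OF f x j] xj]
        continuous_on_mult_GLn[OF CB_slice(1)[OF f x' j] xj] by auto
    have t: "x(j := x j ** k) \<in> tuples q" "?x(j := x j ** k) \<in> tuples q" if "k \<in> GLn" for k
      using that xj x x' j by (auto intro!: update_tuples GLn_mult)
    have int: "integrable lborel (\<lambda>k. bump k * f (x(j := x j ** k)))" "integrable lborel (\<lambda>k. bump k * f (?x(j := x j ** k)))"
      by (rule integrable_bump_mult(2)[OF c(1), of C] integrable_bump_mult(2)[OF c(2), of C]; rule C; rule t; assumption)+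
    have "act smooth j f ?x - act smooth j f x = (\<integral>k. bump k * (f (?x(j := x j ** k)) - f (x(j := x j ** k))) \<partial>lborel)"
      unfolding right_diff_distrib Bochner_Integration.integral_diff[OF int(2,1)]
      using i by (simp add: act_def smooth_def)
    also have "\<bar>\<dots>\<bar> \<le> e"
    proof (rule integrable_bump_mult(3))
      show "continuous_on GLn (\<lambda>k. f (?x(j := x j ** k)) - f (x(j := x j ** k)))"
        by (intro continuous_on_diff c)
      fix k :: "real^'n^'n" assume k: "k \<in> GLn"
      have "?x(j := x j ** k) = (x(j := x j ** k))(i := (x(j := x j ** k)) i ** m)"
        using i by (auto simp: fun_eq_iff)
      then show "\<bar>f (?x(j := x j ** k)) - f (x(j := x j ** k))\<bar> \<le> e"
        using d(2)[OF t(1)[OF k] m] by simp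
    qed
    finally show "\<bar>act smooth j f ?x - act smooth j f x\<bar> \<le> e" .
  qed (use d in simp)
qed

lemma uniform_at_act_from_smooth:
  fixes f :: "(nat \<Rightarrow> real^'n^'n) \<Rightarrow> real"
  assumes f: "f \<in> CB q"
  shows "a + m \<le> Suc q \<Longrightarrow> a \<le> i \<Longrightarrow> i < a + m \<Longrightarrow> uniform_at q i (act_from smooth a m f)"
proof (induction m arbitrary: a)
  case (Suc m)
  interpret vertex_operator smooth "{} :: (real^'n^'n) set" by (rule vertex_operator_smooth) simp
  have c: "act_from smooth (Suc a) m f \<in> CB q"
    using Suc.prems by (intro act_from_CB f) auto
  show ?case
  proof (cases "i = a")
    case True
    then show ?thesis using Suc.prems c by (auto intro!: uniform_at_smooth_same)
  next
    case False
    then show ?thesis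
      using Suc c by (auto intro!: uniform_at_smooth_other)
  qed
qed simp

definition unif :: "nat \<Rightarrow> ((nat \<Rightarrow> real^'n^'n) \<Rightarrow> real) \<Rightarrow> bool" where
  "unif q f \<longleftrightarrow> (\<forall>e>0. \<exists>d>0. \<forall>x\<in>tuples q. \<forall>y\<in>tuples q.
     (\<forall>i\<le>q. norm (matrix_inv (x i) ** y i - mat 1) < d) \<longrightarrow> \<bar>f y - f x\<bar> < e)"

text \<open>The entries of \<open>x\<close> are exchanged for those of \<open>y\<close> one at a
  time.\<close>

lemma unif_if_uniform_at:
  fixes f :: "(nat \<Rightarrow> real^'n^'n) \<Rightarrow> real"
  assumes u: "\<And>i. i \<le> q \<Longrightarrow> uniform_at q i f"
  shows "unif q f"
  unfolding unif_def
proof (intro allI impI)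
  fix e :: real assume "e > 0"
  \<comment> \<open>There are \<open>q + 1\<close> exchanges with error at most \<open>e'\<close>
    each; \<open>q + 2\<close> leaves the inequality strict.\<close>
  define e' where "e' = e / (q + 2)"
  have e': "e' > 0" using \<open>e > 0\<close> by (simp add: e'_def)
  have "\<forall>i. \<exists>d>0. i \<le> q \<longrightarrow> (\<forall>x\<in>tuples q. \<forall>m\<in>GLn. norm (m - mat 1) < d \<longrightarrow>
     \<bar>f (x(i := x i ** m)) - f x\<bar> \<le> e')"
    using u e' unfolding uniform_at_def by (metis zero_less_one)
  then obtain d where d: "\<And>i. d i > 0" "\<And>i x m. i \<le> q \<Longrightarrow> x \<in> tuples q \<Longrightarrow> m \<in> GLn \<Longrightarrow> norm (m - mat 1) < d i \<Longrightarrow>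
     \<bar>f (x(i := x i ** m)) - f x\<bar> \<le> e'"
    by metis
  define D where "D = Min (d ` {..q})"
  have D: "D > 0" "\<And>i. i \<le> q \<Longrightarrow> D \<le> d i" using d(1) by (auto simp: D_def)
  show "\<exists>d>0. \<forall>x\<in>tuples q. \<forall>y\<in>tuples q.
     (\<forall>i\<le>q. norm (matrix_inv (x i) ** y i - mat 1) < d) \<longrightarrow> \<bar>f y - f x\<bar> < e"
  proof (intro exI[of _ D] conjI ballI impI)
    fix x y :: "nat \<Rightarrow> real^'n^'n"
    assume x: "x \<in> tuples q" and y: "y \<in> tuples q" and c: "\<forall>i\<le>q. norm (matrix_inv (x i) ** y i - mat 1) < D"
    have *: "\<bar>f (\<lambda>i. if i < l then y i else x i) - f x\<bar> \<le> l * e'" if "l \<le> Suc q" for l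
      using that
    proof (induction l)
      case (Suc l)
      let ?z = "\<lambda>i. if i < l then y i else x i"
      have "(\<lambda>i. if i < Suc l then y i else x i) = ?z(l := ?z l ** (matrix_inv (x l) ** y l))"
        using x Suc.prems by (auto simp: fun_eq_iff less_Suc_eq matrix_inv_cancel tuples_iff)
      moreover have "\<bar>f (?z(l := ?z l ** (matrix_inv (x l) ** y l))) - f ?z\<bar> \<le> e'"
      proof (rule d(2))
        show "norm (matrix_inv (x l) ** y l - mat 1) < d l"
          using c D(2)[of l] Suc.prems by fastforce
      qed (use x y Suc.prems in \<open>auto simp: tuples_iff intro!: GLn_mult GLn_inv\<close>)
      ultimately show ?case using Suc by (simp add: algebra_simps)
    qed simp
    have "(\<lambda>i. if i < Suc q then y i else x i) = y" using x y by (auto simp: tuples_iff fun_eq_iff)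
    then have "\<bar>f y - f x\<bar> \<le> Suc q * e'" using *[of "Suc q"] by simp
    also have "\<dots> < e" using \<open>e > 0\<close> by (simp add: e'_def field_simps)
    finally show "\<bar>f y - f x\<bar> < e" .
  qed (use D in simp)
qed

text \<open>Tychonoff's theorem in place of a convergence argument: a cluster point in the product
  of intervals approximates on any finite set at once, for arbitrarily large \<open>m\<close>,
  although no subsequence need converge.\<close>

lemma cluster_function:
  fixes k :: "nat \<Rightarrow> 'a \<Rightarrow> real"
  assumes bd: "\<And>m x. \<bar>k m x\<bar> \<le> C"
  obtains k0 where "\<And>A e M. finite A \<Longrightarrow> e > 0 \<Longrightarrow> \<exists>m\<ge>M. \<forall>x\<in>A. \<bar>k m x - k0 x\<bar> < e"
proof -
  let ?K = "PiE UNIV (\<lambda>_::'a. {-C..C})"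
  have "compactin (product_topology (\<lambda>_::'a. euclidean :: real topology) UNIV) ?K"
    by (simp add: compactin_PiE)
  then have "compact ?K" by (simp add: euclidean_product_topology)
  moreover have "eventually (\<lambda>f. f \<in> ?K) (filtermap k sequentially)"
  proof -
    have "- C \<le> k m x \<and> k m x \<le> C" for m x using bd[of m x] by linarith
    then show ?thesis by (simp add: eventually_filtermap PiE_iff)
  qed
  moreover have "filtermap k sequentially \<noteq> bot" by (simp add: filtermap_bot_iff)
  ultimately obtain k0 where k0: "inf (nhds k0) (filtermap k sequentially) \<noteq> bot"
    unfolding compact_filter by blast
  show ?thesis
  proof (rule that)
    fix A :: "'a set" and e :: real and M :: nat assume A: "finite A" and e: "e > 0"
    let ?U = "\<Inter>x\<in>A. {f :: 'a \<Rightarrow> real. \<bar>f x - k0 x\<bar> < e}"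
    have "open ?U"
      using A by (intro open_INT ballI open_Collect_less continuous_intros) auto
    moreover have "k0 \<in> ?U" using e by simp
    ultimately have n: "eventually (\<lambda>f. f \<in> ?U) (nhds k0)" by (rule eventually_nhds_in_open)
    show "\<exists>m\<ge>M. \<forall>x\<in>A. \<bar>k m x - k0 x\<bar> < e"
    proof (rule ccontr)
      assume "\<not> ?thesis"
      then have "eventually (\<lambda>m. k m \<notin> ?U) sequentially"
        by (auto intro!: eventually_sequentiallyI[of M])
      then have "eventually (\<lambda>f. f \<notin> ?U) (filtermap k sequentially)"
        by (simp add: eventually_filtermap)
      with n have "eventually (\<lambda>f. False) (inf (nhds k0) (filtermap k sequentially))"
        unfolding eventually_inf by blast
      then show False using k0 by (simp add: trivial_limit_def)
    qed
  qed
qed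

subsection \<open>Squeezing towards a coordinate subspace\<close>

lemma matrix_ring_simps:
  fixes A B C :: "real^'n^'n"
  shows "(A - B) ** C = A ** C - B ** C" "A ** (B - C) = A ** B - A ** C"
    "(A + B) ** C = A ** C + B ** C" "A ** (B + C) = A ** B + A ** C"
    "(c *\<^sub>R A) ** B = c *\<^sub>R (A ** B)" "A ** (c *\<^sub>R B) = c *\<^sub>R (A ** B)"
    "0 ** A = 0" "A ** 0 = 0"
  by (simp_all add: matrix_matrix_mult_def vec_eq_iff sum_subtractf sum.distrib sum_distrib_left algebra_simps)

definition dg :: "'n set \<Rightarrow> real^'n^'n" where
  "dg A = (\<chi> i j. if i = j \<and> i \<in> A then 1 else 0)"

lemma dg_mult_nth: "(dg A ** M) $ i $ j = (if i \<in> A then M $ i $ j else 0)"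
  and mult_dg_nth: "(M ** dg A) $ i $ j = (if j \<in> A then M $ i $ j else 0)"
proof -
  have "(dg A ** M) $ i $ j = (\<Sum>k\<in>UNIV. if k = i then (if i \<in> A then M $ i $ j else 0) else 0)"
    unfolding matrix_matrix_mult_def dg_def vec_lambda_beta by (intro sum.cong) auto
  then show "(dg A ** M) $ i $ j = (if i \<in> A then M $ i $ j else 0)" by simp
  have "(M ** dg A) $ i $ j = (\<Sum>k\<in>UNIV. if k = j then (if j \<in> A then M $ i $ j else 0) else 0)"
    unfolding matrix_matrix_mult_def dg_def vec_lambda_beta by (intro sum.cong) auto
  then show "(M ** dg A) $ i $ j = (if j \<in> A then M $ i $ j else 0)" by simp
qed

lemma dg_mult_dg: "dg A ** dg B = dg (A \<inter> B)"
  by (auto simp: vec_eq_iff dg_mult_nth) (auto simp: dg_def)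

lemma dg_empty [simp]: "dg {} = 0"
  by (simp add: dg_def vec_eq_iff)

lemma dg_complement: "dg (- A) = mat 1 - dg A"
  by (simp add: dg_def vec_eq_iff mat_def)

lemma transpose_dg: "transpose (dg A) = dg A"
  by (auto simp: dg_def vec_eq_iff transpose_def)

lemma det_dg_reflection: "det (mat 1 - 2 *\<^sub>R dg {j}) = -1"
proof -
  have "det (mat 1 - 2 *\<^sub>R dg {j}) = (\<Prod>i\<in>UNIV. (mat 1 - 2 *\<^sub>R dg {j}) $ i $ i)"
    by (rule det_diagonal) (simp add: mat_def dg_def)
  also have "\<dots> = (\<Prod>i\<in>UNIV. if i = j then -1 else 1)"
    by (intro prod.cong) (auto simp: mat_def dg_def)
  finally show ?thesis by simp
qed

definition line_stab :: "'n set \<Rightarrow> (real^'n^'n) set" where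
  "line_stab J = {h \<in> GLn. \<forall>j\<in>J. \<forall>i. i \<noteq> j \<longrightarrow> h $ i $ j = 0}"

lemma line_stab_GLn: "line_stab J \<subseteq> GLn"
  by (auto simp: line_stab_def)

text \<open>On the lines in \<open>J\<close> the matrix \<open>h\<close> is diagonal, so there it
  commutes with the coordinate projections.\<close>

lemma line_stab_dg:
  assumes "h \<in> line_stab J" "A \<subseteq> J"
  shows "h ** dg A = dg A ** h ** dg J"
  using assms by (simp add: vec_eq_iff dg_mult_nth mult_dg_nth line_stab_def) (metis subsetD)

lemma line_stab_inv:
  assumes h: "h \<in> line_stab J"
  shows "matrix_inv h \<in> line_stab J"
proof -
  have hG: "h \<in> GLn" using h by (simp add: line_stab_def)
  have *: "matrix_inv h $ i $ j * h $ j $ j = mat 1 $ i $ j" if "j \<in> J" for i j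
  proof -
    have "(\<Sum>k\<in>UNIV. matrix_inv h $ i $ k * h $ k $ j) = mat 1 $ i $ j"
      using matrix_inv_left[OF hG] unfolding matrix_matrix_mult_def vec_eq_iff by simp
    moreover have "(\<Sum>k\<in>UNIV. matrix_inv h $ i $ k * h $ k $ j) =
        (\<Sum>k\<in>UNIV. if k = j then matrix_inv h $ i $ j * h $ j $ j else 0)"
      using h that by (intro sum.cong) (auto simp: line_stab_def)
    ultimately show ?thesis by simp
  qed
  have "matrix_inv h $ i $ j = 0" if "j \<in> J" "i \<noteq> j" for i j
    using *[OF that(1), of i] *[OF that(1), of j] that(2) by (auto simp: mat_def)
  then show ?thesis using GLn_inv[OF hG] by (simp add: line_stab_def)
qed

text \<open>For \<open>L = span {e\<^sub>j | j \<in> J}\<close> this is the projection with kernel \<open>L\<close> onto the complement of \<open>L\<close>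
  that is orthogonal for the inner product carried over from the standard one by \<open>x\<close>.\<close>
definition coproj :: "'n set \<Rightarrow> real^'n^'n \<Rightarrow> real^'n^'n" where
  "coproj J x = (x ** transpose x) ** dg (- J) **
     matrix_inv (dg J + dg (- J) ** (x ** transpose x) ** dg (- J)) ** dg (- J)"

text \<open>The quadratic form of this matrix at \<open>w\<close> is the squared norm of the
  \<open>J\<close> part of \<open>w\<close> plus that of \<open>transpose x\<close> applied to the
  rest, which vanishes only at 0. The summand \<open>dg J\<close> completes the block outside
  \<open>J\<close> to a full matrix that can be inverted.\<close>

lemma coproj_denominator_GLn:
  fixes x :: "real^'n^'n"
  assumes x: "x \<in> GLn"
  shows "dg J + dg (- J) ** (x ** transpose x) ** dg (- J) \<in> GLn" (is "?C \<in> GLn")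
proof -
  have "w = 0" if "?C *v w = 0" for w :: "real^'n"
  proof -
    let ?N = "dg (- J) :: real^'n^'n"
    have sym: "u \<bullet> (dg A *v v) = (dg A *v u) \<bullet> v" for u v :: "real^'n" and A
      by (metis dot_lmul_matrix transpose_dg vector_transpose_matrix)
    have idem: "dg A *v (dg A *v u) = dg A *v u" for u :: "real^'n" and A
      by (simp add: matrix_vector_mul_assoc dg_mult_dg)
    let ?v = "transpose x *v (?N *v w)"
    have "0 = w \<bullet> (?C *v w)" by (simp add: that)
    also have "\<dots> = w \<bullet> (dg J *v w) + w \<bullet> (?N *v (x *v ?v))"
      by (simp add: matrix_vector_mult_add_rdistrib inner_add_right matrix_vector_mul_assoc matrix_mul_assoc)
    also have "w \<bullet> (dg J *v w) = (dg J *v w) \<bullet> (dg J *v w)"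
      using sym[of w J "dg J *v w"] by (simp add: idem)
    also have "w \<bullet> (?N *v (x *v ?v)) = ?v \<bullet> ?v"
      by (simp add: sym) (metis dot_lmul_matrix vector_transpose_matrix transpose_transpose)
    finally have "(dg J *v w) \<bullet> (dg J *v w) + ?v \<bullet> ?v = 0" by simp
    then have "(dg J *v w) \<bullet> (dg J *v w) = 0" "?v \<bullet> ?v = 0"
      using inner_ge_zero[of "dg J *v w"] inner_ge_zero[of ?v] by linarith+
    then have "dg J *v w = 0" "?v = 0" unfolding inner_eq_zero_iff .
    moreover have "?N *v w = 0"
    proof -
      have "transpose x \<in> GLn" using x by (simp add: GLn_iff_det det_transpose)
      then have "?N *v w = matrix_inv (transpose x) *v ?v"
        by (simp add: matrix_vector_mul_assoc matrix_inv_left matrix_inv_cancel)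
      then show ?thesis using \<open>?v = 0\<close> by simp
    qed
    moreover have "w = dg J *v w + ?N *v w"
      by (simp add: dg_complement matrix_vector_mult_diff_rdistrib)
    ultimately show ?thesis by simp
  qed
  then show ?thesis
    unfolding GLn_def invertible_left_inverse matrix_left_invertible_ker by blast
qed

lemma coproj_kernel: "coproj J x ** dg J = 0"
  by (simp add: coproj_def matrix_mul_assoc[symmetric] dg_mult_dg matrix_ring_simps)

lemma dg_coproj:
  fixes x :: "real^'n^'n"
  assumes x: "x \<in> GLn"
  shows "dg (- J) ** coproj J x = dg (- J)"
proof -
  let ?N = "dg (- J) :: real^'n^'n" and ?Y = "x ** transpose x"
  let ?C = "dg J + ?N ** ?Y ** ?N"
  have "?N ** ?Y ** ?N = ?N ** ?C"
    by (simp add: matrix_ring_simps matrix_mul_assoc dg_mult_dg)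
  then have "?N ** ?Y ** ?N ** matrix_inv ?C = ?N ** ?C ** matrix_inv ?C"
    by (rule arg_cong)
  then have "?N ** ?Y ** ?N ** matrix_inv ?C = ?N"
    unfolding matrix_inv_cancel(3)[OF coproj_denominator_GLn[OF x]] .
  then show ?thesis by (simp add: coproj_def matrix_mul_assoc dg_mult_dg)
qed

text \<open>The projection is pinned down by a condition on its range and by its composition with
  \<open>dg (- J)\<close>. Equivariance is thereby reduced to two identities that do not involve the
  inverse.\<close>

lemma coproj_unique:
  fixes x :: "real^'n^'n"
  assumes x: "x \<in> GLn" and R: "R = (x ** transpose x) ** dg (- J) ** M" "dg (- J) ** R = dg (- J)"
  shows "R = coproj J x"
proof -
  let ?N = "dg (- J) :: real^'n^'n" and ?Y = "x ** transpose x"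
  let ?C = "dg J + ?N ** ?Y ** ?N"
  define M' where "M' = matrix_inv ?C ** ?N"
  have R': "coproj J x = ?Y ** ?N ** M'" by (simp add: coproj_def M'_def matrix_mul_assoc)
  have C: "?C ** (?N ** X) = ?N ** (?Y ** ?N ** X)" for X
    by (simp add: matrix_ring_simps matrix_mul_assoc dg_mult_dg)
       (simp add: matrix_mul_assoc[symmetric] dg_mult_dg)
  have "?C ** (?N ** M) = ?C ** (?N ** M')"
    unfolding C using R dg_coproj[OF x, of J] R' by simp
  then have "matrix_inv ?C ** (?C ** (?N ** M)) = matrix_inv ?C ** (?C ** (?N ** M'))" by simp
  then have "?N ** M = ?N ** M'"
    unfolding matrix_inv_cancel(2)[OF coproj_denominator_GLn[OF x]] .
  then show ?thesis
    unfolding R(1) R' by (simp add: matrix_mul_assoc[symmetric])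
qed

text \<open>\<open>h\<close> preserves L, which is \<open>hN\<close>, and carries the inner product
  belonging to \<open>x\<close> to the one belonging to \<open>h ** x\<close>; so it conjugates one
  projection into the other.\<close>

lemma coproj_equivariant:
  fixes x :: "real^'n^'n"
  assumes h: "h \<in> line_stab J" and x: "x \<in> GLn"
  shows "coproj J (h ** x) ** h = h ** coproj J x"
proof -
  let ?N = "dg (- J) :: real^'n^'n" and ?Y = "x ** transpose x"
  have hG: "h \<in> GLn" using h by (simp add: line_stab_def)
  have tG: "transpose h \<in> GLn" using hG by (simp add: GLn_iff_det det_transpose)
  define hi where "hi = matrix_inv h"
  have hi: "hi ** h = mat 1" "h ** hi = mat 1"
    using hG by (simp_all add: hi_def matrix_inv_left matrix_inv_right)
  have hN: "?N ** h ** ?N = ?N ** h"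
    using h by (simp add: vec_eq_iff dg_mult_nth mult_dg_nth line_stab_def) metis
  have hiN: "?N ** hi ** ?N = ?N ** hi"
    using line_stab_inv[OF h] unfolding hi_def[symmetric]
    by (simp add: vec_eq_iff dg_mult_nth mult_dg_nth line_stab_def) metis
  have thiN: "transpose hi ** ?N = ?N ** transpose hi ** ?N"
    using arg_cong[OF hiN, of transpose] by (simp add: matrix_transpose_mul transpose_dg matrix_mul_assoc)
  have tt: "transpose h ** transpose hi = mat 1"
    using hi(1) by (metis matrix_transpose_mul transpose_mat)
  obtain M where M: "coproj J x = ?Y ** ?N ** M" unfolding coproj_def
    by (metis matrix_mul_assoc)
  have "h ** coproj J x ** hi = coproj J (h ** x)"
  proof (rule coproj_unique[OF GLn_mult[OF hG x], where M = "transpose hi ** ?N ** M ** hi"])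
    have "(h ** x) ** transpose (h ** x) ** ?N ** (transpose hi ** ?N ** M ** hi) =
        h ** ?Y ** transpose h ** (?N ** transpose hi ** ?N) ** M ** hi"
      by (simp add: matrix_transpose_mul matrix_mul_assoc)
    also have "\<dots> = h ** ?Y ** (transpose h ** transpose hi) ** ?N ** M ** hi"
      unfolding thiN[symmetric] by (simp add: matrix_mul_assoc)
    also have "\<dots> = h ** coproj J x ** hi"
      unfolding tt M by (simp add: matrix_mul_assoc)
    finally show "h ** coproj J x ** hi = (h ** x) ** transpose (h ** x) ** ?N ** (transpose hi ** ?N ** M ** hi)" ..
    have "?N ** (h ** coproj J x ** hi) = (?N ** h ** ?N) ** coproj J x ** hi"
      unfolding hN by (simp add: matrix_mul_assoc)
    also have "\<dots> = ?N ** h ** (?N ** coproj J x) ** hi" by (simp add: matrix_mul_assoc)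
    also have "\<dots> = (?N ** h ** ?N) ** hi" unfolding dg_coproj[OF x] by (simp add: matrix_mul_assoc)
    also have "\<dots> = ?N" unfolding hN by (simp add: matrix_mul_assoc[symmetric] hi)
    finally show "?N ** (h ** coproj J x ** hi) = ?N" .
  qed
  then have "coproj J (h ** x) ** h = h ** coproj J x ** hi ** h" by simp
  then show ?thesis by (simp add: matrix_mul_assoc[symmetric] hi)
qed

text \<open>The kernel L is the same for all base points, and \<open>mat 1 - coproj J x\<close> maps
  into L.\<close>

lemma coproj_mult:
  fixes x :: "real^'n^'n"
  assumes "x \<in> GLn"
  shows "coproj J y ** coproj J x = coproj J y"
proof -
  have "dg J ** (mat 1 - coproj J x) = (mat 1 - dg (- J)) ** (mat 1 - coproj J x)"
    by (simp add: dg_complement)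
  also have "\<dots> = mat 1 - coproj J x"
    using dg_coproj[OF assms, of J] by (simp add: matrix_ring_simps)
  finally have "coproj J y ** (mat 1 - coproj J x) = (coproj J y ** dg J) ** (mat 1 - coproj J x)"
    by (simp add: matrix_mul_assoc[symmetric])
  then show ?thesis by (simp add: coproj_kernel matrix_ring_simps)
qed

lemma coproj_dg:
  assumes "A \<subseteq> J"
  shows "coproj J x ** dg A = 0"
proof -
  have "coproj J x ** dg A = coproj J x ** dg J ** dg A"
    using assms by (simp add: matrix_mul_assoc[symmetric] dg_mult_dg Int_absorb1)
  then show ?thesis by (simp add: coproj_kernel matrix_ring_simps)
qed

lemma tendsto_coproj:
  fixes u :: "'b \<Rightarrow> real^'n^'n"
  assumes "(u \<longlongrightarrow> x) F" "x \<in> GLn"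
  shows "((\<lambda>n. coproj J (u n)) \<longlongrightarrow> coproj J x) F"
  unfolding coproj_def
  by (intro tendsto_matrix_mult tendsto_matrix_inv tendsto_add tendsto_const tendsto_transpose assms
      coproj_denominator_GLn)

text \<open>The left factor is the identity on L and multiplication by \<open>l\<close> on the
  complement of L attached to \<open>x\<close>.\<close>

definition squeeze :: "'n set \<Rightarrow> real \<Rightarrow> real^'n^'n \<Rightarrow> real^'n^'n" where
  "squeeze J l x = (mat 1 - (1 - l) *\<^sub>R coproj J x) ** x"

text \<open>For \<open>j \<in> J\<close> it is -1 on the j-th line and 1 on the other lines in
  \<open>J\<close> and on the complement attached to \<open>x\<close>. Its dependence on
  \<open>x\<close> makes the map sending \<open>x\<close> to \<open>reflect J j x ** x\<close>
  commute with \<open>line_stab J\<close>, as multiplication by a fixed reflection in general does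
  not.\<close>

definition reflect :: "'n set \<Rightarrow> 'n \<Rightarrow> real^'n^'n \<Rightarrow> real^'n^'n" where
  "reflect J j x = mat 1 - 2 *\<^sub>R (dg {j} ** (mat 1 - coproj J x))"

lemma squeeze_factor_inverse:
  fixes x :: "real^'n^'n"
  assumes "x \<in> GLn" "l \<noteq> 0"
  shows "(mat 1 - (1 - 1/l) *\<^sub>R coproj J x) ** (mat 1 - (1 - l) *\<^sub>R coproj J x) = mat 1"
    and "(mat 1 - (1 - l) *\<^sub>R coproj J x) ** (mat 1 - (1 - 1/l) *\<^sub>R coproj J x) = mat 1"
proof -
  let ?R = "coproj J x"
  have 1: "(mat 1 - b *\<^sub>R ?R) ** (mat 1 - a *\<^sub>R ?R) = mat 1 - (a + b - a * b) *\<^sub>R ?R" for a b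
    by (simp add: matrix_ring_simps coproj_mult[OF assms(1)] algebra_simps)
  have "(1 - l) + (1 - 1/l) - (1 - l) * (1 - 1/l) = 0"
    "(1 - 1/l) + (1 - l) - (1 - 1/l) * (1 - l) = 0"
    using assms by (simp_all add: field_simps)
  then show "(mat 1 - (1 - 1/l) *\<^sub>R ?R) ** (mat 1 - (1 - l) *\<^sub>R ?R) = mat 1"
    "(mat 1 - (1 - l) *\<^sub>R ?R) ** (mat 1 - (1 - 1/l) *\<^sub>R ?R) = mat 1"
    unfolding 1 by simp_all
qed

lemma squeeze_GLn:
  fixes x :: "real^'n^'n"
  assumes "x \<in> GLn" "l \<noteq> 0"
  shows "squeeze J l x \<in> GLn"
  unfolding squeeze_def
  by (rule GLn_mult[OF GLnI[OF squeeze_factor_inverse(2)[OF assms]] assms(1)])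

lemma matrix_inv_squeeze:
  fixes x :: "real^'n^'n"
  assumes "x \<in> GLn" "l \<noteq> 0"
  shows "matrix_inv (squeeze J l x) = matrix_inv x ** (mat 1 - (1 - 1/l) *\<^sub>R coproj J x)"
  unfolding squeeze_def
  using matrix_inv_mult[OF GLnI[OF squeeze_factor_inverse(2)[OF assms]] assms(1)]
    matrix_inv_unique'[OF squeeze_factor_inverse(2)[OF assms]] by simp

text \<open>By \<open>coproj_mult\<close> the terms with \<open>1/l\<close> cancel and an expression
  affine in \<open>l\<close> remains. It stays under control as \<open>l\<close> tends to 0,
  although the inverse of the squeezed matrix does not.\<close>

lemma squeeze_quotient:
  fixes x :: "real^'n^'n"
  assumes x: "x \<in> GLn" and y: "y \<in> GLn" and l: "l \<noteq> 0"
  shows "matrix_inv (squeeze J l x) ** squeeze J l y =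
    matrix_inv x ** y + (1 - l) *\<^sub>R (matrix_inv x ** (coproj J x - coproj J y) ** y)"
proof -
  let ?R = "coproj J x" and ?S = "coproj J y"
  have c: "(1 - 1/l) - (1 - l) * (1 - 1/l) = l - 1" using l by (simp add: field_simps)
  have "(mat 1 - b *\<^sub>R ?R) ** (mat 1 - a *\<^sub>R ?S) = mat 1 - a *\<^sub>R ?S - (b - a * b) *\<^sub>R ?R" for a b
    by (simp add: matrix_ring_simps coproj_mult[OF y] algebra_simps)
  then have "(mat 1 - (1 - 1/l) *\<^sub>R ?R) ** (mat 1 - (1 - l) *\<^sub>R ?S) =
      mat 1 - (1 - l) *\<^sub>R ?S - ((1 - 1/l) - (1 - l) * (1 - 1/l)) *\<^sub>R ?R" .
  also have "\<dots> = mat 1 + (1 - l) *\<^sub>R (?R - ?S)"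
    unfolding c by (simp add: algebra_simps)
  finally have "matrix_inv x ** ((mat 1 - (1 - 1/l) *\<^sub>R ?R) ** (mat 1 - (1 - l) *\<^sub>R ?S)) ** y =
      matrix_inv x ** (mat 1 + (1 - l) *\<^sub>R (?R - ?S)) ** y" by simp
  then show ?thesis
    unfolding matrix_inv_squeeze[OF x l]
    by (simp add: squeeze_def matrix_mul_assoc matrix_ring_simps)
qed

lemma squeeze_equivariant:
  fixes x :: "real^'n^'n"
  assumes "h \<in> line_stab J" "x \<in> GLn"
  shows "squeeze J l (h ** x) = h ** squeeze J l x"
proof -
  have "(mat 1 - (1 - l) *\<^sub>R coproj J (h ** x)) ** h = h ** (mat 1 - (1 - l) *\<^sub>R coproj J x)"
    by (simp add: matrix_ring_simps coproj_equivariant[OF assms])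
  then show ?thesis by (simp add: squeeze_def matrix_mul_assoc)
qed

lemma eps_dg_reflection: "eps (mat 1 - 2 *\<^sub>R dg {j}) = -1"
  by (simp add: eps_def det_dg_reflection)

lemma reflection_line_stab: "mat 1 - 2 *\<^sub>R dg {j} \<in> line_stab J"
  using det_dg_reflection[of j] by (auto simp: line_stab_def GLn_iff_det) (auto simp: mat_def dg_def)

lemma reflect_expand: "reflect J j x = mat 1 - 2 *\<^sub>R dg {j} + 2 *\<^sub>R (dg {j} ** coproj J x)"
  by (simp add: reflect_def matrix_ring_simps algebra_simps)

text \<open>Products containing \<open>coproj J y ** dg {j}\<close> vanish because the j-th line
  lies in the kernel. The result is unipotent: it differs from the identity by a matrix that kills L
  and maps into the j-th line.\<close>

lemma reflect_mult:
  fixes x y :: "real^'n^'n"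
  assumes "j \<in> J"
  shows "reflect J j y ** reflect J j x = mat 1 + 2 *\<^sub>R (dg {j} ** (coproj J y - coproj J x))"
proof -
  let ?E = "dg {j} :: real^'n^'n"
  have RE: "coproj J y ** ?E = 0" using assms by (intro coproj_dg) auto
  have 1: "?E ** ?E = ?E" by (simp add: dg_mult_dg)
  have "?E ** coproj J y ** ?E = 0" by (simp add: matrix_mul_assoc[symmetric] RE matrix_ring_simps)
  moreover have "?E ** coproj J y ** (?E ** coproj J x) = 0"
  proof -
    have "?E ** coproj J y ** (?E ** coproj J x) = ?E ** (coproj J y ** ?E) ** coproj J x"
      by (simp add: matrix_mul_assoc)
    then show ?thesis by (simp add: RE matrix_ring_simps)
  qed
  moreover have "?E ** (?E ** coproj J x) = ?E ** coproj J x"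
    by (simp add: matrix_mul_assoc 1)
  ultimately show ?thesis
    unfolding reflect_expand by (simp add: matrix_ring_simps 1 algebra_simps)
qed

lemma reflect_self_inverse: "j \<in> J \<Longrightarrow> reflect J j x ** reflect J j x = mat 1"
  by (simp add: reflect_mult matrix_ring_simps)

lemma reflect_GLn: "j \<in> J \<Longrightarrow> reflect J j x \<in> GLn"
  by (rule GLnI[OF reflect_self_inverse])

lemma matrix_inv_reflect: "j \<in> J \<Longrightarrow> matrix_inv (reflect J j x) = reflect J j x"
  by (rule matrix_inv_unique'[OF reflect_self_inverse])

text \<open>The reflection differs from the diagonal one by the square of a transvection.\<close>
lemma eps_reflect:
  fixes x :: "real^'n^'n"
  assumes j: "j \<in> J"
  shows "eps (reflect J j x) = -1"
proof -
  let ?E = "dg {j} :: real^'n^'n"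
  let ?A = "?E ** coproj J x"
  have RE: "coproj J x ** ?E = 0" using assms by (intro coproj_dg) auto
  have 1: "?E ** ?E = ?E" by (simp add: dg_mult_dg)
  have EA: "?E ** ?A = ?A" by (simp add: matrix_mul_assoc 1)
  have AA: "?A ** ?A = 0"
  proof -
    have "?A ** ?A = ?E ** (coproj J x ** ?E) ** coproj J x" by (simp add: matrix_mul_assoc)
    then show ?thesis by (simp add: RE matrix_ring_simps)
  qed
  have "(mat 1 - ?A) ** (mat 1 + ?A) = mat 1"
    by (simp add: matrix_ring_simps AA)
  then have G: "mat 1 - ?A \<in> GLn" by (rule GLnI)
  have "(mat 1 - 2 *\<^sub>R ?E) ** reflect J j x = (mat 1 - ?A) ** (mat 1 - ?A)"
    unfolding reflect_expand
    by (simp add: matrix_ring_simps 1 EA AA) (simp add: vec_eq_iff)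
  then have "eps (mat 1 - 2 *\<^sub>R ?E) * eps (reflect J j x) = 1"
    unfolding eps_mult[symmetric] using eps_square[OF G] by (simp add: eps_mult)
  then show ?thesis by (simp add: eps_dg_reflection)
qed

lemma reflect_line_stab:
  fixes x :: "real^'n^'n"
  assumes j: "j \<in> J"
  shows "reflect J j x \<in> line_stab J"
proof -
  have "reflect J j x ** dg J = dg J - 2 *\<^sub>R (dg {j} ** dg J)"
    unfolding reflect_expand by (simp add: matrix_ring_simps matrix_mul_assoc[symmetric] coproj_kernel)
  then have *: "(reflect J j x ** dg J) $ a $ b = (dg J - 2 *\<^sub>R (dg {j} ** dg J)) $ a $ b" for a b by simp
  have "reflect J j x $ a $ b = 0" if "b \<in> J" "a \<noteq> b" for a b
    using *[of a b] that by (simp add: mult_dg_nth) (simp add: dg_def)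
  then show ?thesis using reflect_GLn[OF j] by (simp add: line_stab_def)
qed

text \<open>\<open>mat 1 - coproj J x\<close> maps into L, where \<open>h\<close> is diagonal and so
  commutes with \<open>dg {j}\<close>.\<close>

lemma reflect_equivariant:
  fixes x :: "real^'n^'n"
  assumes h: "h \<in> line_stab J" and x: "x \<in> GLn" and j: "j \<in> J"
  shows "reflect J j (h ** x) ** h = h ** reflect J j x"
proof -
  let ?P = "mat 1 - coproj J x" and ?E = "dg {j} :: real^'n^'n"
  have e: "coproj J x - dg J ** coproj J x = mat 1 - dg J"
    using dg_coproj[OF x, of J] by (simp add: dg_complement matrix_ring_simps)
  have "dg J - dg J ** coproj J x = (coproj J x - dg J ** coproj J x) - coproj J x + dg J" by simp
  also have "\<dots> = ?P" unfolding e by simp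
  finally have QP: "dg J ** ?P = ?P" by (simp add: matrix_ring_simps)
  have "h ** ?E = ?E ** h ** dg J" using j by (intro line_stab_dg[OF h]) auto
  then have "h ** (?E ** ?P) = ?E ** h ** (dg J ** ?P)" by (simp add: matrix_mul_assoc)
  then have *: "h ** (?E ** ?P) = ?E ** (h ** ?P)" unfolding QP by (simp add: matrix_mul_assoc)
  have "(mat 1 - coproj J (h ** x)) ** h = h ** ?P"
    by (simp add: matrix_ring_simps coproj_equivariant[OF h x])
  then have "?E ** (mat 1 - coproj J (h ** x)) ** h = h ** (?E ** ?P)"
    unfolding * by (simp add: matrix_mul_assoc[symmetric])
  then show ?thesis unfolding reflect_def by (simp add: matrix_ring_simps(1,2,5,6))
qed

text \<open>The reflection fixes the range of \<open>coproj J x\<close> pointwise and is itself in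
  \<open>line_stab J\<close>, so equivariance of the projection may be used with the reflection as
  \<open>h\<close>.\<close>

lemma coproj_reflect:
  fixes x :: "real^'n^'n"
  assumes x: "x \<in> GLn" and j: "j \<in> J"
  shows "coproj J (reflect J j x ** x) = coproj J x"
    and "reflect J j x ** coproj J x = coproj J x" "coproj J x ** reflect J j x = coproj J x"
proof -
  have RE: "coproj J x ** dg {j} = 0" using assms by (intro coproj_dg) auto
  have RR: "coproj J x ** coproj J x = coproj J x" by (rule coproj_mult[OF x])
  show 1: "reflect J j x ** coproj J x = coproj J x"
    unfolding reflect_expand by (simp add: matrix_ring_simps matrix_mul_assoc[symmetric] RR)
  have "coproj J x ** (dg {j} ** coproj J x) = 0" by (simp add: matrix_mul_assoc RE matrix_ring_simps)
  then show 2: "coproj J x ** reflect J j x = coproj J x"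
    unfolding reflect_expand by (simp add: matrix_ring_simps RE)
  have "coproj J (reflect J j x ** x) ** reflect J j x ** reflect J j x = coproj J x ** reflect J j x"
    unfolding coproj_equivariant[OF reflect_line_stab[OF j] x] 1 ..
  then show "coproj J (reflect J j x ** x) = coproj J x"
    unfolding 2 by (simp add: matrix_mul_assoc[symmetric] reflect_self_inverse[OF j])
qed

lemma squeeze_reflect:
  fixes x :: "real^'n^'n"
  assumes x: "x \<in> GLn" and j: "j \<in> J"
  shows "squeeze J l (reflect J j x ** x) = reflect J j x ** squeeze J l x"
  unfolding squeeze_def coproj_reflect(1)[OF assms] matrix_mul_assoc
  by (simp add: matrix_ring_simps coproj_reflect[OF assms])

text \<open>As \<open>l \<rightarrow> 0\<close> the squeezing makes the reflections attached to different base points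
  indistinguishable up to a right factor tending to the identity.\<close>
lemma squeeze_reflect_quotient:
  fixes x y :: "real^'n^'n"
  assumes x: "x \<in> GLn" and y: "y \<in> GLn" and j: "j \<in> J" and l: "l \<noteq> 0"
  shows "matrix_inv (reflect J j y ** squeeze J l x) ** (reflect J j x ** squeeze J l x) =
    mat 1 + (2 * l) *\<^sub>R (matrix_inv x ** dg {j} ** (coproj J y - coproj J x) ** x)"
proof -
  let ?E = "dg {j} :: real^'n^'n" and ?R = "coproj J x" and ?S = "coproj J y"
  let ?a = "mat 1 - (1 - l) *\<^sub>R ?R" and ?b = "mat 1 - (1 - 1/l) *\<^sub>R ?R"
  have "matrix_inv (reflect J j y ** squeeze J l x) ** (reflect J j x ** squeeze J l x) =
      matrix_inv (squeeze J l x) ** (reflect J j y ** reflect J j x) ** squeeze J l x"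
    by (simp add: matrix_inv_mult reflect_GLn[OF j] squeeze_GLn[OF x l] matrix_inv_reflect[OF j] matrix_mul_assoc)
  also have "\<dots> = matrix_inv x ** (?b ** (mat 1 + 2 *\<^sub>R (?E ** (?S - ?R))) ** ?a) ** x"
    unfolding reflect_mult[OF j] matrix_inv_squeeze[OF x l] by (simp add: squeeze_def matrix_mul_assoc)
  also have "?b ** (mat 1 + 2 *\<^sub>R (?E ** (?S - ?R))) ** ?a = ?b ** ?a + 2 *\<^sub>R ((?b ** ?E) ** ((?S - ?R) ** ?a))"
    by (simp only: matrix_ring_simps(3,4,5,6) matrix_mul_rid matrix_mul_assoc)
  also have "?b ** ?a = mat 1" by (rule squeeze_factor_inverse[OF x l])
  also have "?b ** ?E = ?E"
    using coproj_dg[of "{j}" J x] j by (simp add: matrix_ring_simps)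
  also have "(?S - ?R) ** ?a = l *\<^sub>R (?S - ?R)"
    by (simp add: matrix_ring_simps coproj_mult[OF x] algebra_simps)
  finally show ?thesis
    by (simp add: matrix_ring_simps(3,4,5,6) matrix_mul_assoc matrix_inv_left[OF x])
qed

lemma tendsto_reflect:
  fixes u :: "'b \<Rightarrow> real^'n^'n"
  assumes "(u \<longlongrightarrow> x) F" "x \<in> GLn"
  shows "((\<lambda>n. reflect J j (u n)) \<longlongrightarrow> reflect J j x) F"
  unfolding reflect_def by (intro tendsto_intros tendsto_matrix_mult tendsto_coproj assms)

lemma tendsto_squeeze:
  fixes u :: "'b \<Rightarrow> real^'n^'n"
  assumes "(u \<longlongrightarrow> x) F" "x \<in> GLn"
  shows "((\<lambda>n. squeeze J l (u n)) \<longlongrightarrow> squeeze J l x) F"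
  unfolding squeeze_def by (intro tendsto_intros tendsto_matrix_mult tendsto_coproj assms)

subsection \<open>Cochains equivariant under the stabilizer of coordinate lines\<close>

lemma cobd_cobd: "cobd (Suc q) (cobd q f) x = 0"
  unfolding cobd_def by (rule alternating_sum_omit_omit)

text \<open>The coefficient \<open>1 - l m\<close> in \<open>squeeze_quotient\<close> lies between 0
  and 1, so one bound serves all \<open>m\<close>.\<close>

lemma squeeze_equicontinuous:
  fixes x :: "real^'n^'n"
  assumes u: "\<And>n. u n \<in> GLn" and x: "x \<in> GLn" and lim: "u \<longlonglongrightarrow> x"
    and l: "\<And>m :: nat. 0 < l m \<and> l m \<le> 1" and d: "d > 0"
  shows "eventually (\<lambda>n. \<forall>m. norm (matrix_inv (squeeze J (l m) x) ** squeeze J (l m) (u n) - mat 1) < d) sequentially"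
proof -
  define A where "A n = matrix_inv x ** u n - mat 1" for n
  define B where "B n = matrix_inv x ** (coproj J x - coproj J (u n)) ** u n" for n
  have "A \<longlonglongrightarrow> matrix_inv x ** x - mat 1"
    unfolding A_def by (intro tendsto_intros tendsto_matrix_mult lim)
  then have A: "A \<longlonglongrightarrow> 0" by (simp add: matrix_inv_left[OF x])
  have "B \<longlonglongrightarrow> matrix_inv x ** (coproj J x - coproj J x) ** x"
    unfolding B_def by (intro tendsto_intros tendsto_matrix_mult tendsto_coproj lim x)
  then have B: "B \<longlonglongrightarrow> 0" by (simp add: matrix_ring_simps)
  have "(\<lambda>n. norm (A n) + norm (B n)) \<longlonglongrightarrow> 0"
    using tendsto_add[OF tendsto_norm_zero[OF A] tendsto_norm_zero[OF B]] by simp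
  then have "eventually (\<lambda>n. norm (A n) + norm (B n) < d) sequentially"
    using d by (rule order_tendstoD)
  then show ?thesis
  proof eventually_elim
    case (elim n)
    show ?case
    proof
      fix m
      have "matrix_inv (squeeze J (l m) x) ** squeeze J (l m) (u n) - mat 1 = A n + (1 - l m) *\<^sub>R B n"
        using l[of m] by (subst squeeze_quotient[OF x u]) (auto simp: A_def B_def)
      then have "norm (matrix_inv (squeeze J (l m) x) ** squeeze J (l m) (u n) - mat 1) \<le>
          norm (A n) + \<bar>1 - l m\<bar> * norm (B n)"
        using norm_triangle_ineq[of "A n" "(1 - l m) *\<^sub>R B n"] by simp
      also have "\<bar>1 - l m\<bar> * norm (B n) \<le> 1 * norm (B n)"
        using l[of m] by (intro mult_right_mono) auto
      finally show "norm (matrix_inv (squeeze J (l m) x) ** squeeze J (l m) (u n) - mat 1) < d"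
        using elim by linarith
    qed
  qed
qed

lemma map_segment_tuples:
  assumes "y \<in> tuples q" "\<And>x. x \<in> GLn \<Longrightarrow> \<Phi> x \<in> GLn" "b \<le> Suc q"
  shows "(\<lambda>j. if a \<le> j \<and> j < b then \<Phi> (y j) else y j) \<in> tuples q"
  using assms by (simp add: tuples_iff)

text \<open>Each summand of the prism is \<open>g\<close> at a tuple with entries from
  \<open>x\<close> and from its image under \<open>\<Phi> m\<close>. Uniform continuity of
  \<open>g\<close> and equicontinuity of the maps make the estimate independent of
  \<open>m\<close>.\<close>

lemma prism_map_equicontinuous:
  fixes g :: "(nat \<Rightarrow> real^'n^'n) \<Rightarrow> real"
  assumes g: "unif (Suc p) g" and \<Phi>G: "\<And>m x. x \<in> GLn \<Longrightarrow> \<Phi> m x \<in> GLn"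
    and eq: "\<And>u x d. (\<And>n. u n \<in> GLn) \<Longrightarrow> x \<in> GLn \<Longrightarrow> u \<longlonglongrightarrow> x \<Longrightarrow> d > 0 \<Longrightarrow>
      eventually (\<lambda>n. \<forall>m. norm (matrix_inv (\<Phi> m x) ** \<Phi> m (u n) - mat 1) < d) sequentially"
    and u: "\<And>n. u n \<in> tuples p" and x: "x \<in> tuples p" and lim: "\<And>i. (\<lambda>n. u n i) \<longlonglongrightarrow> x i" and e: "e > 0"
  shows "eventually (\<lambda>n. \<forall>m :: nat. \<bar>prism (\<lambda>\<phi> x. \<phi> (\<Phi> m x)) p g (u n) - prism (\<lambda>\<phi> x. \<phi> (\<Phi> m x)) p g x\<bar> < e) sequentially"
proof -
  define e' where "e' = e / (p + 2)"
  have e': "e' > 0" using e by (simp add: e'_def)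
  obtain d where d: "d > 0" "\<And>x y. x \<in> tuples (Suc p) \<Longrightarrow> y \<in> tuples (Suc p) \<Longrightarrow>
     (\<And>i. i \<le> Suc p \<Longrightarrow> norm (matrix_inv (x i) ** y i - mat 1) < d) \<Longrightarrow> \<bar>g y - g x\<bar> < e'"
    using g e' unfolding unif_def by metis
  have 1: "eventually (\<lambda>n. norm (matrix_inv (x i) ** u n i - mat 1) < d) sequentially" if i: "i \<le> p" for i
  proof -
    have xi: "x i \<in> GLn" using x i by (simp add: tuples_iff)
    have "(\<lambda>n. norm (matrix_inv (x i) ** u n i - mat 1)) \<longlonglongrightarrow> norm (matrix_inv (x i) ** x i - mat 1)"
      by (intro tendsto_intros tendsto_matrix_mult lim)
    then show ?thesis using d(1) by (intro order_tendstoD) (auto simp: matrix_inv_left[OF xi])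
  qed
  have 2: "eventually (\<lambda>n. \<forall>m. norm (matrix_inv (\<Phi> m (x i)) ** \<Phi> m (u n i) - mat 1) < d) sequentially" if "i \<le> p" for i
    using that u x by (intro eq lim d(1)) (auto simp: tuples_iff)
  have "eventually (\<lambda>n. \<forall>i\<in>{..p}. norm (matrix_inv (x i) ** u n i - mat 1) < d \<and>
      (\<forall>m. norm (matrix_inv (\<Phi> m (x i)) ** \<Phi> m (u n i) - mat 1) < d)) sequentially"
    using 1 2 by (intro eventually_ball_finite ballI eventually_conj) auto
  then show ?thesis
  proof eventually_elim
    case (elim n)
    show ?case
    proof
      fix m
      let ?Z = "\<lambda>i x j. if Suc i \<le> j \<and> j < Suc i + (Suc p - i) then \<Phi> m (dup i x j) else dup i x j"
      have eq: "prism (\<lambda>\<phi> x. \<phi> (\<Phi> m x)) p g (u n) - prism (\<lambda>\<phi> x. \<phi> (\<Phi> m x)) p g x =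
          (\<Sum>i\<le>p. (-1)^i * (g (?Z i (u n)) - g (?Z i x)))"
        unfolding prism_def act_from_map sum_subtractf[symmetric] right_diff_distrib ..
      have "\<bar>prism (\<lambda>\<phi> x. \<phi> (\<Phi> m x)) p g (u n) - prism (\<lambda>\<phi> x. \<phi> (\<Phi> m x)) p g x\<bar> \<le>
          (\<Sum>i\<le>p. \<bar>(-1)^i * (g (?Z i (u n)) - g (?Z i x))\<bar>)"
        unfolding eq by (rule sum_abs)
      also have "\<dots> \<le> (\<Sum>i\<le>p. e')"
      proof (rule sum_mono)
        fix i assume "i \<in> {..p}"
        then have i: "i \<le> p" by simp
        have Z: "?Z i w \<in> tuples (Suc p)" if "w \<in> tuples p" for w
          by (rule map_segment_tuples[where \<Phi> = "\<Phi> m", OF dup_tuples[OF that i] \<Phi>G]) (use i in simp_all)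
        have "\<bar>g (?Z i (u n)) - g (?Z i x)\<bar> < e'"
        proof (rule d(2)[OF Z[OF x] Z[OF u]])
          fix k assume k: "k \<le> Suc p"
          show "norm (matrix_inv (?Z i x k) ** ?Z i (u n) k - mat 1) < d"
          proof (cases "k \<le> i")
            case True
            then show ?thesis using elim i by (simp add: dup_def)
          next
            case False
            then have "k - 1 \<le> p" using k by simp
            then show ?thesis using elim False k i by (simp add: dup_def)
          qed
        qed
        then show "\<bar>(-1)^i * (g (?Z i (u n)) - g (?Z i x))\<bar> \<le> e'" by (simp add: abs_mult)
      qed
      also have "\<dots> < e" using e by (simp add: e'_def field_simps)
      finally show "\<bar>prism (\<lambda>\<phi> x. \<phi> (\<Phi> m x)) p g (u n) - prism (\<lambda>\<phi> x. \<phi> (\<Phi> m x)) p g x\<bar> < e" .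
    qed
  qed
qed

lemma prism_map_bound:
  fixes g :: "(nat \<Rightarrow> real^'n^'n) \<Rightarrow> real"
  assumes g: "\<And>x. x \<in> tuples (Suc p) \<Longrightarrow> \<bar>g x\<bar> \<le> C" and \<Phi>G: "\<And>x. x \<in> GLn \<Longrightarrow> \<Phi> x \<in> GLn" and x: "x \<in> tuples p"
  shows "\<bar>prism (\<lambda>\<phi> x. \<phi> (\<Phi> x)) p g x\<bar> \<le> (real p + 1) * C"
proof -
  let ?Z = "\<lambda>i x j. if Suc i \<le> j \<and> j < Suc i + (Suc p - i) then \<Phi> (dup i x j) else dup i x j"
  have "\<bar>prism (\<lambda>\<phi> x. \<phi> (\<Phi> x)) p g x\<bar> \<le> (\<Sum>i\<le>p. \<bar>(-1)^i * g (?Z i x)\<bar>)"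
    unfolding prism_def act_from_map by (rule sum_abs)
  also have "\<dots> \<le> (\<Sum>i\<le>p. C)"
  proof (rule sum_mono)
    fix i assume "i \<in> {..p}"
    then have i: "i \<le> p" by simp
    have "?Z i x \<in> tuples (Suc p)"
      by (rule map_segment_tuples[where \<Phi> = \<Phi>, OF dup_tuples[OF x i] \<Phi>G]) (use i in simp_all)
    then show "\<bar>(-1)^i * g (?Z i x)\<bar> \<le> C" using g by (simp add: abs_mult)
  qed
  finally show ?thesis by (simp add: add.commute)
qed

text \<open>With the homotopies \<open>a m\<close> and \<open>b m\<close> for
  \<open>\<Phi> m\<close> and \<open>\<Psi> m\<close>, the cochain \<open>g\<close> is the
  coboundary of \<open>- (a m + b m) / 2\<close> plus the mean of \<open>g\<close> after
  \<open>\<Phi> m\<close> and \<open>g\<close> after \<open>\<Psi> m\<close>. That mean tends to 0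
  pointwise, because on a given tuple \<open>\<Psi> m\<close> is nearly \<open>\<Phi> m\<close>
  followed by a single reflection of sign -1.\<close>

lemma line_stab_column_exact_unif:
  fixes g :: "(nat \<Rightarrow> real^'n^'n) \<Rightarrow> real"
  assumes j: "j \<in> J" and g: "g \<in> CH (line_stab J) (Suc p)" and uni: "unif (Suc p) g"
    and z: "\<And>x. x \<in> tuples (Suc (Suc p)) \<Longrightarrow> cobd (Suc p) g x = 0"
  shows "\<exists>f\<in>CH (line_stab J) p. \<forall>x\<in>tuples (Suc p). g x = cobd p f x"
proof -
  define l where "l m = 1 / real (Suc m)" for m
  have l: "0 < l m \<and> l m \<le> 1" for m by (simp add: l_def)
  have l0: "l m \<noteq> 0" for m using l[of m] by simp
  define \<Phi> where "\<Phi> m = squeeze J (l m)" for m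
  define \<Psi> where "\<Psi> m x = squeeze J (l m) (reflect J j x ** x)" for m x
  have \<Phi>G: "\<Phi> m x \<in> GLn" if "x \<in> GLn" for m x
    using that by (simp add: \<Phi>_def squeeze_GLn l0)
  have rG: "reflect J j x ** x \<in> GLn" if "x \<in> GLn" for x
    using that by (intro GLn_mult reflect_GLn j)
  have \<Psi>G: "\<Psi> m x \<in> GLn" if "x \<in> GLn" for m x
    using that by (simp add: \<Psi>_def squeeze_GLn l0 rG)
  have rlim: "(\<lambda>n. reflect J j (u n) ** u n) \<longlonglongrightarrow> reflect J j x ** x" if "u \<longlonglongrightarrow> x" "x \<in> GLn" for u x
    by (intro tendsto_matrix_mult tendsto_reflect that)
  have V\<Phi>: "vertex_operator (\<lambda>\<phi> x. \<phi> (\<Phi> m x)) (line_stab J)" for m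
    by (rule vertex_operator_map) (auto simp: \<Phi>G line_stab_GLn[THEN subsetD] \<Phi>_def squeeze_equivariant intro!: tendsto_squeeze squeeze_GLn l0)
  have V\<Psi>: "vertex_operator (\<lambda>\<phi> x. \<phi> (\<Psi> m x)) (line_stab J)" for m
  proof (rule vertex_operator_map)
    show "\<Psi> m (h ** x) = h ** \<Psi> m x" if "h \<in> line_stab J" "x \<in> GLn" for h x
      unfolding \<Psi>_def matrix_mul_assoc reflect_equivariant[OF that j]
      by (simp add: matrix_mul_assoc[symmetric] squeeze_equivariant[OF that(1) rG[OF that(2)]])
    show "(\<lambda>n. \<Psi> m (u n)) \<longlonglongrightarrow> \<Psi> m x" if "u \<longlonglongrightarrow> x" "x \<in> GLn" for u x
      unfolding \<Psi>_def by (intro tendsto_squeeze rlim that rG)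
  qed (auto simp: \<Psi>G line_stab_GLn[THEN subsetD])
  have gC: "g \<in> CB (Suc p)" using g by (simp add: CH_def)
  obtain C where C: "\<And>x. x \<in> tuples (Suc p) \<Longrightarrow> \<bar>g x\<bar> \<le> C" using CB_bound[OF gC] by blast
  define a where "a m = prism (\<lambda>\<phi> x. \<phi> (\<Phi> m x)) p g" for m
  define b where "b m = prism (\<lambda>\<phi> x. \<phi> (\<Psi> m x)) p g" for m
  \<comment> \<open>Cut off outside the tuples, since \<open>cluster_function\<close> asks for a
    bound at all points.\<close>
  define k where "k m x = (if x \<in> tuples p then - (a m x + b m x) / 2 else 0)" for m x
  have aH: "a m \<in> CH (line_stab J) p" for m unfolding a_def by (rule vertex_operator.prism_CH[OF V\<Phi> g])
  have bH: "b m \<in> CH (line_stab J) p" for m unfolding b_def by (rule vertex_operator.prism_CH[OF V\<Psi> g])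
  have kb: "\<bar>k m x\<bar> \<le> \<bar>(real p + 1) * C\<bar>" for m x
  proof (cases "x \<in> tuples p")
    case True
    have "\<bar>a m x\<bar> \<le> (real p + 1) * C"
      unfolding a_def by (rule prism_map_bound[OF C _ True]) (simp_all add: \<Phi>G)
    moreover have "\<bar>b m x\<bar> \<le> (real p + 1) * C"
      unfolding b_def by (rule prism_map_bound[OF C _ True]) (simp_all add: \<Psi>G)
    ultimately show ?thesis using True by (simp add: k_def)
  qed (simp add: k_def)
  obtain k0 where k0: "\<And>A e M. finite A \<Longrightarrow> e > 0 \<Longrightarrow> \<exists>m\<ge>M. \<forall>x\<in>A. \<bar>k m x - k0 x\<bar> < e"
    using cluster_function[of k, OF kb] by blast
  have "k0 \<in> CB p"
  proof (rule CB_I[where C = "\<bar>(real p + 1) * C\<bar> + 1"])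
    fix x :: "nat \<Rightarrow> real^'n^'n"
    obtain m where "\<bar>k m x - k0 x\<bar> < 1" using k0[of "{x}" 1 0] by auto
    then show "\<bar>k0 x\<bar> \<le> \<bar>(real p + 1) * C\<bar> + 1" using kb[of m x] by linarith
  next
    fix u :: "nat \<Rightarrow> nat \<Rightarrow> real^'n^'n" and x
    assume u: "\<And>n. u n \<in> tuples p" and x: "x \<in> tuples p" and lim: "\<And>i. (\<lambda>n. u n i) \<longlonglongrightarrow> x i"
    show "(\<lambda>n. k0 (u n)) \<longlonglongrightarrow> k0 x"
    proof (rule tendstoI)
      fix e :: real assume e: "e > 0"
      have "eventually (\<lambda>n. \<forall>m. \<bar>a m (u n) - a m x\<bar> < e/4) sequentially"
        unfolding a_def using e
        by (intro prism_map_equicontinuous[OF uni _ _ u x lim] \<Phi>G) (auto simp: \<Phi>_def intro!: squeeze_equicontinuous l)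
      moreover have "eventually (\<lambda>n. \<forall>m. \<bar>b m (u n) - b m x\<bar> < e/4) sequentially"
        unfolding b_def using e
        by (intro prism_map_equicontinuous[OF uni _ _ u x lim] \<Psi>G) (auto simp: \<Psi>_def intro!: squeeze_equicontinuous l rG rlim)
      ultimately show "eventually (\<lambda>n. dist (k0 (u n)) (k0 x) < e) sequentially"
      proof eventually_elim
        case (elim n)
        \<comment> \<open>One index has to serve both points; it may be any, as the estimates for
          \<open>a\<close> and \<open>b\<close> hold for every \<open>m\<close>.\<close>
        obtain m where m: "\<bar>k m (u n) - k0 (u n)\<bar> < e/4" "\<bar>k m x - k0 x\<bar> < e/4"
          using k0[of "{u n, x}" "e/4" 0] e by auto
        have "2 * (k m (u n) - k m x) = - (a m (u n) - a m x) - (b m (u n) - b m x)"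
          using u x by (simp add: k_def field_simps)
        moreover have "\<bar>a m (u n) - a m x\<bar> < e/4" "\<bar>b m (u n) - b m x\<bar> < e/4" using elim by blast+
        moreover have "\<bar>X\<bar> < c" if "2 * X = - A - B" "\<bar>A\<bar> < c" "\<bar>B\<bar> < c" for A B X c :: real
          using that by linarith
        ultimately have "\<bar>k m (u n) - k m x\<bar> < e/4" by blast
        then show ?case using m unfolding dist_real_def by linarith
      qed
    qed
  qed
  moreover have "k0 (left_mult p h x) = eps h * k0 x" if h: "h \<in> line_stab J" and x: "x \<in> tuples p" for h x
  proof (rule ccontr)
    assume ne: "k0 (left_mult p h x) \<noteq> eps h * k0 x"
    have hG: "h \<in> GLn" using h line_stab_GLn by blast
    define e where "e = \<bar>k0 (left_mult p h x) - eps h * k0 x\<bar> / 2"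
    have "e > 0" using ne by (simp add: e_def)
    then obtain m where m: "\<bar>k m (left_mult p h x) - k0 (left_mult p h x)\<bar> < e" "\<bar>k m x - k0 x\<bar> < e"
      using k0[of "{left_mult p h x, x}" e 0] by auto
    have "k m (left_mult p h x) = eps h * k m x"
      using aH[of m] bH[of m] h x left_mult_tuples[OF hG x] by (simp add: k_def CH_def algebra_simps)
    then have "\<bar>k0 (left_mult p h x) - eps h * k0 x\<bar> \<le> \<bar>k m (left_mult p h x) - k0 (left_mult p h x)\<bar> + \<bar>eps h * (k m x - k0 x)\<bar>"
      by (simp add: right_diff_distrib)
    also have "\<dots> < 2 * e" using m by (simp add: abs_mult abs_eps[OF hG])
    finally show False by (simp add: e_def)
  qed
  moreover have "g x = cobd p k0 x" if x: "x \<in> tuples (Suc p)" for x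
  proof (rule ccontr)
    assume ne: "g x \<noteq> cobd p k0 x"
    \<comment> \<open>The faces of \<open>x\<close> will cost \<open>(p + 2) * e\<close> and the
      reflection estimate at most \<open>e\<close>; their sum stays below
      \<open>(p + 4) * e\<close>.\<close>
    define e where "e = \<bar>g x - cobd p k0 x\<bar> / (p + 4)"
    have e: "e > 0" using ne by (simp add: e_def)
    let ?P = "\<lambda>F j. if 0 \<le> j \<and> j < 0 + Suc (Suc p) then F (x j) else x j"
    \<comment> \<open>The reflection at the first vertex is used for all vertices, because
      equivariance moves the whole tuple by one group element.\<close>
    let ?r = "reflect J j (x 0)"
    have x0: "x 0 \<in> GLn" "\<And>i. i \<le> Suc p \<Longrightarrow> x i \<in> GLn" using x by (auto simp: tuples_iff)
    have \<Phi>t: "?P (\<Phi> m) \<in> tuples (Suc p)" for m using x by (auto simp: tuples_iff intro!: \<Phi>G)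
    have \<Psi>t: "?P (\<Psi> m) \<in> tuples (Suc p)" for m using x by (auto simp: tuples_iff intro!: \<Psi>G)
    have refl_t: "left_mult (Suc p) ?r (?P (\<Phi> m)) \<in> tuples (Suc p)" for m
      by (intro left_mult_tuples \<Phi>t reflect_GLn j)
    obtain d where d: "d > 0" "\<And>x y. x \<in> tuples (Suc p) \<Longrightarrow> y \<in> tuples (Suc p) \<Longrightarrow>
       (\<And>i. i \<le> Suc p \<Longrightarrow> norm (matrix_inv (x i) ** y i - mat 1) < d) \<Longrightarrow> \<bar>g y - g x\<bar> < e"
      using uni e unfolding unif_def by metis
    have "l \<longlonglongrightarrow> 0" unfolding l_def by (rule LIMSEQ_Suc[OF lim_1_over_n])
    then have "(\<lambda>m. norm ((2 * l m) *\<^sub>R (matrix_inv (x i) ** dg {j} ** (coproj J (x 0) - coproj J (x i)) ** x i)))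
        \<longlonglongrightarrow> norm ((2 * 0) *\<^sub>R (matrix_inv (x i) ** dg {j} ** (coproj J (x 0) - coproj J (x i)) ** x i))" for i
      by (intro tendsto_intros)
    then have "eventually (\<lambda>m. norm ((2 * l m) *\<^sub>R (matrix_inv (x i) ** dg {j} ** (coproj J (x 0) - coproj J (x i)) ** x i)) < d) sequentially" for i
      using d(1) by (intro order_tendstoD(2)) auto
    then have "eventually (\<lambda>m. \<forall>i\<in>{..Suc p}. norm ((2 * l m) *\<^sub>R (matrix_inv (x i) ** dg {j} ** (coproj J (x 0) - coproj J (x i)) ** x i)) < d) sequentially"
      by (intro eventually_ball_finite) auto
    then obtain M where M: "\<And>m i. m \<ge> M \<Longrightarrow> i \<le> Suc p \<Longrightarrow>
        norm ((2 * l m) *\<^sub>R (matrix_inv (x i) ** dg {j} ** (coproj J (x 0) - coproj J (x i)) ** x i)) < d"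
      unfolding eventually_sequentially by auto
    \<comment> \<open>\<open>m\<close> is large enough for the squeezing estimate and approximates
      \<open>k0\<close> on all faces of \<open>x\<close> at once.\<close>
    obtain m where m: "m \<ge> M" "\<And>i. i \<le> Suc p \<Longrightarrow> \<bar>k m (omit i x) - k0 (omit i x)\<bar> < e"
      using k0[of "(\<lambda>i. omit i x) ` {..Suc p}" e M] e by auto
    have \<Psi>\<Phi>: "\<bar>g (?P (\<Psi> m)) - g (left_mult (Suc p) ?r (?P (\<Phi> m)))\<bar> < e"
    proof (rule d(2)[OF refl_t \<Psi>t])
      fix i assume i: "i \<le> Suc p"
      then have "matrix_inv (left_mult (Suc p) ?r (?P (\<Phi> m)) i) ** ?P (\<Psi> m) i =
          matrix_inv (?r ** squeeze J (l m) (x i)) ** (reflect J j (x i) ** squeeze J (l m) (x i))"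
        by (simp add: left_mult_def \<Phi>_def \<Psi>_def squeeze_reflect[OF x0(2) j])
      also have "\<dots> = mat 1 + (2 * l m) *\<^sub>R (matrix_inv (x i) ** dg {j} ** (coproj J (x 0) - coproj J (x i)) ** x i)"
        by (rule squeeze_reflect_quotient[OF x0(2)[OF i] x0(1) j l0])
      finally show "norm (matrix_inv (left_mult (Suc p) ?r (?P (\<Phi> m)) i) ** ?P (\<Psi> m) i - mat 1) < d"
        using M[OF m(1) i] by simp
    qed
    have "g (left_mult (Suc p) ?r (?P (\<Phi> m))) = - g (?P (\<Phi> m))"
      using g reflect_line_stab[OF j, of "x 0"] \<Phi>t[of m] by (simp add: CH_def eps_reflect[OF j])
    then have small: "\<bar>g (?P (\<Psi> m)) + g (?P (\<Phi> m))\<bar> < e" using \<Psi>\<Phi> by simp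
    have da: "g (?P (\<Phi> m)) - g x = cobd p (a m) x"
      using vertex_operator.prism_homotopy[OF V\<Phi> gC z x, of m] unfolding act_from_map a_def .
    have db: "g (?P (\<Psi> m)) - g x = cobd p (b m) x"
      using vertex_operator.prism_homotopy[OF V\<Psi> gC z x, of m] unfolding act_from_map b_def .
    have "cobd p (k m) x = (\<Sum>i\<le>Suc p. (-1)^i * (- (a m (omit i x) + b m (omit i x)) / 2))"
      unfolding cobd_def using x by (intro sum.cong) (auto simp: k_def omit_tuples)
    also have "\<dots> = (\<Sum>i\<le>Suc p. (-1/2) * ((-1)^i * a m (omit i x) + (-1)^i * b m (omit i x)))"
      by (intro sum.cong) (auto simp: field_simps)
    also have "\<dots> = - (cobd p (a m) x + cobd p (b m) x) / 2"
      unfolding sum_distrib_left[symmetric] sum.distrib cobd_def by (simp add: field_simps del: sum.atMost_Suc)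
    finally have km: "cobd p (k m) x - g x = - (g (?P (\<Psi> m)) + g (?P (\<Phi> m))) / 2"
      unfolding da[symmetric] db[symmetric] by (simp add: field_simps)
    have eq: "cobd p (k m) x - cobd p k0 x = (\<Sum>i\<le>Suc p. (-1)^i * (k m (omit i x) - k0 (omit i x)))"
      unfolding cobd_def sum_subtractf[symmetric] right_diff_distrib ..
    have "\<bar>cobd p (k m) x - cobd p k0 x\<bar> \<le> (\<Sum>i\<le>Suc p. \<bar>(-1)^i * (k m (omit i x) - k0 (omit i x))\<bar>)"
      unfolding eq by (rule sum_abs)
    also have "\<dots> \<le> (\<Sum>i\<le>Suc p. e)"
      using m(2) by (intro sum_mono) (auto simp: abs_mult intro!: less_imp_le)
    finally have "\<bar>cobd p (k m) x - cobd p k0 x\<bar> \<le> (p + 2) * e" by simp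
    moreover have "\<bar>cobd p (k m) x - g x\<bar> \<le> e" unfolding km using small e by (simp add: abs_le_iff abs_less_iff)
    ultimately have "\<bar>g x - cobd p k0 x\<bar> \<le> (p + 2) * e + e" by linarith
    also have "\<dots> < (p + 4) * e" using e by (simp add: algebra_simps)
    also have "\<dots> = \<bar>g x - cobd p k0 x\<bar>" by (simp add: e_def)
    finally show False by simp
  qed
  ultimately show ?thesis by (intro bexI[of _ k0]) (auto simp: CH_def)
qed

lemma CH_lin:
  fixes f g :: "(nat \<Rightarrow> real^'n^'n) \<Rightarrow> real"
  shows "f \<in> CH H q \<Longrightarrow> g \<in> CH H q \<Longrightarrow> (\<lambda>x. a * f x + b * g x) \<in> CH H q"
  by (auto simp: CH_def algebra_simps intro!: CB_lin)

text \<open>Convolution changes a cocycle by the coboundary of its prism, so uniform continuity may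
  be assumed.\<close>

lemma line_stab_column_exact:
  fixes f :: "(nat \<Rightarrow> real^'n^'n) \<Rightarrow> real"
  assumes j: "j \<in> J" and f: "f \<in> CH (line_stab J) (Suc p)"
    and z: "\<And>x. x \<in> tuples (Suc (Suc p)) \<Longrightarrow> cobd (Suc p) f x = 0"
  shows "\<exists>f'\<in>CH (line_stab J) p. \<forall>x\<in>tuples (Suc p). f x = cobd p f' x"
proof -
  interpret vertex_operator smooth "line_stab J" by (rule vertex_operator_smooth[OF line_stab_GLn])
  have fC: "f \<in> CB (Suc p)" using f by (simp add: CH_def)
  define g where "g = act_from smooth 0 (Suc (Suc p)) f"
  have gH: "g \<in> CH (line_stab J) (Suc p)" unfolding g_def by (rule act_from_CH[OF f]) simp
  have gu: "unif (Suc p) g" unfolding g_def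
    by (intro unif_if_uniform_at uniform_at_act_from_smooth fC) auto
  have gf: "g x - f x = cobd p (prism smooth p f) x" if "x \<in> tuples (Suc p)" for x
    unfolding g_def by (rule prism_homotopy[OF fC z that])
  have "cobd (Suc p) g x = 0" if x: "x \<in> tuples (Suc (Suc p))" for x
  proof -
    have "cobd (Suc p) g x - cobd (Suc p) f x = (\<Sum>i\<le>Suc (Suc p). (-1)^i * (g (omit i x) - f (omit i x)))"
      unfolding cobd_def sum_subtractf[symmetric] right_diff_distrib ..
    also have "\<dots> = cobd (Suc p) (cobd p (prism smooth p f)) x"
      unfolding cobd_def[of "Suc p"] by (intro sum.cong) (auto simp: gf omit_tuples[OF x])
    finally show ?thesis by (simp add: cobd_cobd z[OF x])
  qed
  then obtain k where k: "k \<in> CH (line_stab J) p" "\<And>x. x \<in> tuples (Suc p) \<Longrightarrow> g x = cobd p k x"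
    using line_stab_column_exact_unif[OF j gH gu] by blast
  let ?f = "\<lambda>x. 1 * k x + (-1) * prism smooth p f x"
  have "?f \<in> CH (line_stab J) p" by (intro CH_lin k(1) prism_CH f)
  moreover have "f x = cobd p ?f x" if x: "x \<in> tuples (Suc p)" for x
  proof -
    have "cobd p ?f x = cobd p k x - cobd p (prism smooth p f) x"
      unfolding cobd_def sum_subtractf[symmetric] by (simp add: algebra_simps)
    then show ?thesis using gf[OF x] k(2)[OF x] by simp
  qed
  ultimately show ?thesis by blast
qed

text \<open>A closed function of one group element is constant, and a reflection in the stabilizer
  changes its sign.\<close>

lemma line_stab_column_exact_0:
  fixes f :: "(nat \<Rightarrow> real^'n^'n) \<Rightarrow> real"
  assumes f: "f \<in> CH (line_stab J) 0" and z: "\<And>x. x \<in> tuples 1 \<Longrightarrow> cobd 0 f x = 0" and x: "x \<in> tuples 0"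
  shows "f x = 0"
proof -
  \<comment> \<open>Any coordinate will do, in \<open>J\<close> or not: a diagonal reflection
    preserves all coordinate lines.\<close>
  obtain j :: 'n where True by simp
  let ?h = "mat 1 - 2 *\<^sub>R dg {j} :: real^'n^'n"
  have h: "?h \<in> line_stab J" "?h \<in> GLn" "eps ?h = -1"
    using reflection_line_stab[of j J] line_stab_GLn eps_dg_reflection[of j] by auto
  let ?y = "\<lambda>i. if i = 0 then ?h ** x 0 else if i = 1 then x 0 else 0"
  have "?y \<in> tuples 1" using x h by (auto simp: tuples_iff GLn_mult le_Suc_eq)
  then have "cobd 0 f ?y = 0" by (rule z)
  moreover have "omit 0 ?y = x" "omit (Suc 0) ?y = left_mult 0 ?h x"
    using x by (auto simp: omit_def tuples_iff left_mult_def fun_eq_iff)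
  ultimately have "f x = f (left_mult 0 ?h x)" by (simp add: cobd_def)
  also have "\<dots> = - f x" using f h x by (simp add: CH_def)
  finally show ?thesis by simp
qed

subsection \<open>Configurations in general position and the double complex\<close>

text \<open>Points of projective space are represented by vectors; independence of the
  representative is imposed on the functions, in \<open>mixed\<close>. The entries from
  \<open>k\<close> on are 0, so a configuration is determined by its \<open>k\<close>
  vectors.\<close>

definition conf :: "nat \<Rightarrow> (nat \<Rightarrow> real^'n) set" where
  "conf k = {v. (\<forall>I c. I \<subseteq> {..<k} \<longrightarrow> card I \<le> CARD('n) \<longrightarrow> (\<Sum>i\<in>I. c i *\<^sub>R v i) = 0 \<longrightarrow> (\<forall>i\<in>I. c i = 0)) \<and>
     (\<forall>i\<ge>k. v i = 0)}"

lemma confI: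
  fixes v :: "nat \<Rightarrow> real^'n"
  assumes "\<And>I c i. I \<subseteq> {..<k} \<Longrightarrow> card I \<le> CARD('n) \<Longrightarrow> (\<Sum>i\<in>I. c i *\<^sub>R v i) = 0 \<Longrightarrow> i \<in> I \<Longrightarrow> c i = 0"
    and "\<And>i. i \<ge> k \<Longrightarrow> v i = 0"
  shows "v \<in> conf k"
  unfolding conf_def using assms by blast

lemma conf_indep:
  fixes v :: "nat \<Rightarrow> real^'n"
  assumes "v \<in> conf k" "I \<subseteq> {..<k}" "card I \<le> CARD('n)" "(\<Sum>i\<in>I. c i *\<^sub>R v i) = 0" "i \<in> I"
  shows "c i = 0"
  using assms unfolding conf_def by blast

lemma conf_zero: "v \<in> conf k \<Longrightarrow> i \<ge> k \<Longrightarrow> v i = 0"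
  by (simp add: conf_def)

lemma conf_0: "v \<in> conf 0 \<longleftrightarrow> v = (\<lambda>_. 0)"
  by (auto simp: conf_def)

lemma omit_conf:
  fixes v :: "nat \<Rightarrow> real^'n"
  assumes v: "v \<in> conf (Suc k)" and i: "i \<le> k"
  shows "omit i v \<in> conf k"
proof (rule confI)
  fix I c j
  assume I: "I \<subseteq> {..<k}" "card I \<le> CARD('n)" "(\<Sum>i'\<in>I. c i' *\<^sub>R omit i v i') = 0" and j: "j \<in> I"
  define s where "s m = (if m < i then m else Suc m)" for m
  define t where "t m = (if m < i then m else m - 1)" for m
  have inj: "inj_on s I" by (auto simp: inj_on_def s_def split: if_splits)
  have ts: "t (s m) = m" for m by (simp add: s_def t_def)
  have "c (t (s j)) = 0"
  proof (rule conf_indep[OF v, where I = "s ` I" and c = "\<lambda>m. c (t m)" and i = "s j"])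
    show "s ` I \<subseteq> {..<Suc k}" using I(1) by (auto simp: s_def)
    show "card (s ` I) \<le> CARD('n)" using I(2) inj by (simp add: card_image)
    have "(\<Sum>m\<in>s ` I. c (t m) *\<^sub>R v m) = (\<Sum>m\<in>I. c m *\<^sub>R v (s m))"
      by (simp add: sum.reindex[OF inj] ts)
    also have "\<dots> = (\<Sum>m\<in>I. c m *\<^sub>R omit i v m)"
      by (intro sum.cong) (auto simp: omit_def s_def)
    finally show "(\<Sum>m\<in>s ` I. c (t m) *\<^sub>R v m) = 0" using I(3) by simp
  qed (use j in auto)
  then show "c j = 0" by (simp add: ts)
qed (use v i in \<open>auto simp: omit_def conf_def\<close>)

lemma mult_conf:
  fixes v :: "nat \<Rightarrow> real^'n"
  assumes v: "v \<in> conf k" and g: "g \<in> GLn"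
  shows "(\<lambda>i. g *v v i) \<in> conf k"
proof (rule confI)
  fix I c j
  assume I: "I \<subseteq> {..<k}" "card I \<le> CARD('n)" "(\<Sum>i\<in>I. c i *\<^sub>R (g *v v i)) = 0" and j: "j \<in> I"
  have "g *v (\<Sum>i\<in>I. c i *\<^sub>R v i) = 0"
    using I(3) by (simp add: linear_sum[OF matrix_vector_mul_linear] linear_scale[OF matrix_vector_mul_linear])
  then have "matrix_inv g *v (g *v (\<Sum>i\<in>I. c i *\<^sub>R v i)) = 0" by simp
  then have "(\<Sum>i\<in>I. c i *\<^sub>R v i) = 0"
    by (simp add: matrix_vector_mul_assoc matrix_inv_left[OF g] del: matrix_vector_mult_0_right)
  then show "c j = 0" by (rule conf_indep[OF v I(1,2) _ j])
qed (use v in \<open>simp add: conf_zero\<close>)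

lemma scale_conf:
  fixes v :: "nat \<Rightarrow> real^'n"
  assumes v: "v \<in> conf k" and a: "\<And>i. a i \<noteq> 0"
  shows "(\<lambda>i. a i *\<^sub>R v i) \<in> conf k"
proof (rule confI)
  fix I c j
  assume I: "I \<subseteq> {..<k}" "card I \<le> CARD('n)" "(\<Sum>i\<in>I. c i *\<^sub>R a i *\<^sub>R v i) = 0" and j: "j \<in> I"
  have "c j * a j = 0" by (rule conf_indep[OF v I(1,2) _ j]) (use I(3) in simp)
  then show "c j = 0" using a by simp
qed (use v in \<open>simp add: conf_zero\<close>)

definition cons :: "'a \<Rightarrow> (nat \<Rightarrow> 'a) \<Rightarrow> nat \<Rightarrow> 'a" where
  "cons w v = (\<lambda>i. case i of 0 \<Rightarrow> w | Suc j \<Rightarrow> v j)"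

lemma cons_simps [simp]: "cons w v 0 = w" "cons w v (Suc j) = v j"
  by (simp_all add: cons_def)

lemma omit_0_cons: "omit 0 (cons w v) = v"
  by (auto simp: omit_def fun_eq_iff)

lemma omit_Suc_cons: "omit (Suc i) (cons w v) = cons w (omit i v)"
  by (auto simp: omit_def cons_def fun_eq_iff split: nat.split)

definition generic :: "nat \<Rightarrow> (nat \<Rightarrow> real^'n) \<Rightarrow> (real^'n) set" where
  "generic k v = {w. \<forall>I. I \<subseteq> {..<k} \<longrightarrow> card I < CARD('n) \<longrightarrow> w \<notin> span (v ` I)}"

text \<open>A relation of at most n terms that involves \<open>w\<close> would put \<open>w\<close>
  into the span of fewer than n of the old vectors.\<close>

lemma cons_conf:
  fixes v :: "nat \<Rightarrow> real^'n"
  assumes v: "v \<in> conf k" and w: "w \<in> generic k v"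
  shows "cons w v \<in> conf (Suc k)"
proof (rule confI)
  fix I c j
  assume I: "I \<subseteq> {..<Suc k}" "card I \<le> CARD('n)" "(\<Sum>i\<in>I. c i *\<^sub>R cons w v i) = 0" and j: "j \<in> I"
  have finI: "finite I" using I(1) finite_subset by blast
  define I' where "I' = {i. Suc i \<in> I}"
  have I': "I' \<subseteq> {..<k}" using I(1) by (auto simp: I'_def)
  have fin: "finite I'" using I' finite_subset by blast
  have eq: "I - {0} = Suc ` I'"
    by (auto simp: I'_def image_iff) (metis not0_implies_Suc)
  have card: "card I' = card (I - {0})" unfolding eq by (simp add: card_image)
  have sumS: "(\<Sum>i\<in>I - {0}. c i *\<^sub>R cons w v i) = (\<Sum>i\<in>I'. c (Suc i) *\<^sub>R v i)"
    unfolding eq by (simp add: sum.reindex)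
  have c0: "c 0 = 0" if "0 \<in> I"
  proof (rule ccontr)
    assume c: "c 0 \<noteq> 0"
    have "c 0 *\<^sub>R w + (\<Sum>i\<in>I'. c (Suc i) *\<^sub>R v i) = 0"
      using I(3) sum.remove[OF finI that, of "\<lambda>i. c i *\<^sub>R cons w v i"] sumS by simp
    then have "c 0 *\<^sub>R w = - (\<Sum>i\<in>I'. c (Suc i) *\<^sub>R v i)" by (simp add: eq_neg_iff_add_eq_0)
    then have "w = (1 / c 0) *\<^sub>R (- (\<Sum>i\<in>I'. c (Suc i) *\<^sub>R v i))"
      using c by (metis divide_self_if scaleR_one scaleR_scaleR times_divide_eq_left mult_1)
    moreover have "\<dots> \<in> span (v ` I')"
      by (intro span_scale span_neg span_sum) (auto intro: span_base)
    moreover have "card I' < CARD('n)"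
      using card card_Diff1_less[OF finI that] I(2) by simp
    ultimately show False using w I' unfolding generic_def by blast
  qed
  have "(\<Sum>i\<in>I'. c (Suc i) *\<^sub>R v i) = 0"
  proof (cases "0 \<in> I")
    case True
    then show ?thesis
      using I(3) sum.remove[OF finI True, of "\<lambda>i. c i *\<^sub>R cons w v i"] sumS c0 by simp
  next
    case False
    then show ?thesis using I(3) sumS by simp
  qed
  moreover have "card I' \<le> CARD('n)" using card I(2) card_mono[OF finI, of "I - {0}"] by simp
  ultimately have "c (Suc i) = 0" if "i \<in> I'" for i
    using conf_indep[OF v I', of "\<lambda>i. c (Suc i)"] that by blast
  then show "c j = 0" using j c0 by (cases j) (auto simp: I'_def)
qed (use v in \<open>auto simp: cons_def conf_def split: nat.splits\<close>)

text \<open>The excluded set is a finite union of proper subspaces. Openness of the rest gives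
  measurable integrands, and full measure makes the exceptional vectors invisible to the
  average.\<close>

lemma generic_preimage:
  fixes v :: "nat \<Rightarrow> real^'n"
  assumes g: "g \<in> GLn"
  shows "open {w. g *v w \<in> generic k v}" "AE w in lborel. g *v w \<in> generic k v"
proof -
  let ?S = "{I. I \<subseteq> {..<k} \<and> card I < CARD('n)}"
  let ?B = "\<lambda>I. (*v) (matrix_inv g) ` span (v ` I)"
  have fin: "finite ?S" by (rule finite_subset[of _ "Pow {..<k}"]) auto
  have B: "?B I = {w. g *v w \<in> span (v ` I)}" for I
  proof (intro equalityI subsetI)
    fix w assume "w \<in> ?B I"
    then obtain s where "s \<in> span (v ` I)" "w = matrix_inv g *v s" by blast
    then show "w \<in> {w. g *v w \<in> span (v ` I)}"
      by (simp add: matrix_vector_mul_assoc matrix_inv_right[OF g])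
  next
    fix w assume "w \<in> {w. g *v w \<in> span (v ` I)}"
    moreover have "w = matrix_inv g *v (g *v w)"
      by (simp add: matrix_vector_mul_assoc matrix_inv_left[OF g])
    ultimately show "w \<in> ?B I" by blast
  qed
  have sub: "subspace (?B I)" for I
    by (rule linear_subspace_image[OF matrix_vector_mul_linear subspace_span])
  have neg: "negligible (?B I)" if I: "I \<in> ?S" for I
  proof (rule negligible_lowdim)
    have "finite I" using I finite_subset by blast
    have "dim (?B I) \<le> dim (span (v ` I))" by (rule dim_image_le[OF matrix_vector_mul_linear])
    also have "\<dots> \<le> card (v ` I)" unfolding dim_span by (rule dim_le_card') (simp add: \<open>finite I\<close>)
    also have "\<dots> \<le> card I" using \<open>finite I\<close> by (rule card_image_le)
    finally show "dim (?B I) < DIM(real^'n)" using I by simp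
  qed
  have eq: "{w. g *v w \<in> generic k v} = - (\<Union>I\<in>?S. ?B I)"
    unfolding B generic_def by auto
  have "closed (\<Union>I\<in>?S. ?B I)" by (intro closed_UN fin ballI closed_subspace sub)
  then show op: "open {w. g *v w \<in> generic k v}" unfolding eq by (rule open_Compl)
  have "negligible (\<Union>I\<in>?S. ?B I)" by (intro negligible_Union finite_imageI fin) (use neg in auto)
  then have "(\<Union>I\<in>?S. ?B I) \<in> null_sets lborel"
    using \<open>closed (\<Union>I\<in>?S. ?B I)\<close>
    by (simp add: negligible_iff_null_sets null_sets_completion_iff borel_closed)
  then have "AE w in lborel. w \<notin> (\<Union>I\<in>?S. ?B I)" by (rule AE_not_in)
  then show "AE w in lborel. g *v w \<in> generic k v"
    by eventually_elim (use eq in blast)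
qed

definition wt :: "real^'n \<Rightarrow> real" where
  "wt w = indicator (ball 0 1) w / measure lborel (ball (0 :: real^'n) 1)"

lemma integrable_wt: "integrable lborel (wt :: real^'n \<Rightarrow> real)"
  and integral_wt: "integral\<^sup>L lborel (wt :: real^'n \<Rightarrow> real) = 1"
  and wt_nonneg: "0 \<le> wt (w :: real^'n)"
proof -
  have fin: "emeasure lborel (ball (0 :: real^'n) 1) < \<infinity>" by (rule emeasure_lborel_ball_finite)
  have pos: "measure lborel (ball (0 :: real^'n) 1) > 0"
    using emeasure_lborel_open_pos[of "ball (0 :: real^'n) 1" 0] fin
    by (simp add: measure_def enn2real_positive_iff)
  have i: "integrable lborel (indicator (ball (0 :: real^'n) 1) :: _ \<Rightarrow> real)"
    by (rule integrable_real_indicator) (use fin in auto)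
  then show "integrable lborel (wt :: real^'n \<Rightarrow> real)" unfolding wt_def by simp
  show "integral\<^sup>L lborel (wt :: real^'n \<Rightarrow> real) = 1" unfolding wt_def using pos by simp
  show "0 \<le> wt w" by (simp add: wt_def)
qed

section \<open>Functions of points and group elements, and their two differentials\<close>

definition mixed :: "nat \<Rightarrow> nat \<Rightarrow> ((nat \<Rightarrow> real^'n) \<Rightarrow> (nat \<Rightarrow> real^'n^'n) \<Rightarrow> real) set" where
  "mixed k q = {F. continuous_on (conf k \<times> tuples q) (\<lambda>(v,x). F v x) \<and>
     (\<exists>C. \<forall>v\<in>conf k. \<forall>x\<in>tuples q. \<bar>F v x\<bar> \<le> C) \<and>
     (\<forall>g\<in>GLn. \<forall>v\<in>conf k. \<forall>x\<in>tuples q. F (\<lambda>i. g *v v i) (left_mult q g x) = eps g * F v x) \<and>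
     (\<forall>a. (\<forall>i. a i \<noteq> 0) \<longrightarrow> (\<forall>v\<in>conf k. \<forall>x\<in>tuples q. F (\<lambda>i. a i *\<^sub>R v i) x = F v x))}"

lemma mixedI:
  fixes F :: "(nat \<Rightarrow> real^'n) \<Rightarrow> (nat \<Rightarrow> real^'n^'n) \<Rightarrow> real"
  assumes "\<And>v' v x' x. (\<And>n. v' n \<in> conf k) \<Longrightarrow> v \<in> conf k \<Longrightarrow> (\<And>i. (\<lambda>n. v' n i) \<longlonglongrightarrow> v i) \<Longrightarrow>
      (\<And>n. x' n \<in> tuples q) \<Longrightarrow> x \<in> tuples q \<Longrightarrow> (\<And>i. (\<lambda>n. x' n i) \<longlonglongrightarrow> x i) \<Longrightarrow> (\<lambda>n. F (v' n) (x' n)) \<longlonglongrightarrow> F v x"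
    and "\<And>v x. v \<in> conf k \<Longrightarrow> x \<in> tuples q \<Longrightarrow> \<bar>F v x\<bar> \<le> C"
    and "\<And>g v x. g \<in> GLn \<Longrightarrow> v \<in> conf k \<Longrightarrow> x \<in> tuples q \<Longrightarrow> F (\<lambda>i. g *v v i) (left_mult q g x) = eps g * F v x"
    and "\<And>a v x. (\<And>i. a i \<noteq> 0) \<Longrightarrow> v \<in> conf k \<Longrightarrow> x \<in> tuples q \<Longrightarrow> F (\<lambda>i. a i *\<^sub>R v i) x = F v x"
  shows "F \<in> mixed k q"
proof -
  have "continuous_on (conf k \<times> tuples q) (\<lambda>(v,x). F v x)"
  proof (rule continuous_on_sequentiallyI)
    fix u :: "nat \<Rightarrow> (nat \<Rightarrow> real^'n) \<times> (nat \<Rightarrow> real^'n^'n)" and a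
    assume u: "\<forall>n. u n \<in> conf k \<times> tuples q" "a \<in> conf k \<times> tuples q" "u \<longlonglongrightarrow> a"
    have "(\<lambda>n. fst (u n)) \<longlonglongrightarrow> fst a" "(\<lambda>n. snd (u n)) \<longlonglongrightarrow> snd a"
      by (intro tendsto_fst tendsto_snd u(3))+
    then have "(\<lambda>n. F (fst (u n)) (snd (u n))) \<longlonglongrightarrow> F (fst a) (snd a)"
      using u by (intro assms(1)) (auto simp: tendsto_fun_iff mem_Times_iff)
    then show "(\<lambda>n. case u n of (v, x) \<Rightarrow> F v x) \<longlonglongrightarrow> (case a of (v, x) \<Rightarrow> F v x)"
      by (simp add: case_prod_unfold)
  qed
  then show ?thesis unfolding mixed_def using assms(2-4) by auto
qed

lemma mixed_tendsto:
  fixes F :: "(nat \<Rightarrow> real^'n) \<Rightarrow> (nat \<Rightarrow> real^'n^'n) \<Rightarrow> real"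
  assumes F: "F \<in> mixed k q" and v: "\<And>n. v' n \<in> conf k" "v \<in> conf k" "\<And>i. (\<lambda>n. v' n i) \<longlonglongrightarrow> v i"
    and x: "\<And>n. x' n \<in> tuples q" "x \<in> tuples q" "\<And>i. (\<lambda>n. x' n i) \<longlonglongrightarrow> x i"
  shows "(\<lambda>n. F (v' n) (x' n)) \<longlonglongrightarrow> F v x"
proof -
  have c: "continuous_on (conf k \<times> tuples q) (\<lambda>(v,x). F v x)" using F by (simp add: mixed_def)
  have "(\<lambda>n. (v' n, x' n)) \<longlonglongrightarrow> (v, x)"
    using v(3) x(3) by (intro tendsto_Pair) (simp_all add: tendsto_fun_iff)
  then have "(\<lambda>n. (\<lambda>(v,x). F v x) (v' n, x' n)) \<longlonglongrightarrow> (\<lambda>(v,x). F v x) (v, x)"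
    by (rule continuous_on_tendsto_compose[OF c]) (use v x in auto)
  then show ?thesis by simp
qed

lemma mixed_bound:
  assumes "F \<in> mixed k q"
  obtains C where "\<And>v x. v \<in> conf k \<Longrightarrow> x \<in> tuples q \<Longrightarrow> \<bar>F v x\<bar> \<le> C"
  using assms unfolding mixed_def by blast

lemma mixed_equiv: "F \<in> mixed k q \<Longrightarrow> g \<in> GLn \<Longrightarrow> v \<in> conf k \<Longrightarrow> x \<in> tuples q \<Longrightarrow>
    F (\<lambda>i. g *v v i) (left_mult q g x) = eps g * F v x"
  unfolding mixed_def by blast

lemma mixed_scale: "F \<in> mixed k q \<Longrightarrow> (\<And>i. a i \<noteq> 0) \<Longrightarrow> v \<in> conf k \<Longrightarrow> x \<in> tuples q \<Longrightarrow>
    F (\<lambda>i. a i *\<^sub>R v i) x = F v x"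
  unfolding mixed_def by blast

text \<open>Raises the number of points from \<open>k\<close> to \<open>k + 1\<close>. In particular
  \<open>dV 0\<close> is the augmentation, which reads a cochain as a function of one point.\<close>

definition dV :: "nat \<Rightarrow> ((nat \<Rightarrow> 'v) \<Rightarrow> 'x \<Rightarrow> real) \<Rightarrow> (nat \<Rightarrow> 'v) \<Rightarrow> 'x \<Rightarrow> real" where
  "dV k F v x = (\<Sum>i\<le>k. (-1) ^ i * F (omit i v) x)"

definition dG :: "nat \<Rightarrow> ('v \<Rightarrow> (nat \<Rightarrow> real^'n^'n) \<Rightarrow> real) \<Rightarrow> 'v \<Rightarrow> (nat \<Rightarrow> real^'n^'n) \<Rightarrow> real" where
  "dG q F v = cobd q (F v)"

lemma dV_dV: "dV (Suc k) (dV k F) v x = 0"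
  unfolding dV_def by (rule alternating_sum_omit_omit[where f = "\<lambda>v. F v x"])

lemma dG_dG: "dG (Suc q) (dG q F) v x = 0"
  unfolding dG_def by (rule cobd_cobd)

lemma dG_dV: "dG q (dV k F) v x = dV k (dG q F) v x"
  unfolding dG_def dV_def cobd_def sum_distrib_left
  by (subst sum.swap) (simp add: ac_simps)

lemma dV_cong:
  assumes "\<And>v x. v \<in> conf k \<Longrightarrow> x \<in> tuples q \<Longrightarrow> F v x = G v x" "v \<in> conf (Suc k)" "x \<in> tuples q"
  shows "dV k F v x = dV k G v x"
  unfolding dV_def by (intro sum.cong refl) (auto simp: assms(1)[OF omit_conf[OF assms(2)] assms(3)])

lemma dG_cong:
  assumes "\<And>v x. v \<in> conf k \<Longrightarrow> x \<in> tuples q \<Longrightarrow> F v x = G v x" "v \<in> conf k" "x \<in> tuples (Suc q)"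
  shows "dG q F v x = dG q G v x"
  unfolding dG_def cobd_def
  by (intro sum.cong refl) (auto simp: assms(1)[OF assms(2) omit_tuples[OF assms(3)]])

lemma dV_lin: "dV k (\<lambda>v x. a * F v x + b * G v x) v x = a * dV k F v x + b * dV k G v x"
  unfolding dV_def sum_distrib_left sum.distrib[symmetric] by (simp add: algebra_simps)

lemma dG_lin: "dG q (\<lambda>v x. a * F v x + b * G v x) v x = a * dG q F v x + b * dG q G v x"
  unfolding dG_def cobd_def sum_distrib_left sum.distrib[symmetric] by (simp add: algebra_simps)

lemma mixed_lin:
  fixes F G :: "(nat \<Rightarrow> real^'n) \<Rightarrow> (nat \<Rightarrow> real^'n^'n) \<Rightarrow> real"
  assumes F: "F \<in> mixed k q" and G: "G \<in> mixed k q"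
  shows "(\<lambda>v x. a * F v x + b * G v x) \<in> mixed k q"
proof -
  obtain C where C: "\<And>v x. v \<in> conf k \<Longrightarrow> x \<in> tuples q \<Longrightarrow> \<bar>F v x\<bar> \<le> C" using mixed_bound[OF F] by blast
  obtain D where D: "\<And>v x. v \<in> conf k \<Longrightarrow> x \<in> tuples q \<Longrightarrow> \<bar>G v x\<bar> \<le> D" using mixed_bound[OF G] by blast
  show ?thesis
  proof (rule mixedI[where C = "\<bar>a\<bar> * C + \<bar>b\<bar> * D"])
    fix v :: "nat \<Rightarrow> real^'n" and x :: "nat \<Rightarrow> real^'n^'n" assume vx: "v \<in> conf k" "x \<in> tuples q"
    have "\<bar>a * F v x + b * G v x\<bar> \<le> \<bar>a\<bar> * \<bar>F v x\<bar> + \<bar>b\<bar> * \<bar>G v x\<bar>"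
      using abs_triangle_ineq[of "a * F v x" "b * G v x"] by (simp add: abs_mult)
    also have "\<dots> \<le> \<bar>a\<bar> * C + \<bar>b\<bar> * D"
      by (intro add_mono mult_left_mono C D vx) auto
    finally show "\<bar>a * F v x + b * G v x\<bar> \<le> \<bar>a\<bar> * C + \<bar>b\<bar> * D" .
  qed (auto simp: mixed_equiv[OF F] mixed_equiv[OF G] mixed_scale[OF F] mixed_scale[OF G] algebra_simps
       intro!: tendsto_intros mixed_tendsto[OF F] mixed_tendsto[OF G])
qed

lemma mixed_zero: "(\<lambda>_ _. 0) \<in> mixed k q"
  by (rule mixedI[where C = 0]) auto

lemma mixed_sum:
  assumes "\<And>i. i \<in> I \<Longrightarrow> F i \<in> mixed k q"
  shows "(\<lambda>v x. \<Sum>i\<in>I. c i * F i v x) \<in> mixed k q"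
  using assms
proof (induction I rule: infinite_finite_induct)
  case (insert i I)
  then have "(\<lambda>v x. c i * F i v x + 1 * (\<Sum>i\<in>I. c i * F i v x)) \<in> mixed k q" by (intro mixed_lin) auto
  then show ?case using insert by simp
qed (auto simp: mixed_zero)

lemma dV_mixed:
  fixes F :: "(nat \<Rightarrow> real^'n) \<Rightarrow> (nat \<Rightarrow> real^'n^'n) \<Rightarrow> real"
  assumes F: "F \<in> mixed k q"
  shows "dV k F \<in> mixed (Suc k) q"
proof -
  obtain C where C: "\<And>v x. v \<in> conf k \<Longrightarrow> x \<in> tuples q \<Longrightarrow> \<bar>F v x\<bar> \<le> C" using mixed_bound[OF F] by blast
  have "(\<lambda>v x. F (omit i v) x) \<in> mixed (Suc k) q" if i: "i \<in> {..k}" for i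
  proof (rule mixedI[where C = C])
    have i: "i \<le> k" using that by simp
    show "\<bar>F (omit i v) x\<bar> \<le> C" if "v \<in> conf (Suc k)" "x \<in> tuples q" for v x
      by (intro C omit_conf that i)
    show "F (omit i (\<lambda>i. g *v v i)) (left_mult q g x) = eps g * F (omit i v) x"
      if "g \<in> GLn" "v \<in> conf (Suc k)" "x \<in> tuples q" for g v x
    proof -
      have "omit i (\<lambda>i. g *v v i) = (\<lambda>j. g *v omit i v j)" by (auto simp: omit_def fun_eq_iff)
      then show ?thesis using mixed_equiv[OF F that(1) omit_conf[OF that(2) i] that(3)] by simp
    qed
    show "F (omit i (\<lambda>i. a i *\<^sub>R v i)) x = F (omit i v) x"
      if "\<And>i. a i \<noteq> 0" "v \<in> conf (Suc k)" "x \<in> tuples q" for a v x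
    proof -
      have eq: "omit i (\<lambda>i. a i *\<^sub>R v i) = (\<lambda>j. omit i a j *\<^sub>R omit i v j)" by (auto simp: omit_def fun_eq_iff)
      show ?thesis unfolding eq
        by (rule mixed_scale[OF F _ omit_conf[OF that(2) i] that(3)]) (simp add: omit_def that(1))
    qed
    show "(\<lambda>n. F (omit i (v' n)) (x' n)) \<longlonglongrightarrow> F (omit i v) x"
      if "\<And>n. v' n \<in> conf (Suc k)" "v \<in> conf (Suc k)" "\<And>i. (\<lambda>n. v' n i) \<longlonglongrightarrow> v i"
        "\<And>n. x' n \<in> tuples q" "x \<in> tuples q" "\<And>i. (\<lambda>n. x' n i) \<longlonglongrightarrow> x i" for v' v x' x
      by (rule mixed_tendsto[OF F omit_conf[OF that(1) i] omit_conf[OF that(2) i] _ that(4-6)]) (simp add: omit_def that(3))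
  qed
  then show ?thesis unfolding dV_def[abs_def] by (rule mixed_sum)
qed

lemma dG_mixed:
  fixes F :: "(nat \<Rightarrow> real^'n) \<Rightarrow> (nat \<Rightarrow> real^'n^'n) \<Rightarrow> real"
  assumes F: "F \<in> mixed k q"
  shows "dG q F \<in> mixed k (Suc q)"
proof -
  obtain C where C: "\<And>v x. v \<in> conf k \<Longrightarrow> x \<in> tuples q \<Longrightarrow> \<bar>F v x\<bar> \<le> C" using mixed_bound[OF F] by blast
  have "(\<lambda>v x. F v (omit i x)) \<in> mixed k (Suc q)" if i: "i \<in> {..Suc q}" for i
  proof (rule mixedI[where C = C])
    have i: "i \<le> Suc q" using that by simp
    show "\<bar>F v (omit i x)\<bar> \<le> C" if "v \<in> conf k" "x \<in> tuples (Suc q)" for v x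
      by (intro C omit_tuples that i)
    show "F (\<lambda>i. g *v v i) (omit i (left_mult (Suc q) g x)) = eps g * F v (omit i x)"
      if "g \<in> GLn" "v \<in> conf k" "x \<in> tuples (Suc q)" for g v x
      unfolding omit_left_mult[OF i] by (rule mixed_equiv[OF F that(1,2) omit_tuples[OF that(3) i]])
    show "F (\<lambda>i. a i *\<^sub>R v i) (omit i x) = F v (omit i x)"
      if "\<And>i. a i \<noteq> 0" "v \<in> conf k" "x \<in> tuples (Suc q)" for a v x
      by (rule mixed_scale[OF F that(1,2) omit_tuples[OF that(3) i]])
    show "(\<lambda>n. F (v' n) (omit i (x' n))) \<longlonglongrightarrow> F v (omit i x)"
      if "\<And>n. v' n \<in> conf k" "v \<in> conf k" "\<And>i. (\<lambda>n. v' n i) \<longlonglongrightarrow> v i"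
        "\<And>n. x' n \<in> tuples (Suc q)" "x \<in> tuples (Suc q)" "\<And>i. (\<lambda>n. x' n i) \<longlonglongrightarrow> x i" for v' v x' x
      by (rule mixed_tendsto[OF F that(1-3) omit_tuples[OF that(4) i] omit_tuples[OF that(5) i]]) (simp add: omit_def that(6))
  qed
  then show ?thesis unfolding dG_def[abs_def] cobd_def[abs_def] by (rule mixed_sum)
qed

section \<open>Averaging over a random vector\<close>

definition integrand :: "nat \<Rightarrow> ((nat \<Rightarrow> real^'n) \<Rightarrow> (nat \<Rightarrow> real^'n^'n) \<Rightarrow> real) \<Rightarrow> (nat \<Rightarrow> real^'n) \<Rightarrow> (nat \<Rightarrow> real^'n^'n) \<Rightarrow> real^'n \<Rightarrow> real" where
  "integrand k F v x w = wt w * (indicator {w. x 0 *v w \<in> generic k v} w *\<^sub>R F (cons (x 0 *v w) v) x)"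

definition contract :: "nat \<Rightarrow> ((nat \<Rightarrow> real^'n) \<Rightarrow> (nat \<Rightarrow> real^'n^'n) \<Rightarrow> real) \<Rightarrow> (nat \<Rightarrow> real^'n) \<Rightarrow> (nat \<Rightarrow> real^'n^'n) \<Rightarrow> real" where
  "contract k F v x = (\<integral>w. integrand k F v x w \<partial>lborel)"

lemma borel_measurable_wt: "(wt :: real^'n \<Rightarrow> real) \<in> borel_measurable borel"
  using borel_measurable_integrable[OF integrable_wt[where 'n = 'n]] by simp

lemma tuples_0_GLn: "x \<in> tuples q \<Longrightarrow> x 0 \<in> GLn"
  by (simp add: tuples_iff)

lemma integrand_measurable:
  fixes F :: "(nat \<Rightarrow> real^'n) \<Rightarrow> (nat \<Rightarrow> real^'n^'n) \<Rightarrow> real"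
  assumes F: "F \<in> mixed (Suc k) q" and v: "v \<in> conf k" and x: "x \<in> tuples q"
  shows "integrand k F v x \<in> borel_measurable lborel"
proof -
  let ?G = "{w. x 0 *v w \<in> generic k v}"
  have "continuous_on ?G (\<lambda>w. F (cons (x 0 *v w) v) x)"
  proof (rule continuous_on_sequentiallyI, rule mixed_tendsto[OF F _ _ _ x x])
    fix u :: "nat \<Rightarrow> real^'n" and a i assume u: "\<forall>n. u n \<in> ?G" "a \<in> ?G" "u \<longlonglongrightarrow> a"
    show "cons (x 0 *v u n) v \<in> conf (Suc k)" for n using u by (intro cons_conf v) auto
    show "cons (x 0 *v a) v \<in> conf (Suc k)" using u by (intro cons_conf v) auto
    show "(\<lambda>n. cons (x 0 *v u n) v i) \<longlonglongrightarrow> cons (x 0 *v a) v i"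
      by (cases i) (auto intro!: tendsto_matrix_vector_mult u(3))
  qed auto
  then have "(\<lambda>w. indicator ?G w *\<^sub>R F (cons (x 0 *v w) v) x) \<in> borel_measurable borel"
    by (intro borel_measurable_continuous_on_indicator borel_open generic_preimage tuples_0_GLn[OF x])
  then show ?thesis unfolding integrand_def[abs_def] by (simp add: borel_measurable_times[OF borel_measurable_wt])
qed

lemma integrand_bound:
  fixes F :: "(nat \<Rightarrow> real^'n) \<Rightarrow> (nat \<Rightarrow> real^'n^'n) \<Rightarrow> real"
  assumes C: "\<And>v x. v \<in> conf (Suc k) \<Longrightarrow> x \<in> tuples q \<Longrightarrow> \<bar>F v x\<bar> \<le> C" and v: "v \<in> conf k" and x: "x \<in> tuples q"
  shows "\<bar>integrand k F v x w\<bar> \<le> \<bar>C\<bar> * wt w"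
proof (cases "x 0 *v w \<in> generic k v")
  case True
  have "\<bar>F (cons (x 0 *v w) v) x\<bar> \<le> \<bar>C\<bar>" using C[OF cons_conf[OF v True] x] by linarith
  then have "\<bar>F (cons (x 0 *v w) v) x\<bar> * wt w \<le> \<bar>C\<bar> * wt w" using wt_nonneg by (rule mult_right_mono)
  then show ?thesis
    using True wt_nonneg[of w] by (simp add: integrand_def abs_mult mult.commute)
qed (simp add: integrand_def wt_nonneg)

lemma integrand_integrable:
  fixes F :: "(nat \<Rightarrow> real^'n) \<Rightarrow> (nat \<Rightarrow> real^'n^'n) \<Rightarrow> real"
  assumes F: "F \<in> mixed (Suc k) q" and v: "v \<in> conf k" and x: "x \<in> tuples q"
  shows "integrable lborel (integrand k F v x)"
proof -
  obtain C where C: "\<And>v x. v \<in> conf (Suc k) \<Longrightarrow> x \<in> tuples q \<Longrightarrow> \<bar>F v x\<bar> \<le> C" using mixed_bound[OF F] by blast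
  have "integrable lborel (\<lambda>w::real^'n. \<bar>C\<bar> * wt w)" by (intro integrable_mult_right integrable_wt)
  then show ?thesis
    by (rule Bochner_Integration.integrable_bound[OF _ integrand_measurable[OF F v x]])
       (intro AE_I2, use integrand_bound[where F = F, OF C v x] in \<open>simp add: abs_mult abs_of_nonneg[OF wt_nonneg]\<close>)
qed

text \<open>Outside general position \<open>F\<close> is uncontrolled, so the integrand is cut off
  there; almost every \<open>w\<close> is generic, and the cutoff disappears under the
  integral.\<close>

lemma integrand_AE:
  fixes F :: "(nat \<Rightarrow> real^'n) \<Rightarrow> (nat \<Rightarrow> real^'n^'n) \<Rightarrow> real"
  assumes v: "v \<in> conf k" and x: "x \<in> tuples q"
  shows "AE w in lborel. cons (x 0 *v w) v \<in> conf (Suc k) \<and> integrand k F v x w = wt w * F (cons (x 0 *v w) v) x"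
  using generic_preimage(2)[OF tuples_0_GLn[OF x], of k v]
  by eventually_elim (auto simp: integrand_def cons_conf[OF v])

lemma contract_mixed:
  fixes F :: "(nat \<Rightarrow> real^'n) \<Rightarrow> (nat \<Rightarrow> real^'n^'n) \<Rightarrow> real"
  assumes F: "F \<in> mixed (Suc k) q"
  shows "contract k F \<in> mixed k q"
proof -
  obtain C where C: "\<And>v x. v \<in> conf (Suc k) \<Longrightarrow> x \<in> tuples q \<Longrightarrow> \<bar>F v x\<bar> \<le> C" using mixed_bound[OF F] by blast
  have iw: "integrable lborel (\<lambda>w::real^'n. \<bar>C\<bar> * wt w)" by (intro integrable_mult_right integrable_wt)
  show ?thesis
  proof (rule mixedI[where C = "\<bar>C\<bar>"])
    fix v :: "nat \<Rightarrow> real^'n" and x :: "nat \<Rightarrow> real^'n^'n" assume v: "v \<in> conf k" and x: "x \<in> tuples q"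
    have "\<bar>contract k F v x\<bar> \<le> (\<integral>w. \<bar>integrand k F v x w\<bar> \<partial>lborel)"
      unfolding contract_def by (rule integral_abs_bound)
    also have "\<dots> \<le> (\<integral>w. \<bar>C\<bar> * wt (w::real^'n) \<partial>lborel)"
      by (intro integral_mono iw integrable_abs integrand_integrable[OF F v x]) (rule integrand_bound[where F = F, OF C v x])
    also have "\<dots> = \<bar>C\<bar>" by (simp add: integral_wt)
    finally show "\<bar>contract k F v x\<bar> \<le> \<bar>C\<bar>" .
    show "contract k F (\<lambda>i. g *v v i) (left_mult q g x) = eps g * contract k F v x" if g: "g \<in> GLn" for g
    proof -
      let ?v = "\<lambda>i. g *v v i" and ?x = "left_mult q g x"
      have v': "?v \<in> conf k" and x': "?x \<in> tuples q" using mult_conf[OF v g] left_mult_tuples[OF g x] .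
      have "contract k F ?v ?x = (\<integral>w. eps g * integrand k F v x w \<partial>lborel)"
        unfolding contract_def
      proof (rule integral_cong_AE)
        show "AE w in lborel. integrand k F ?v ?x w = eps g * integrand k F v x w"
          using integrand_AE[OF v x, of F] integrand_AE[OF v' x', of F]
        proof eventually_elim
          case (elim w)
          have "cons (?x 0 *v w) ?v = (\<lambda>i. g *v cons (x 0 *v w) v i)"
            by (auto simp: cons_def left_mult_def matrix_vector_mul_assoc fun_eq_iff split: nat.split)
          then show ?case using elim mixed_equiv[OF F g, of "cons (x 0 *v w) v" x] x by simp
        qed
      qed (use integrand_measurable[OF F v x] integrand_measurable[OF F v' x'] in auto)
      then show ?thesis by (simp add: contract_def)
    qed
    show "contract k F (\<lambda>i. a i *\<^sub>R v i) x = contract k F v x" if a: "\<And>i. a i \<noteq> 0" for a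
    proof -
      let ?v = "\<lambda>i. a i *\<^sub>R v i"
      have v': "?v \<in> conf k" by (rule scale_conf[OF v a])
      show ?thesis
        unfolding contract_def
      proof (rule integral_cong_AE)
        show "AE w in lborel. integrand k F ?v x w = integrand k F v x w"
          using integrand_AE[OF v x, of F] integrand_AE[OF v' x, of F]
        proof eventually_elim
          case (elim w)
          \<comment> \<open>The new vector is not rescaled, whence the additional factor 1.\<close>
          have "cons (x 0 *v w) ?v = (\<lambda>i. cons 1 a i *\<^sub>R cons (x 0 *v w) v i)"
            by (auto simp: cons_def fun_eq_iff split: nat.split)
          moreover have "cons 1 a i \<noteq> 0" for i using a by (cases i) auto
          ultimately show ?case using elim mixed_scale[OF F, of "cons 1 a" "cons (x 0 *v w) v" x] x by simp
        qed
      qed (use integrand_measurable[OF F v x] integrand_measurable[OF F v' x] in auto)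
    qed
  next
    fix v' :: "nat \<Rightarrow> nat \<Rightarrow> real^'n" and v and x' :: "nat \<Rightarrow> nat \<Rightarrow> real^'n^'n" and x
    assume v: "\<And>n. v' n \<in> conf k" "v \<in> conf k" "\<And>i. (\<lambda>n. v' n i) \<longlonglongrightarrow> v i"
      and x: "\<And>n. x' n \<in> tuples q" "x \<in> tuples q" "\<And>i. (\<lambda>n. x' n i) \<longlonglongrightarrow> x i"
    show "(\<lambda>n. contract k F (v' n) (x' n)) \<longlonglongrightarrow> contract k F v x"
      unfolding contract_def
    proof (rule integral_dominated_convergence[where w = "\<lambda>w. \<bar>C\<bar> * wt w"])
      show "integrand k F v x \<in> borel_measurable lborel" by (rule integrand_measurable[OF F v(2) x(2)])
      show "integrand k F (v' n) (x' n) \<in> borel_measurable lborel" for n by (rule integrand_measurable[OF F v(1) x(1)])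
      show "AE w in lborel. norm (integrand k F (v' n) (x' n) w) \<le> \<bar>C\<bar> * wt w" for n
        using integrand_bound[where F = F, OF C v(1) x(1)] by simp
      \<comment> \<open>The sequence is countable, so one null set contains the exceptions for all
        its members.\<close>
      have "AE w in lborel. \<forall>n. cons (x' n 0 *v w) (v' n) \<in> conf (Suc k) \<and>
          integrand k F (v' n) (x' n) w = wt w * F (cons (x' n 0 *v w) (v' n)) (x' n)"
        unfolding AE_all_countable using integrand_AE[OF v(1) x(1)] by blast
      then show "AE w in lborel. (\<lambda>n. integrand k F (v' n) (x' n) w) \<longlonglongrightarrow> integrand k F v x w"
        using integrand_AE[OF v(2) x(2), of F]
      proof eventually_elim
        case (elim w)
        have "(\<lambda>n. F (cons (x' n 0 *v w) (v' n)) (x' n)) \<longlonglongrightarrow> F (cons (x 0 *v w) v) x"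
        proof (rule mixed_tendsto[OF F _ _ _ x])
          show "(\<lambda>n. cons (x' n 0 *v w) (v' n) i) \<longlonglongrightarrow> cons (x 0 *v w) v i" for i
            by (cases i) (auto intro!: tendsto_matrix_vector_mult x(3) v(3))
        qed (use elim in auto)
        then show ?case using elim by (simp add: tendsto_mult_left)
      qed
    qed (rule iw)
  qed
qed

text \<open>Averaging the cocycle relation over a random first vector.\<close>
lemma dV_contract:
  fixes F :: "(nat \<Rightarrow> real^'n) \<Rightarrow> (nat \<Rightarrow> real^'n^'n) \<Rightarrow> real"
  assumes F: "F \<in> mixed (Suc k) q"
    and z: "\<And>v x. v \<in> conf (Suc (Suc k)) \<Longrightarrow> x \<in> tuples q \<Longrightarrow> dV (Suc k) F v x = 0"
    and v: "v \<in> conf (Suc k)" and x: "x \<in> tuples q"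
  shows "dV k (contract k F) v x = F v x"
proof -
  have o: "omit i v \<in> conf k" if "i \<le> k" for i by (rule omit_conf[OF v that])
  have "dV k (contract k F) v x = (\<integral>w. (\<Sum>i\<le>k. (-1)^i * integrand k F (omit i v) x w) \<partial>lborel)"
    unfolding dV_def contract_def
    by (subst Bochner_Integration.integral_sum) (auto intro!: integrand_integrable[OF F o x])
  also have "\<dots> = (\<integral>w. wt (w::real^'n) * F v x \<partial>lborel)"
  proof (rule integral_cong_AE)
    have "AE w in lborel. \<forall>i\<in>{..k}. cons (x 0 *v w) (omit i v) \<in> conf (Suc k) \<and>
        integrand k F (omit i v) x w = wt w * F (cons (x 0 *v w) (omit i v)) x"
      by (intro AE_finite_allI integrand_AE[OF o x]) auto
    then show "AE w in lborel. (\<Sum>i\<le>k. (-1)^i * integrand k F (omit i v) x w) = wt w * F v x"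
      \<comment> \<open>This contributes the general position of the enlarged configuration; the
        zero function is a placeholder.\<close>
      using integrand_AE[OF v x, of "\<lambda>_ _. 0"]
    proof eventually_elim
      case (elim w)
      have "dV (Suc k) F (cons (x 0 *v w) v) x = 0" using elim z x by blast
      \<comment> \<open>Deleting the new vector returns \<open>F v x\<close>; every other face keeps
        it, and its index and sign shift by one.\<close>
      then have "F v x = (\<Sum>i\<le>k. (-1)^i * F (cons (x 0 *v w) (omit i v)) x)"
        unfolding dV_def sum.atMost_Suc_shift by (simp add: omit_0_cons omit_Suc_cons sum_negf)
      then show ?case using elim by (simp add: sum_distrib_left ac_simps)
    qed
    show "(\<lambda>w. \<Sum>i\<le>k. (-1)^i * integrand k F (omit i v) x w) \<in> borel_measurable lborel"
      by (intro borel_measurable_sum borel_measurable_times borel_measurable_const integrand_measurable[OF F o x]) auto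
  qed (simp add: borel_measurable_times[OF borel_measurable_wt])
  also have "\<dots> = F v x" by (simp add: integral_wt)
  finally show ?thesis .
qed

subsection \<open>Exactness of the columns\<close>

text \<open>An arbitrary numbering of the coordinates, fixed once; it lets a list of vectors be read
  as the columns of a matrix with a definite sign of the determinant.\<close>

definition enumb :: "nat \<Rightarrow> 'n::finite" where
  "enumb = (SOME b. bij_betw b {0..<CARD('n)} UNIV)"

definition idx :: "'n::finite \<Rightarrow> nat" where
  "idx = the_inv_into {0..<CARD('n)} enumb"

lemma bij_enumb: "bij_betw enumb {0..<CARD('n)} (UNIV :: 'n::finite set)"
  unfolding enumb_def by (rule someI_ex[OF ex_bij_betw_nat_finite]) simp

lemma idx_less: "idx (c :: 'n::finite) < CARD('n)"
  using the_inv_into_into[OF bij_betw_imp_inj_on[OF bij_enumb], of c "{0..<CARD('n)}"]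
    bij_betw_imp_surj_on[OF bij_enumb[where 'n = 'n]] by (auto simp: idx_def)

lemma enumb_idx [simp]: "enumb (idx c) = (c :: 'n::finite)"
  unfolding idx_def
  by (rule f_the_inv_into_f[OF bij_betw_imp_inj_on[OF bij_enumb]])
     (simp add: bij_betw_imp_surj_on[OF bij_enumb])

lemma idx_enumb [simp]: "i < CARD('n) \<Longrightarrow> idx (enumb i :: 'n::finite) = i"
  unfolding idx_def by (rule the_inv_into_f_f[OF bij_betw_imp_inj_on[OF bij_enumb]]) simp

lemma sum_enumb: "(\<Sum>c\<in>UNIV. f c) = (\<Sum>i<CARD('n). f (enumb i :: 'n::finite))"
  using sum.reindex_bij_betw[OF bij_enumb[where 'n = 'n], of f] by (simp add: atLeast0LessThan)

lemma prod_enumb: "(\<Prod>c\<in>UNIV. f c) = (\<Prod>i<CARD('n). f (enumb i :: 'n::finite))"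
  using prod.reindex_bij_betw[OF bij_enumb[where 'n = 'n], of f] by (simp add: atLeast0LessThan)

definition colmat :: "(nat \<Rightarrow> real^'n) \<Rightarrow> real^'n^'n" where
  "colmat v = (\<chi> r c. v (idx c) $ r)"

lemma colmat_axis: "i < CARD('n) \<Longrightarrow> colmat v *v axis (enumb i) 1 = (v i :: real^'n)"
  by (simp add: matrix_vector_mult_basis column_def colmat_def)

lemma colmat_mult_vec: "colmat v *v w = (\<Sum>i<CARD('n). w $ enumb i *\<^sub>R (v i :: real^'n))"
proof -
  have "colmat v *v w = (\<Sum>c\<in>UNIV. w $ c *\<^sub>R column c (colmat v))"
    by (simp add: matrix_mult_sum scalar_mult_eq_scaleR)
  also have "\<dots> = (\<Sum>i<CARD('n). w $ enumb i *\<^sub>R column (enumb i) (colmat v))"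
    by (rule sum_enumb)
  also have "\<dots> = (\<Sum>i<CARD('n). w $ enumb i *\<^sub>R v i)"
    by (intro sum.cong) (auto simp: column_def colmat_def vec_eq_iff)
  finally show ?thesis .
qed

lemma colmat_GLn:
  fixes v :: "nat \<Rightarrow> real^'n"
  assumes "v \<in> conf CARD('n)"
  shows "colmat v \<in> GLn"
proof -
  have "w = 0" if "colmat v *v w = 0" for w
  proof -
    have "(\<Sum>i<CARD('n). w $ enumb i *\<^sub>R v i) = 0" using that by (simp add: colmat_mult_vec)
    then have "w $ enumb i = 0" if "i < CARD('n)" for i
      using conf_indep[OF assms, of "{..<CARD('n)}" "\<lambda>i. w $ enumb i" i] that by simp
    then have "w $ c = 0" for c using idx_less[of c] by (metis enumb_idx)
    then show ?thesis by (simp add: vec_eq_iff)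
  qed
  then show ?thesis
    unfolding GLn_def invertible_left_inverse matrix_left_invertible_ker by blast
qed

lemma colmat_mult: "colmat (\<lambda>i. g *v v i) = g ** colmat (v :: nat \<Rightarrow> real^'n)"
  by (simp add: colmat_def matrix_matrix_mult_def matrix_vector_mult_def vec_eq_iff)

lemma colmat_cong: "(\<And>i. i < CARD('n) \<Longrightarrow> v i = w i) \<Longrightarrow> colmat v = colmat (w :: nat \<Rightarrow> real^'n)"
  by (simp add: colmat_def idx_less)

text \<open>Fewer than n vectors do not span, and any vector outside their span can be
  added.\<close>

lemma conf_extend_1:
  fixes v :: "nat \<Rightarrow> real^'n"
  assumes v: "v \<in> conf k" and k: "k < CARD('n)"
  shows "\<exists>w. v(k := w) \<in> conf (Suc k)"
proof -
  have "dim (span (v ` {..<k})) \<le> card (v ` {..<k})" unfolding dim_span by (rule dim_le_card') simp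
  also have "\<dots> \<le> k" using card_image_le[of "{..<k}" v] by simp
  also have "\<dots> < DIM(real^'n)" using k by simp
  finally have "span (v ` {..<k}) \<noteq> UNIV" by (metis dim_UNIV less_irrefl)
  then obtain w where w: "w \<notin> span (v ` {..<k})" by blast
  have "v(k := w) \<in> conf (Suc k)"
  proof (rule confI)
    fix I c j
    assume I: "I \<subseteq> {..<Suc k}" "card I \<le> CARD('n)" "(\<Sum>i\<in>I. c i *\<^sub>R (v(k := w)) i) = 0" and j: "j \<in> I"
    have finI: "finite I" using I(1) finite_subset by blast
    have sub: "I - {k} \<subseteq> {..<k}" using I(1) by auto
    have eq: "(\<Sum>i\<in>I - {k}. c i *\<^sub>R (v(k := w)) i) = (\<Sum>i\<in>I - {k}. c i *\<^sub>R v i)"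
      by (intro sum.cong) auto
    have ck: "c k = 0" if "k \<in> I"
    proof (rule ccontr)
      assume c: "c k \<noteq> 0"
      have "c k *\<^sub>R w + (\<Sum>i\<in>I - {k}. c i *\<^sub>R v i) = 0"
        using I(3) sum.remove[OF finI that, of "\<lambda>i. c i *\<^sub>R (v(k := w)) i"] eq by simp
      then have "c k *\<^sub>R w = - (\<Sum>i\<in>I - {k}. c i *\<^sub>R v i)" by (simp add: eq_neg_iff_add_eq_0)
      then have "(1 / c k) *\<^sub>R c k *\<^sub>R w = (1 / c k) *\<^sub>R (- (\<Sum>i\<in>I - {k}. c i *\<^sub>R v i))" by simp
      then have "w = (1 / c k) *\<^sub>R (- (\<Sum>i\<in>I - {k}. c i *\<^sub>R v i))" using c by simp
      moreover have "\<dots> \<in> span (v ` {..<k})"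
        by (intro span_scale span_neg span_sum) (use sub in \<open>auto intro: span_base\<close>)
      ultimately show False using w by simp
    qed
    have "(\<Sum>i\<in>I - {k}. c i *\<^sub>R v i) = 0"
    proof (cases "k \<in> I")
      case True
      then show ?thesis
        using I(3) sum.remove[OF finI True, of "\<lambda>i. c i *\<^sub>R (v(k := w)) i"] eq ck by simp
    next
      case False
      then show ?thesis using I(3) eq by simp
    qed
    moreover have "card (I - {k}) \<le> CARD('n)" using I(2) card_mono[OF finI, of "I - {k}"] by simp
    ultimately have "c i = 0" if "i \<in> I - {k}" for i
      using conf_indep[OF v sub, of c i] that by blast
    then show "c j = 0" using j ck by blast
  qed (use v in \<open>auto simp: conf_def\<close>)
  then show ?thesis by blast
qed

lemma conf_extend:
  fixes v :: "nat \<Rightarrow> real^'n"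
  assumes "v \<in> conf k" "k \<le> CARD('n)"
  shows "\<exists>v'\<in>conf CARD('n). \<forall>i<k. v' i = v i"
  using assms(2,1)
proof (induction arbitrary: v rule: inc_induct)
  case (step m)
  obtain w where "v(m := w) \<in> conf (Suc m)" using conf_extend_1[OF step.prems step.hyps(2)] by blast
  then obtain v' where "v' \<in> conf CARD('n)" "\<And>i. i < Suc m \<Longrightarrow> v' i = (v(m := w)) i"
    using step.IH by blast
  then show ?case by (intro bexI[of _ v']) auto
qed auto

definition std :: "nat \<Rightarrow> nat \<Rightarrow> real^'n" where
  "std k i = (if i < k then axis (enumb i) 1 else 0)"

lemma std_conf:
  assumes "k \<le> CARD('n)"
  shows "(std k :: nat \<Rightarrow> real^'n) \<in> conf k"
proof (rule confI)
  fix I c j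
  assume I: "I \<subseteq> {..<k}" "(\<Sum>i\<in>I. c i *\<^sub>R (std k i :: real^'n)) = 0" and j: "j \<in> I"
  have fin: "finite I" using I(1) finite_subset by blast
  have "(\<Sum>i\<in>I. c i *\<^sub>R (std k i :: real^'n)) $ enumb j = (\<Sum>i\<in>I. if i = j then c j else 0)"
    unfolding sum_component
  proof (rule sum.cong[OF refl])
    fix i assume i: "i \<in> I"
    then have "(enumb i :: 'n) = enumb j \<longleftrightarrow> i = j"
      using I(1) j assms by (metis idx_enumb lessThan_iff less_le_trans subsetD)
    then show "(c i *\<^sub>R (std k i :: real^'n)) $ enumb j = (if i = j then c j else 0)"
      using i I(1) by (auto simp: std_def axis_def)
  qed
  then show "c j = 0" using I(2) j fin by simp
qed (simp add: std_def)

text \<open>Transitivity on configurations of at most n vectors: complete \<open>v\<close> to a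
  basis and take it as columns.\<close>

lemma frame_exists:
  fixes v :: "nat \<Rightarrow> real^'n"
  assumes v: "v \<in> conf k" and k: "k \<le> CARD('n)"
  shows "\<exists>g\<in>GLn. (\<lambda>i. g *v std k i) = v"
proof -
  obtain v' where v': "v' \<in> conf CARD('n)" "\<And>i. i < k \<Longrightarrow> v' i = v i" using conf_extend[OF assms] by blast
  have "(\<lambda>i. colmat v' *v std k i) = v"
    using v' k conf_zero[OF v] by (auto simp: fun_eq_iff std_def colmat_axis)
  then show ?thesis using colmat_GLn[OF v'(1)] by blast
qed

text \<open>The reason why \<open>induce\<close> is well defined on projective configurations:
  frames over the same lines differ by an element of the stabilizer, whatever the scaling of their
  vectors.\<close>

lemma frames_line_stab:
  fixes g g' :: "real^'n^'n"
  assumes g: "g \<in> GLn" "g' \<in> GLn" and eq: "\<And>i. i < k \<Longrightarrow> g *v std k i = a i *\<^sub>R (g' *v std k i)"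
  shows "matrix_inv g' ** g \<in> line_stab (enumb ` {..<k})"
proof -
  have "(matrix_inv g' ** g) $ r $ c = 0" if c: "c \<in> enumb ` {..<k}" and rc: "r \<noteq> c" for r c
  proof -
    obtain i where i: "i < k" "c = enumb i" using c by blast
    have "(matrix_inv g' ** g) *v axis c 1 = matrix_inv g' *v (g *v std k i)"
      using i by (simp add: std_def matrix_vector_mul_assoc)
    also have "\<dots> = a i *\<^sub>R (matrix_inv g' *v (g' *v std k i))"
      unfolding eq[OF i(1)] by (rule linear_scale[OF matrix_vector_mul_linear])
    also have "\<dots> = a i *\<^sub>R axis c 1"
      using i by (simp add: matrix_vector_mul_assoc matrix_inv_left[OF g(2)] std_def)
    finally have "((matrix_inv g' ** g) *v axis c 1) $ r = (a i *\<^sub>R axis c 1) $ r" by simp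
    then show ?thesis using rc by (simp add: matrix_vector_mult_basis column_def) (simp add: axis_def)
  qed
  then show ?thesis using g by (simp add: line_stab_def GLn_mult GLn_inv)
qed

lemma left_mult_inv_right: "g \<in> GLn \<Longrightarrow> x \<in> tuples q \<Longrightarrow> left_mult q g (left_mult q (matrix_inv g) x) = x"
  by (simp add: left_mult_mult matrix_inv_right left_mult_one)

text \<open>Elements of the stabilizer only rescale the standard vectors, and \<open>F\<close>
  ignores rescaling.\<close>

lemma mixed_std_CH:
  fixes F :: "(nat \<Rightarrow> real^'n) \<Rightarrow> (nat \<Rightarrow> real^'n^'n) \<Rightarrow> real"
  assumes F: "F \<in> mixed k q" and k: "k \<le> CARD('n)"
  shows "F (std k) \<in> CH (line_stab (enumb ` {..<k})) q"
proof -
  note s = std_conf[OF k]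
  obtain C where C: "\<And>v x. v \<in> conf k \<Longrightarrow> x \<in> tuples q \<Longrightarrow> \<bar>F v x\<bar> \<le> C" using mixed_bound[OF F] by blast
  have "F (std k) \<in> CB q"
    by (rule CB_I[where C = C]) (auto intro!: C s mixed_tendsto[OF F])
  moreover have "F (std k) (left_mult q h x) = eps h * F (std k) x"
    if h: "h \<in> line_stab (enumb ` {..<k})" and x: "x \<in> tuples q" for h x
  proof -
    have hG: "h \<in> GLn" using h line_stab_GLn by blast
    \<comment> \<open>Set to 1 from \<open>k\<close> on, where the vectors are 0, because scale
      invariance asks for nonzero factors at all indices.\<close>
    define a where "a i = (if i < k then h $ enumb i $ enumb i else 1)" for i
    have eq: "(\<lambda>i. h *v std k i) = (\<lambda>i. a i *\<^sub>R (std k i :: real^'n))"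
    proof
      fix i
      show "h *v std k i = a i *\<^sub>R (std k i :: real^'n)"
        using h by (simp add: std_def a_def matrix_vector_mult_basis column_def vec_eq_iff line_stab_def)
          (simp add: axis_def)
    qed
    have "a i \<noteq> 0" for i
    proof
      assume z: "a i = 0"
      then have i: "i < k" by (auto simp: a_def split: if_splits)
      have "(\<lambda>i. a i *\<^sub>R (std k i :: real^'n)) \<in> conf k" using mult_conf[OF s hG] unfolding eq .
      from conf_indep[OF this, of "{i}" "\<lambda>_. 1" i] show False using i z by simp
    qed
    then have "F (\<lambda>i. a i *\<^sub>R std k i) (left_mult q h x) = F (std k) (left_mult q h x)"
      by (rule mixed_scale[OF F _ s left_mult_tuples[OF hG x]])
    then show ?thesis using mixed_equiv[OF F hG s x] unfolding eq by simp
  qed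
  ultimately show ?thesis by (simp add: CH_def)
qed

lemma CH_bound:
  assumes "f \<in> CH H q"
  obtains C where "\<And>x. x \<in> tuples q \<Longrightarrow> \<bar>f x\<bar> \<le> C"
  using assms CB_bound[of f q] by (auto simp: CH_def)

text \<open>The inverse of restriction to the standard configuration. The chosen frame need not vary
  continuously with \<open>v\<close>; by \<open>induce_eq\<close> any other frame gives the same
  value.\<close>

definition induce :: "nat \<Rightarrow> nat \<Rightarrow> ((nat \<Rightarrow> real^'n^'n) \<Rightarrow> real) \<Rightarrow> (nat \<Rightarrow> real^'n) \<Rightarrow> (nat \<Rightarrow> real^'n^'n) \<Rightarrow> real" where
  "induce k q f v x = (let g = (SOME g. g \<in> GLn \<and> (\<lambda>i. g *v std k i) = v)
     in eps g * f (left_mult q (matrix_inv g) x))"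

lemma induce_eq:
  fixes v :: "nat \<Rightarrow> real^'n"
  assumes f: "f \<in> CH (line_stab (enumb ` {..<k})) q" and k: "k \<le> CARD('n)"
    and v: "v \<in> conf k" and x: "x \<in> tuples q" and g: "g \<in> GLn" and gv: "\<And>i. i < k \<Longrightarrow> g *v std k i = a i *\<^sub>R v i"
  shows "induce k q f v x = eps g * f (left_mult q (matrix_inv g) x)"
proof -
  define g' where "g' = (SOME g. g \<in> GLn \<and> (\<lambda>i. g *v std k i) = v)"
  have "\<exists>g. g \<in> GLn \<and> (\<lambda>i. g *v std k i) = v" using frame_exists[OF v k] by blast
  from someI_ex[OF this] have g': "g' \<in> GLn" "(\<lambda>i. g' *v std k i) = v" unfolding g'_def by auto
  define h where "h = matrix_inv g' ** g"
  have h: "h \<in> line_stab (enumb ` {..<k})" unfolding h_def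
    by (rule frames_line_stab[OF g g'(1), where a = a]) (use gv g'(2) in \<open>auto dest: fun_cong\<close>)
  have hG: "h \<in> GLn" using h line_stab_GLn by blast
  have gh: "g = g' ** h" by (simp add: h_def matrix_inv_cancel[OF g'(1)])
  let ?y = "left_mult q (matrix_inv g) x"
  have "left_mult q h ?y = left_mult q (matrix_inv g') x"
    by (simp add: left_mult_mult h_def matrix_mul_assoc[symmetric] matrix_inv_right[OF g])
  moreover have "f (left_mult q h ?y) = eps h * f ?y"
    using f h left_mult_tuples[OF GLn_inv[OF g] x] by (simp add: CH_def)
  ultimately have "induce k q f v x = eps g' * (eps h * f ?y)"
    by (simp add: induce_def g'_def Let_def)
  then show ?thesis unfolding gh eps_mult by (simp add: gh)
qed

lemma induce_mixed:
  fixes f :: "(nat \<Rightarrow> real^'n^'n) \<Rightarrow> real"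
  assumes f: "f \<in> CH (line_stab (enumb ` {..<k})) q" and k: "k \<le> CARD('n)"
  shows "induce k q f \<in> mixed k q"
proof -
  obtain C where C: "\<And>x. x \<in> tuples q \<Longrightarrow> \<bar>f x\<bar> \<le> C" using CH_bound[OF f] by blast
  have fC: "f \<in> CB q" using f by (simp add: CH_def)
  note ind = induce_eq[OF f k]
  show ?thesis
  proof (rule mixedI[where C = C])
    fix v :: "nat \<Rightarrow> real^'n" and x :: "nat \<Rightarrow> real^'n^'n" assume v: "v \<in> conf k" and x: "x \<in> tuples q"
    obtain g where g: "g \<in> GLn" "(\<lambda>i. g *v std k i) = v" using frame_exists[OF v k] by blast
    have gi: "g *v std k i = v i" for i using g(2) by (rule fun_cong)
    have e1: "induce k q f v x = eps g * f (left_mult q (matrix_inv g) x)"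
      by (rule ind[OF v x g(1), where a = "\<lambda>_. 1"]) (simp add: gi)
    show "\<bar>induce k q f v x\<bar> \<le> C"
      unfolding e1 abs_mult abs_eps[OF g(1)] using C[OF left_mult_tuples[OF GLn_inv[OF g(1)] x]] by simp
    show "induce k q f (\<lambda>i. h *v v i) (left_mult q h x) = eps h * induce k q f v x" if h: "h \<in> GLn" for h
    proof -
      have "induce k q f (\<lambda>i. h *v v i) (left_mult q h x) =
          eps (h ** g) * f (left_mult q (matrix_inv (h ** g)) (left_mult q h x))"
        by (rule ind[OF mult_conf[OF v h] left_mult_tuples[OF h x] GLn_mult[OF h g(1)], where a = "\<lambda>_. 1"])
           (simp add: gi[symmetric] matrix_vector_mul_assoc)
      also have "left_mult q (matrix_inv (h ** g)) (left_mult q h x) = left_mult q (matrix_inv g) x"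
        by (simp add: left_mult_mult matrix_inv_mult[OF h g(1)] matrix_inv_cancel[OF h])
      finally show ?thesis by (simp add: e1 eps_mult)
    qed
    show "induce k q f (\<lambda>i. a i *\<^sub>R v i) x = induce k q f v x" if a: "\<And>i. a i \<noteq> 0" for a
      unfolding e1
      by (rule ind[OF scale_conf[OF v a] x g(1), where a = "\<lambda>i. 1 / a i"]) (simp add: gi a)
  next
    fix v' :: "nat \<Rightarrow> nat \<Rightarrow> real^'n" and v and x' :: "nat \<Rightarrow> nat \<Rightarrow> real^'n^'n" and x
    assume v: "\<And>n. v' n \<in> conf k" "v \<in> conf k" "\<And>i. (\<lambda>n. v' n i) \<longlonglongrightarrow> v i"
      and x: "\<And>n. x' n \<in> tuples q" "x \<in> tuples q" "\<And>i. (\<lambda>n. x' n i) \<longlonglongrightarrow> x i"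
    obtain g where g: "g \<in> GLn" "(\<lambda>i. g *v std k i) = v" using frame_exists[OF v(2) k] by blast
    have gi: "g *v std k i = v i" for i using g(2) by (rule fun_cong)
    \<comment> \<open>A continuous choice of frame near \<open>v\<close>: the first \<open>k\<close>
      columns follow the configuration, the others are kept from \<open>g\<close>.\<close>
    define L where "L u = colmat (\<lambda>i. if i < k then u i else g *v axis (enumb i) 1)" for u
    have Lv: "L v = g"
    proof -
      have "L v = colmat (\<lambda>i. g *v axis (enumb i) 1)" unfolding L_def
        by (intro colmat_cong) (auto simp: gi[symmetric] std_def)
      also have "\<dots> = g" by (simp add: colmat_def vec_eq_iff matrix_vector_mult_basis column_def)
      finally show ?thesis .
    qed
    have "(\<lambda>n. L (v' n)) \<longlonglongrightarrow> L v"
      unfolding tendsto_matrix_iff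
    proof (intro allI)
      fix i j
      show "(\<lambda>n. L (v' n) $ i $ j) \<longlonglongrightarrow> L v $ i $ j"
        by (cases "idx j < k") (auto simp: L_def colmat_def intro!: tendsto_vec_nth v(3))
    qed
    then have Llim: "(\<lambda>n. L (v' n)) \<longlonglongrightarrow> g" by (simp add: Lv)
    \<comment> \<open>Finitely many of these frames may be singular; putting \<open>g\<close> in
      their place makes every term meaningful and leaves the limit unchanged.\<close>
    define M where "M n = (if L (v' n) \<in> GLn then L (v' n) else g)" for n
    have ev: "eventually (\<lambda>n. L (v' n) \<in> GLn) sequentially" by (rule eventually_GLn[OF Llim g(1)])
    have MG: "M n \<in> GLn" for n using g(1) by (simp add: M_def)
    have Mlim: "M \<longlonglongrightarrow> g"
      by (rule Lim_transform_eventually[OF Llim]) (use ev in eventually_elim, simp add: M_def)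
    have "(\<lambda>n. eps (M n) * f (left_mult q (matrix_inv (M n)) (x' n))) \<longlonglongrightarrow> eps g * f (left_mult q (matrix_inv g) x)"
    proof (intro tendsto_mult tendsto_eps[OF Mlim g(1)] CB_tendsto[OF fC])
      show "left_mult q (matrix_inv (M n)) (x' n) \<in> tuples q" for n by (intro left_mult_tuples GLn_inv MG x)
      show "left_mult q (matrix_inv g) x \<in> tuples q" by (intro left_mult_tuples GLn_inv g x)
      show "(\<lambda>n. left_mult q (matrix_inv (M n)) (x' n) i) \<longlonglongrightarrow> left_mult q (matrix_inv g) x i" for i
        by (cases "i \<le> q") (auto simp: left_mult_def intro!: tendsto_matrix_mult tendsto_matrix_inv Mlim g(1) x(3))
    qed
    moreover have "induce k q f v x = eps g * f (left_mult q (matrix_inv g) x)"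
      by (rule ind[OF v(2) x(2) g(1), where a = "\<lambda>_. 1"]) (simp add: gi)
    moreover have "eventually (\<lambda>n. eps (M n) * f (left_mult q (matrix_inv (M n)) (x' n)) = induce k q f (v' n) (x' n)) sequentially"
      using ev
    proof eventually_elim
      case (elim n)
      have "induce k q f (v' n) (x' n) = eps (L (v' n)) * f (left_mult q (matrix_inv (L (v' n))) (x' n))"
        by (rule ind[OF v(1) x(1) elim, where a = "\<lambda>_. 1"]) (use k in \<open>simp add: std_def L_def colmat_axis\<close>)
      then show ?case using elim by (simp add: M_def)
    qed
    ultimately show "(\<lambda>n. induce k q f (v' n) (x' n)) \<longlonglongrightarrow> induce k q f v x"
      using Lim_transform_eventually by fastforce
  qed
qed

lemma mixed_from_std:
  fixes F :: "(nat \<Rightarrow> real^'n) \<Rightarrow> (nat \<Rightarrow> real^'n^'n) \<Rightarrow> real"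
  assumes F: "F \<in> mixed k q" and g: "g \<in> GLn" and k: "k \<le> CARD('n)" and x: "x \<in> tuples q"
  shows "F (\<lambda>i. g *v std k i) x = eps g * F (std k) (left_mult q (matrix_inv g) x)"
  using mixed_equiv[OF F g std_conf[OF k] left_mult_tuples[OF GLn_inv[OF g] x]]
  by (simp add: left_mult_inv_right[OF g x])

text \<open>Restriction to the standard configuration and \<open>induce\<close> translate the column
  into cochains equivariant under the stabilizer. The bound \<open>1 \<le> k\<close> supplies the
  index of a reflection.\<close>

lemma column_exact:
  fixes F :: "(nat \<Rightarrow> real^'n) \<Rightarrow> (nat \<Rightarrow> real^'n^'n) \<Rightarrow> real"
  assumes F: "F \<in> mixed k (Suc q)" and k: "1 \<le> k" "k \<le> CARD('n)"
    and z: "\<And>v x. v \<in> conf k \<Longrightarrow> x \<in> tuples (Suc (Suc q)) \<Longrightarrow> dG (Suc q) F v x = 0"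
  shows "\<exists>G\<in>mixed k q. \<forall>v\<in>conf k. \<forall>x\<in>tuples (Suc q). F v x = dG q G v x"
proof -
  let ?J = "enumb ` {..<k} :: 'n set"
  have J: "enumb 0 \<in> ?J" using k by auto
  obtain f where f: "f \<in> CH (line_stab ?J) q" "\<And>x. x \<in> tuples (Suc q) \<Longrightarrow> F (std k) x = cobd q f x"
    using line_stab_column_exact[OF J mixed_std_CH[OF F k(2)]] z[OF std_conf[OF k(2)]] unfolding dG_def by blast
  have "F v x = dG q (induce k q f) v x" if v: "v \<in> conf k" and x: "x \<in> tuples (Suc q)" for v x
  proof -
    obtain g where g: "g \<in> GLn" "(\<lambda>i. g *v std k i) = v" using frame_exists[OF v k(2)] by blast
    have gi: "g *v std k i = v i" for i using g(2) by (rule fun_cong)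
    let ?y = "left_mult (Suc q) (matrix_inv g) x"
    have "F v x = eps g * cobd q f ?y"
      using mixed_from_std[OF F g(1) k(2) x] f(2)[OF left_mult_tuples[OF GLn_inv[OF g(1)] x]] by (simp add: gi)
    also have "\<dots> = dG q (induce k q f) v x"
      unfolding dG_def cobd_def sum_distrib_left
    proof (intro sum.cong refl)
      fix i assume "i \<in> {..Suc q}"
      then have i: "i \<le> Suc q" by simp
      have "induce k q f v (omit i x) = eps g * f (left_mult q (matrix_inv g) (omit i x))"
        by (rule induce_eq[OF f(1) k(2) v omit_tuples[OF x i] g(1), where a = "\<lambda>_. 1"]) (simp add: gi)
      then show "eps g * ((-1)^i * f (omit i ?y)) = (-1)^i * induce k q f v (omit i x)"
        by (simp add: omit_left_mult[OF i])
    qed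
    finally show ?thesis .
  qed
  then show ?thesis using induce_mixed[OF f(1) k(2)] by blast
qed

lemma column_exact_0:
  fixes F :: "(nat \<Rightarrow> real^'n) \<Rightarrow> (nat \<Rightarrow> real^'n^'n) \<Rightarrow> real"
  assumes F: "F \<in> mixed k 0" and k: "k \<le> CARD('n)"
    and z: "\<And>v x. v \<in> conf k \<Longrightarrow> x \<in> tuples 1 \<Longrightarrow> dG 0 F v x = 0"
    and v: "v \<in> conf k" and x: "x \<in> tuples 0"
  shows "F v x = 0"
proof -
  obtain g where g: "g \<in> GLn" "(\<lambda>i. g *v std k i) = v" using frame_exists[OF v k] by blast
  have "F (std k) (left_mult 0 (matrix_inv g) x) = 0"
    by (rule line_stab_column_exact_0[OF mixed_std_CH[OF F k]])
       (use z[OF std_conf[OF k]] in \<open>auto simp: dG_def intro!: left_mult_tuples GLn_inv g x\<close>)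
  then show ?thesis using mixed_from_std[OF F g(1) k x] g(2) by simp
qed

subsection \<open>The Euler cocycle\<close>

lemma omit_image_remove: "i \<le> k \<Longrightarrow> (\<lambda>m. if m < i then m else Suc m) ` {..<k} = {..k} - {i}"
proof (intro equalityI subsetI)
  fix j assume "i \<le> k" "j \<in> {..k} - {i}"
  then show "j \<in> (\<lambda>m. if m < i then m else Suc m) ` {..<k}"
    by (intro image_eqI[of _ _ "if j < i then j else j - 1"]) auto
qed auto

lemma prod_omit:
  fixes f :: "'a \<Rightarrow> 'b::comm_monoid_mult"
  assumes "i \<le> k"
  shows "(\<Prod>m<k. f (omit i a m)) = (\<Prod>j\<in>{..k} - {i}. f (a j))"
proof -
  have inj: "inj_on (\<lambda>m. if m < i then m else Suc m) {..<k}" by (auto simp: inj_on_def split: if_splits)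
  show ?thesis
    unfolding omit_image_remove[OF assms, symmetric] prod.reindex[OF inj]
    by (intro prod.cong) (auto simp: omit_def)
qed

lemma sum_omit:
  fixes f :: "'c \<Rightarrow> 'a \<Rightarrow> 'b::comm_monoid_add"
  assumes "i \<le> k"
  shows "(\<Sum>m<k. f (omit i a m) (omit i b m)) = (\<Sum>j\<in>{..k} - {i}. f (a j) (b j))"
proof -
  have inj: "inj_on (\<lambda>m. if m < i then m else Suc m) {..<k}" by (auto simp: inj_on_def split: if_splits)
  show ?thesis
    unfolding omit_image_remove[OF assms, symmetric] sum.reindex[OF inj]
    by (intro sum.cong) (auto simp: omit_def)
qed

definition eul :: "(nat \<Rightarrow> real^'n) \<Rightarrow> real" where
  "eul v = (\<Prod>i\<le>CARD('n). eps (colmat (omit i v)))"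

lemma sgn_prod_real: "sgn (\<Prod>i\<in>I. f i) = (\<Prod>i\<in>I. sgn (f i :: real))"
  by (induction I rule: infinite_finite_induct) (auto simp: sgn_mult)

lemma eps_colmat_scale:
  fixes v :: "nat \<Rightarrow> real^'n"
  shows "eps (colmat (\<lambda>i. a i *\<^sub>R v i)) = (\<Prod>i<CARD('n). sgn (a i)) * eps (colmat v)"
proof -
  let ?D = "(\<chi> r c. if r = c then a (idx c) else 0) :: real^'n^'n"
  have "(colmat v ** ?D) $ r $ c = v (idx c) $ r * a (idx c)" for r c
  proof -
    have "(colmat v ** ?D) $ r $ c = (\<Sum>k\<in>UNIV. if k = c then v (idx c) $ r * a (idx c) else 0)"
      unfolding matrix_matrix_mult_def colmat_def vec_lambda_beta by (intro sum.cong) auto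
    then show ?thesis by simp
  qed
  then have "colmat (\<lambda>i. a i *\<^sub>R v i) = colmat v ** ?D"
    by (simp add: vec_eq_iff) (simp add: colmat_def)
  moreover have "det ?D = (\<Prod>c\<in>UNIV. a (idx (c::'n)))" by (subst det_diagonal) auto
  moreover have "(\<Prod>c\<in>UNIV. a (idx (c::'n))) = (\<Prod>i<CARD('n). a i)"
    unfolding prod_enumb by (intro prod.cong) auto
  ultimately show ?thesis by (simp add: eps_def det_mul sgn_mult sgn_prod_real mult.commute)
qed

lemma sgn_power_even: "even m \<Longrightarrow> (a::real) \<noteq> 0 \<Longrightarrow> sgn a ^ m = 1"
  by (auto simp: sgn_real_def)

text \<open>The sign of \<open>g\<close> enters once for each of the n + 1 minors, an odd number,
  which leaves \<open>eps g\<close>. Each vector occurs in n minors, an even number, so its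
  rescaling is invisible.\<close>

lemma eul_mixed:
  assumes n: "even CARD('n)"
  shows "(\<lambda>(v :: nat \<Rightarrow> real^'n) x. eul v) \<in> mixed (Suc CARD('n)) q"
proof -
  have oG: "colmat (omit i v) \<in> GLn" if "v \<in> conf (Suc CARD('n))" "i \<le> CARD('n)" for v :: "nat \<Rightarrow> real^'n" and i
    by (rule colmat_GLn[OF omit_conf[OF that]])
  show ?thesis
  proof (rule mixedI[where C = 1])
    show "\<bar>eul v\<bar> \<le> 1" if "v \<in> conf (Suc CARD('n))" for v :: "nat \<Rightarrow> real^'n"
      using that by (simp add: eul_def abs_prod abs_eps oG)
    show "eul (\<lambda>i. g *v v i) = eps g * eul v" if g: "g \<in> GLn" for v :: "nat \<Rightarrow> real^'n" and g
    proof -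
      have "omit i (\<lambda>i. g *v v i) = (\<lambda>j. g *v omit i v j)" for i by (auto simp: omit_def fun_eq_iff)
      then have "eul (\<lambda>i. g *v v i) = eps g ^ Suc CARD('n) * eul v"
        by (simp add: eul_def colmat_mult eps_mult prod.distrib)
      also have "eps g ^ Suc CARD('n) = eps g"
        using sgn_power_even[OF n, of "det g"] g by (simp add: eps_def GLn_iff_det)
      finally show ?thesis .
    qed
    show "eul (\<lambda>i. a i *\<^sub>R v i) = eul v" if a: "\<And>i. a i \<noteq> 0" for v :: "nat \<Rightarrow> real^'n" and a
    proof -
      define P where "P = (\<Prod>j\<le>CARD('n). sgn (a j))"
      have PP: "P * P = 1" unfolding P_def prod.distrib[symmetric]
        by (intro prod.neutral) (use a in \<open>auto simp: sgn_real_def\<close>)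
      have "(\<Prod>m<CARD('n). sgn (omit i a m)) = P * sgn (a i)" if i: "i \<le> CARD('n)" for i
      proof -
        have "P = sgn (a i) * (\<Prod>j\<in>{..CARD('n)} - {i}. sgn (a j))"
          unfolding P_def by (rule prod.remove) (use i in auto)
        then show ?thesis unfolding prod_omit[OF i] using a[of i] by (auto simp: sgn_real_def)
      qed
      moreover have "omit i (\<lambda>i. a i *\<^sub>R v i) = (\<lambda>j. omit i a j *\<^sub>R omit i v j)" for i by (auto simp: omit_def fun_eq_iff)
      ultimately have "eul (\<lambda>i. a i *\<^sub>R v i) = (\<Prod>i\<le>CARD('n). P * sgn (a i) * eps (colmat (omit i v)))"
        unfolding eul_def by (intro prod.cong) (auto simp: eps_colmat_scale)
      also have "\<dots> = P ^ Suc CARD('n) * P * eul v"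
        by (simp add: prod.distrib eul_def P_def[symmetric])
      also have "P ^ Suc CARD('n) * P = (P * P) ^ (CARD('n) div 2 + 1)"
        using n by (auto elim!: evenE simp: power_mult_distrib power_add[symmetric] power2_eq_square power_mult)
      finally show ?thesis by (simp add: PP)
    qed
    show "(\<lambda>n. eul (v' n)) \<longlonglongrightarrow> eul v"
      if "v \<in> conf (Suc CARD('n))" "\<And>i. (\<lambda>n. v' n i) \<longlonglongrightarrow> v i"
      for v' :: "nat \<Rightarrow> nat \<Rightarrow> real^'n" and v
      unfolding eul_def
    proof (intro tendsto_prod tendsto_eps)
      fix i assume i: "i \<in> {..CARD('n)}"
      then show "colmat (omit i v) \<in> GLn" using oG[OF that(1)] by simp
      show "(\<lambda>n. colmat (omit i (v' n))) \<longlonglongrightarrow> colmat (omit i v)"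
        unfolding tendsto_matrix_iff colmat_def by (auto simp: omit_def intro!: tendsto_vec_nth that(2))
    qed
  qed
qed

lemma eul_nonzero: "v \<in> conf (Suc CARD('n)) \<Longrightarrow> eul (v :: nat \<Rightarrow> real^'n) * eul v = 1"
  unfolding eul_def prod.distrib[symmetric] by (simp add: eps_square colmat_GLn omit_conf)

text \<open>The last vector is expanded in the basis of the others. A zero coefficient would leave a
  relation among at most n vectors.\<close>

lemma relation_exists:
  fixes v :: "nat \<Rightarrow> real^'n"
  assumes v: "v \<in> conf (Suc CARD('n))"
  shows "\<exists>c. (\<Sum>i\<le>CARD('n). c i *\<^sub>R v i) = 0 \<and> (\<forall>i\<le>CARD('n). c i \<noteq> 0)"
proof -
  let ?n = "CARD('n)"
  let ?g = "colmat (omit ?n v)"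
  have g: "?g \<in> GLn" by (rule colmat_GLn[OF omit_conf[OF v]]) simp
  define y where "y = matrix_inv ?g *v v ?n"
  have "?g *v y = v ?n" by (simp add: y_def matrix_vector_mul_assoc matrix_inv_right[OF g])
  then have y: "(\<Sum>i<?n. y $ enumb i *\<^sub>R v i) = v ?n"
    by (simp add: colmat_mult_vec omit_def)
  define c where "c i = (if i < ?n then y $ enumb i else -1)" for i
  have "(\<Sum>i\<le>?n. c i *\<^sub>R v i) = (\<Sum>i<?n. c i *\<^sub>R v i) + c ?n *\<^sub>R v ?n"
    by (simp add: lessThan_Suc_atMost[symmetric])
  also have "(\<Sum>i<?n. c i *\<^sub>R v i) = v ?n" unfolding y[symmetric] by (intro sum.cong) (auto simp: c_def)
  finally have rel: "(\<Sum>i\<le>?n. c i *\<^sub>R v i) = 0" by (simp add: c_def)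
  have "c j \<noteq> 0" if j: "j \<le> ?n" for j
  proof
    assume z: "c j = 0"
    then have "j \<noteq> ?n" by (auto simp: c_def)
    have "(\<Sum>i\<in>{..?n} - {j}. c i *\<^sub>R v i) = 0"
      using rel sum.remove[of "{..?n}" j "\<lambda>i. c i *\<^sub>R v i"] j z by simp
    then have "c ?n = 0"
      by (rule conf_indep[OF v, rotated 2]) (use j \<open>j \<noteq> ?n\<close> in auto)
    then show False by (simp add: c_def)
  qed
  then show ?thesis using rel by blast
qed

text \<open>The matrices of two consecutive faces differ in one column only.\<close>
lemma adjacent_cramer:
  fixes w :: "nat \<Rightarrow> real^'n"
  assumes rel: "(\<Sum>m\<le>CARD('n). c m *\<^sub>R w m) = 0" and i: "i < CARD('n)"
  shows "c i * det (colmat (omit (Suc i) w)) = - c (Suc i) * det (colmat (omit i w))"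
proof -
  let ?c0 = "enumb i :: 'n"
  define R where "R a = omit i w (idx a)" for a :: 'n
  \<comment> \<open>The determinant as a linear function of the i-th column, read as a row. Applied
    to the relation it kills every vector that already occurs elsewhere, and only the terms
    \<open>i\<close> and \<open>Suc i\<close> survive.\<close>
  define L where "L x = det ((\<chi> a. if a = ?c0 then x else R a) :: real^'n^'n)" for x
  have tr: "det (colmat u) = det ((\<chi> a. u (idx a)) :: real^'n^'n)" for u :: "nat \<Rightarrow> real^'n"
    using det_transpose[of "colmat u"] by (simp add: transpose_def colmat_def)
  have L1: "L (w i) = det (colmat (omit (Suc i) w))"
  proof -
    have "(if a = ?c0 then w i else R a) = omit (Suc i) w (idx a)" for a :: 'n
    proof (cases "a = ?c0")
      case False
      then have "idx a \<noteq> i" by auto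
      then show ?thesis using False by (simp add: R_def omit_def less_Suc_eq)
    qed (use i in \<open>simp add: omit_def\<close>)
    then show ?thesis by (simp add: L_def tr)
  qed
  have L2: "L (w (Suc i)) = det (colmat (omit i w))"
  proof -
    have "(if a = ?c0 then w (Suc i) else R a) = omit i w (idx a)" for a :: 'n
      using i by (auto simp: R_def omit_def)
    then show ?thesis by (simp add: L_def tr)
  qed
  have L0: "L (w m) = 0" if m: "m \<le> CARD('n)" "m \<noteq> i" "m \<noteq> Suc i" for m
  proof -
    define t where "t = (if m < i then m else m - 1)"
    have t: "t < CARD('n)" "t \<noteq> i" "omit i w t = w m"
      using m i by (auto simp: t_def omit_def split: if_splits)
    have ne: "enumb t \<noteq> ?c0" using t i by (metis idx_enumb)
    show ?thesis unfolding L_def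
      by (rule det_identical_rows[of "enumb t" ?c0]) (use ne t in \<open>auto simp: row_def R_def vec_eq_iff\<close>)
  qed
  have "linear L"
  proof (rule linearI)
    show "L (x + y) = L x + L y" for x y
      unfolding L_def by (rule det_row_add[of ?c0 "\<lambda>_. x" "\<lambda>_. y" R])
    show "L (r *\<^sub>R x) = r *\<^sub>R L x" for r x
    proof -
      have "r *\<^sub>R x = r *s x" by (simp add: scalar_mult_eq_scaleR)
      moreover have "L (r *s x) = r * L x" unfolding L_def by (rule det_row_mul[of ?c0 r "\<lambda>_. x" R])
      ultimately show ?thesis by simp
    qed
  qed
  then have "L (\<Sum>m\<le>CARD('n). c m *\<^sub>R w m) = (\<Sum>m\<le>CARD('n). c m * L (w m))"
    by (simp add: linear_sum linear_scale)
  also have "\<dots> = (\<Sum>m\<in>{i, Suc i}. c m * L (w m))"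
    by (rule sum.mono_neutral_right) (use i L0 in auto)
  finally have "L 0 = c i * L (w i) + c (Suc i) * L (w (Suc i))" using rel by simp
  moreover have "L 0 = 0" unfolding L_def by (rule det_zero_row[of ?c0]) (simp add: row_def vec_eq_iff)
  ultimately show ?thesis using L1 L2 by simp
qed

text \<open>Remove the largest value: its own product is 1, and to every other product it
  contributes one factor -1. So the sum for \<open>m + 1\<close> points is 1 minus the sum for
  \<open>m\<close> points.\<close>

lemma sum_prod_sgn_differences:
  fixes t :: "nat \<Rightarrow> real"
  assumes "finite I" "inj_on t I"
  shows "(\<Sum>j\<in>I. \<Prod>i\<in>I - {j}. sgn (t j - t i)) = (if even (card I) then 0 else 1)"
  using assms
proof (induction "card I" arbitrary: I)
  case (Suc m)
  then have ne: "I \<noteq> {}" by auto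
  obtain l where l: "l \<in> I" "\<And>i. i \<in> I \<Longrightarrow> t i \<le> t l"
  proof -
    have "Max (t ` I) \<in> t ` I" using Suc.prems(1) ne by (intro Max_in) auto
    then obtain l where "l \<in> I" "Max (t ` I) = t l" by auto
    moreover have "t i \<le> Max (t ` I)" if "i \<in> I" for i using Suc.prems(1) that by (intro Max_ge) auto
    ultimately show thesis using that by auto
  qed
  have lt: "t i < t l" if "i \<in> I - {l}" for i
    using l(2)[of i] that Suc.prems(2) l(1) by (metis DiffE inj_onD insertI1 less_eq_real_def)
  let ?I = "I - {l}"
  have c: "card ?I = m" using Suc l(1) by simp
  have "(\<Sum>j\<in>I. \<Prod>i\<in>I - {j}. sgn (t j - t i)) =
      (\<Prod>i\<in>?I. sgn (t l - t i)) + (\<Sum>j\<in>?I. \<Prod>i\<in>I - {j}. sgn (t j - t i))"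
    using Suc.prems(1) l(1) by (rule sum.remove)
  also have "(\<Prod>i\<in>?I. sgn (t l - t i)) = 1" using lt by (intro prod.neutral) auto
  also have "(\<Sum>j\<in>?I. \<Prod>i\<in>I - {j}. sgn (t j - t i)) = (\<Sum>j\<in>?I. - (\<Prod>i\<in>?I - {j}. sgn (t j - t i)))"
  proof (rule sum.cong[OF refl])
    fix j assume j: "j \<in> ?I"
    have "(\<Prod>i\<in>I - {j}. sgn (t j - t i)) = sgn (t j - t l) * (\<Prod>i\<in>I - {j} - {l}. sgn (t j - t i))"
      by (rule prod.remove) (use Suc.prems(1) l(1) j in auto)
    also have "I - {j} - {l} = ?I - {j}" by auto
    also have "sgn (t j - t l) = -1" using lt[OF j] by simp
    finally show "(\<Prod>i\<in>I - {j}. sgn (t j - t i)) = - (\<Prod>i\<in>?I - {j}. sgn (t j - t i))" by simp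
  qed
  also have "\<dots> = - (if even (card ?I) then 0 else 1)"
    unfolding sum_negf
    using Suc.hyps(1)[of ?I] c Suc.prems by (simp add: inj_on_diff)
  finally show ?case using c Suc.hyps(2)[symmetric] by (simp split: if_splits)
qed auto


text \<open>Gale duality: the pairs \<open>(\<alpha> i, \<beta> i)\<close> of coefficients of two independent linear relations
  turn the determinants of the n + 2 vectors into those of n + 2 vectors in the plane.\<close>
lemma eul_cocycle:
  fixes v :: "nat \<Rightarrow> real^'n"
  assumes n: "even CARD('n)" and v: "v \<in> conf (Suc (Suc CARD('n)))"
  shows "(\<Sum>j\<le>Suc CARD('n). (-1)^j * eul (omit j v)) = 0"
proof -
  let ?n = "CARD('n)"
  let ?N = "Suc ?n"
  have oc: "omit j v \<in> conf ?N" if "j \<le> ?N" for j by (rule omit_conf[OF v that])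
  obtain a where a: "(\<Sum>i\<le>?n. a i *\<^sub>R omit ?N v i) = 0" "\<And>i. i \<le> ?n \<Longrightarrow> a i \<noteq> 0"
    using relation_exists[OF oc[of ?N]] by auto
  obtain b where b: "(\<Sum>i\<le>?n. b i *\<^sub>R omit 0 v i) = 0" "\<And>i. i \<le> ?n \<Longrightarrow> b i \<noteq> 0"
    using relation_exists[OF oc[of 0]] by auto
  \<comment> \<open>One relation avoids the last vector and the other the first; this makes them
    independent and provides the zeros used below.\<close>
  define \<alpha> where "\<alpha> i = (if i \<le> ?n then a i else 0)" for i
  define \<beta> where "\<beta> i = (case i of 0 \<Rightarrow> 0 | Suc j \<Rightarrow> b j)" for i
  have \<alpha>0: "\<alpha> 0 \<noteq> 0" "\<alpha> ?N = 0" "\<And>i. i \<le> ?n \<Longrightarrow> \<alpha> i \<noteq> 0" using a(2) by (auto simp: \<alpha>_def)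
  have \<beta>0: "\<beta> 0 = 0" "\<And>i. 0 < i \<Longrightarrow> i \<le> ?N \<Longrightarrow> \<beta> i \<noteq> 0" using b(2) by (auto simp: \<beta>_def split: nat.split)
  have ra: "(\<Sum>i\<le>?N. \<alpha> i *\<^sub>R v i) = 0"
  proof -
    have "(\<Sum>i\<le>?N. \<alpha> i *\<^sub>R v i) = (\<Sum>i\<le>?n. \<alpha> i *\<^sub>R v i)" by (simp add: \<alpha>0(2))
    also have "\<dots> = (\<Sum>i\<le>?n. a i *\<^sub>R omit ?N v i)" by (intro sum.cong) (auto simp: \<alpha>_def omit_def)
    finally show ?thesis using a(1) by simp
  qed
  have rb: "(\<Sum>i\<le>?N. \<beta> i *\<^sub>R v i) = 0"
    using b(1) unfolding sum.atMost_Suc_shift by (simp add: \<beta>_def omit_def)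
  \<comment> \<open>The 2 by 2 minors of the coefficient pairs. For fixed \<open>j\<close> they are
    the coefficients of a relation from which the j-th vector is absent.\<close>
  define br where "br i j = \<alpha> i * \<beta> j - \<alpha> j * \<beta> i" for i j
  have rel: "(\<Sum>i\<le>?N. br i j *\<^sub>R v i) = 0" for j
  proof -
    have "(\<Sum>i\<le>?N. br i j *\<^sub>R v i) = \<beta> j *\<^sub>R (\<Sum>i\<le>?N. \<alpha> i *\<^sub>R v i) - \<alpha> j *\<^sub>R (\<Sum>i\<le>?N. \<beta> i *\<^sub>R v i)"
      unfolding scaleR_sum_right sum_subtractf[symmetric]
      by (intro sum.cong) (auto simp: br_def algebra_simps)
    then show ?thesis using ra rb by simp
  qed
  have brjj: "br j j = 0" for j by (simp add: br_def)
  \<comment> \<open>A zero minor would leave a relation among n vectors, hence a trivial one. Its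
    first and last coefficients would then show that both coefficients of \<open>v j\<close>
    vanish.\<close>
  have br0: "br i j \<noteq> 0" if ij: "i \<le> ?N" "j \<le> ?N" "i \<noteq> j" for i j
  proof
    assume z: "br i j = 0"
    let ?I = "{..?N} - {i} - {j}"
    have "(\<Sum>m\<in>?I. br m j *\<^sub>R v m) = 0"
      using rel[of j] sum.remove[of "{..?N}" i "\<lambda>m. br m j *\<^sub>R v m"]
        sum.remove[of "{..?N} - {i}" j "\<lambda>m. br m j *\<^sub>R v m"] ij z brjj by simp
    moreover have "?I \<subseteq> {..<Suc ?N}" "card ?I \<le> ?n" using ij by auto
    ultimately have "br m j = 0" if "m \<in> ?I" for m
      using conf_indep[OF v, of ?I "\<lambda>m. br m j" m] that by blast
    then have all: "br m j = 0" if "m \<le> ?N" for m using that z brjj by (cases "m = i"; cases "m = j") auto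
    have "\<beta> j = 0" using all[of 0] \<alpha>0(1) \<beta>0(1) by (simp add: br_def)
    moreover have "\<alpha> j = 0" using all[of ?N] \<alpha>0(2) \<beta>0(2)[of ?N] by (simp add: br_def)
    ultimately show False using \<alpha>0(3)[of j] \<beta>0(2)[of j] ij(2) by (cases "j \<le> ?n") auto
  qed
  define D where "D j k = det (colmat (omit k (omit j v)))" for j k
  have D0: "D j k \<noteq> 0" if "j \<le> ?N" "k \<le> ?n" for j k
    using colmat_GLn[OF omit_conf[OF oc[OF that(1)] that(2)]] by (simp add: D_def GLn_iff_det)
  define c where "c j = omit j (\<lambda>i. br i j)" for j
  \<comment> \<open>By Cramer's rule for neighbouring faces the relation of \<open>omit j v\<close>
    is proportional to its alternating minors; \<open>\<kappa> j\<close> is the ratio, read off at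
    index 0.\<close>
  define \<kappa> where "\<kappa> j = c j 0 / D j 0" for j
  have ck: "c j k = \<kappa> j * (-1)^k * D j k" if j: "j \<le> ?N" and k: "k \<le> ?n" for j k
    using k
  proof (induction k)
    case 0
    then show ?case using D0[OF j, of 0] by (simp add: \<kappa>_def)
  next
    case (Suc k)
    have "(\<Sum>m\<le>?n. c j m *\<^sub>R omit j v m) = (\<Sum>m\<in>{..?N} - {j}. br m j *\<^sub>R v m)"
      unfolding c_def using sum_omit[OF j, of scaleR "\<lambda>i. br i j" v] by (simp add: lessThan_Suc_atMost)
    also have "\<dots> = 0"
      using rel[of j] sum.remove[of "{..?N}" j "\<lambda>m. br m j *\<^sub>R v m"] j brjj by simp
    finally have "c j k * D j (Suc k) = - c j (Suc k) * D j k"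
      unfolding D_def using Suc.prems by (intro adjacent_cramer) auto
    then have "\<kappa> j * (-1)^k * D j k * D j (Suc k) = - c j (Suc k) * D j k" using Suc by simp
    then have "D j k * c j (Suc k) = D j k * (\<kappa> j * (-1)^Suc k * D j (Suc k))" by (simp add: algebra_simps)
    moreover have "D j k \<noteq> 0" using D0[OF j, of k] Suc.prems by simp
    ultimately show ?case using mult_left_cancel by blast
  qed
  have c0: "c j k \<noteq> 0" if "j \<le> ?N" "k \<le> ?n" for j k
    using that br0[of k j] br0[of "Suc k" j] by (auto simp: c_def omit_def)
  have \<kappa>0: "\<kappa> j \<noteq> 0" if "j \<le> ?N" for j using c0[OF that, of 0] ck[OF that, of 0] by auto
  \<comment> \<open>Deleting the neighbours \<open>j\<close> and \<open>Suc j\<close> in either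
    order leaves the same vectors, whereas \<open>br\<close> is antisymmetric. So
    \<open>\<kappa>\<close> alternates, which will cancel the signs of the coboundary.\<close>
  have \<kappa>Suc: "\<kappa> (Suc j) = - \<kappa> j" if j: "j \<le> ?n" for j
  proof -
    have "D (Suc j) j = D j j" unfolding D_def omit_omit[OF order_refl] ..
    moreover have "c (Suc j) j = - c j j" by (simp add: c_def omit_def br_def)
    ultimately have "\<kappa> (Suc j) * ((-1)^j * D j j) = - \<kappa> j * ((-1)^j * D j j)"
      using ck[of "Suc j" j] ck[of j j] j by (simp add: mult.assoc)
    moreover have "(-1)^j * D j j \<noteq> 0" using D0[of j j] j by simp
    ultimately show ?thesis using mult_right_cancel by blast
  qed
  have \<kappa>: "\<kappa> j = (-1)^j * \<kappa> 0" if "j \<le> ?N" for j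
    using that by (induction j) (auto simp: \<kappa>Suc)
  define S where "S = (\<Prod>k\<le>?n. (-1)^k :: real)"
  have eul_j: "(-1)^j * eul (omit j v) = sgn (\<kappa> 0) * S * (\<Prod>i\<in>{..?N} - {j}. sgn (br i j))" if j: "j \<le> ?N" for j
  proof -
    have "sgn (D j k) = sgn (\<kappa> j) * (-1)^k * sgn (c j k)" if k: "k \<le> ?n" for k
    proof -
      have "sgn (c j k) = sgn (\<kappa> j) * (-1)^k * sgn (D j k)" unfolding ck[OF j k] by (simp add: sgn_mult)
      then have "sgn (\<kappa> j) * (-1)^k * sgn (c j k) = (sgn (\<kappa> j) * sgn (\<kappa> j)) * ((-1)^k * (-1)^k) * sgn (D j k)"
        by (simp add: ac_simps)
      also have "\<dots> = sgn (D j k)" using \<kappa>0[OF j] by (simp add: power_add[symmetric] sgn_real_def flip: mult_2)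
      finally show ?thesis ..
    qed
    then have "eul (omit j v) = (\<Prod>k\<le>?n. sgn (\<kappa> j) * (-1)^k * sgn (c j k))"
      unfolding eul_def eps_def D_def[symmetric] by (intro prod.cong) auto
    also have "\<dots> = sgn (\<kappa> j) ^ Suc ?n * S * (\<Prod>k\<le>?n. sgn (c j k))"
      by (simp add: prod.distrib S_def)
    also have "sgn (\<kappa> j) ^ Suc ?n = sgn (\<kappa> j)" using sgn_power_even[OF n \<kappa>0[OF j]] by simp
    also have "(\<Prod>k\<le>?n. sgn (c j k)) = (\<Prod>i\<in>{..?N} - {j}. sgn (br i j))"
      unfolding c_def using prod_omit[OF j, of sgn "\<lambda>i. br i j"] by (simp add: lessThan_Suc_atMost)
    also have "sgn (\<kappa> j) = (-1)^j * sgn (\<kappa> 0)" unfolding \<kappa>[OF j] by (simp add: sgn_mult)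
    finally have "(-1)^j * eul (omit j v) = ((-1)^j * (-1)^j) * (sgn (\<kappa> 0) * S * (\<Prod>i\<in>{..?N} - {j}. sgn (br i j)))"
      by (simp add: ac_simps)
    then show ?thesis by (simp add: power_add[symmetric] flip: mult_2)
  qed
  \<comment> \<open>\<open>s\<close> fixes an affine chart of the projective line that contains all
    n + 2 points: no \<open>\<alpha> i + s * \<beta> i\<close> vanishes. At index 0 the quotient is
    a division by zero, and there \<open>p 0\<close> equals \<open>\<alpha> 0\<close>, which is
    nonzero for any \<open>s\<close>.\<close>
  have "finite ((\<lambda>i. - \<alpha> i / \<beta> i) ` {..?N})" by simp
  then obtain s where s: "s \<notin> (\<lambda>i. - \<alpha> i / \<beta> i) ` {..?N}" using ex_new_if_finite[OF infinite_UNIV_char_0] by blast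
  define p where "p i = \<alpha> i + s * \<beta> i" for i
  have p0: "p i \<noteq> 0" if "i \<le> ?N" for i
  proof
    assume z: "p i = 0"
    show False
    proof (cases "i = 0")
      case True
      then show False using z \<alpha>0(1) \<beta>0(1) by (simp add: p_def)
    next
      case False
      then have "\<beta> i \<noteq> 0" using \<beta>0(2) that by simp
      then have "s = - \<alpha> i / \<beta> i" using z by (simp add: p_def field_simps)
      then show False using s that by auto
    qed
  qed
  \<comment> \<open>The affine coordinate in this chart; up to the factors \<open>p i\<close> the
    minors become differences of coordinates.\<close>
  define t where "t i = \<beta> i / p i" for i
  have brt: "br i j = p i * p j * (t j - t i)" if "i \<le> ?N" "j \<le> ?N" for i j
    using p0[OF that(1)] p0[OF that(2)] by (simp add: t_def br_def field_simps) (simp add: p_def algebra_simps)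
  have injt: "inj_on t {..?N}"
    using brt br0 by (intro inj_onI) (metis atMost_iff cancel_comm_monoid_add_class.diff_cancel mult_zero_right)
  define P where "P = (\<Prod>i\<le>?N. sgn (p i))"
  have prod_br: "(\<Prod>i\<in>{..?N} - {j}. sgn (br i j)) = P * (\<Prod>i\<in>{..?N} - {j}. sgn (t j - t i))" if j: "j \<le> ?N" for j
  proof -
    have "(\<Prod>i\<in>{..?N} - {j}. sgn (br i j)) = (\<Prod>i\<in>{..?N} - {j}. sgn (p i) * (sgn (p j) * sgn (t j - t i)))"
      by (intro prod.cong) (auto simp: brt[OF _ j] sgn_mult)
    also have "\<dots> = (\<Prod>i\<in>{..?N} - {j}. sgn (p i)) * (sgn (p j) ^ Suc ?n * (\<Prod>i\<in>{..?N} - {j}. sgn (t j - t i)))"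
      using j by (simp add: prod.distrib)
    \<comment> \<open>The odd power leaves one factor \<open>sgn (p j)\<close>, which completes the
      product over the other indices to \<open>P\<close>, the same for every
      \<open>j\<close>.\<close>
    also have "sgn (p j) ^ Suc ?n = sgn (p j)" using sgn_power_even[OF n p0[OF j]] by simp
    finally show ?thesis unfolding P_def using prod.remove[of "{..?N}" j "\<lambda>i. sgn (p i)"] j by simp
  qed
  have "(\<Sum>j\<le>?N. (-1)^j * eul (omit j v)) = (\<Sum>j\<le>?N. sgn (\<kappa> 0) * S * P * (\<Prod>i\<in>{..?N} - {j}. sgn (t j - t i)))"
    by (intro sum.cong) (auto simp: eul_j prod_br)
  also have "\<dots> = sgn (\<kappa> 0) * S * P * (\<Sum>j\<le>?N. \<Prod>i\<in>{..?N} - {j}. sgn (t j - t i))"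
    by (simp only: sum_distrib_left)
  \<comment> \<open>There are n + 2 points, an even number.\<close>
  also have "\<dots> = 0" using n by (simp add: sum_prod_sgn_differences[OF _ injt] del: sum.atMost_Suc)
  finally show ?thesis .
qed

lemma conf_nonempty: "\<exists>v :: nat \<Rightarrow> real^'n. v \<in> conf k"
proof (induction k)
  case 0
  then show ?case by (auto simp: conf_0)
next
  case (Suc k)
  then obtain v :: "nat \<Rightarrow> real^'n" where v: "v \<in> conf k" by blast
  have "AE w in lborel. mat 1 *v w \<in> generic k v" by (rule generic_preimage(2)) simp
  moreover have "ae_filter (lborel :: (real^'n) measure) \<noteq> bot" by (simp add: ae_filter_eq_bot_iff)
  ultimately obtain w where "mat 1 *v w \<in> generic k v" using eventually_happens' by blast
  then show ?case using cons_conf[OF v] by auto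
qed

text \<open>Closedness removes the group variable. The vectors are then rescaled until their linear
  relation has all coefficients 1; a linear map that matches the first n vectors of two such
  configurations matches the last ones as well.\<close>

lemma top_invariants:
  fixes F :: "(nat \<Rightarrow> real^'n) \<Rightarrow> (nat \<Rightarrow> real^'n^'n) \<Rightarrow> real"
  assumes n: "even CARD('n)" and F: "F \<in> mixed (Suc CARD('n)) 0"
    and z: "\<And>v x. v \<in> conf (Suc CARD('n)) \<Longrightarrow> x \<in> tuples 1 \<Longrightarrow> dG 0 F v x = 0"
  shows "\<exists>t. \<forall>v\<in>conf (Suc CARD('n)). \<forall>x\<in>tuples 0. F v x = t * eul v"
proof -
  let ?n = "CARD('n)"
  have indep: "F v x = F v y" if v: "v \<in> conf (Suc ?n)" and x: "x \<in> tuples 0" and y: "y \<in> tuples 0" for v x y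
  proof -
    let ?u = "\<lambda>i. if i = 0 then y 0 else if i = 1 then x 0 else 0"
    have "?u \<in> tuples 1" using x y by (auto simp: tuples_iff le_Suc_eq)
    then have "dG 0 F v ?u = 0" by (rule z[OF v])
    moreover have "omit 0 ?u = x" "omit (Suc 0) ?u = y"
      using x y by (auto simp: omit_def tuples_iff fun_eq_iff)
    ultimately show ?thesis by (simp add: dG_def cobd_def)
  qed
  obtain v0 :: "nat \<Rightarrow> real^'n" where v0: "v0 \<in> conf (Suc ?n)" using conf_nonempty by blast
  define x0 :: "nat \<Rightarrow> real^'n^'n" where "x0 i = (if i = 0 then mat 1 else 0)" for i
  have x0: "x0 \<in> tuples 0" by (auto simp: x0_def tuples_iff)
  obtain b where b: "(\<Sum>i\<le>?n. b i *\<^sub>R v0 i) = 0" "\<And>i. i \<le> ?n \<Longrightarrow> b i \<noteq> 0" using relation_exists[OF v0] by auto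
  \<comment> \<open>The constant is the quotient of \<open>F\<close> and \<open>eul\<close> at
    \<open>v0\<close>, where \<open>eul v0\<close> is its own inverse.\<close>
  have "F v x = F v0 x0 * eul v0 * eul v" if v: "v \<in> conf (Suc ?n)" and x: "x \<in> tuples 0" for v x
  proof -
    obtain a where a: "(\<Sum>i\<le>?n. a i *\<^sub>R v i) = 0" "\<And>i. i \<le> ?n \<Longrightarrow> a i \<noteq> 0" using relation_exists[OF v] by auto
    define a' where "a' i = (if i \<le> ?n then a i else 1)" for i
    define b' where "b' i = (if i \<le> ?n then b i else 1)" for i
    have a': "a' i \<noteq> 0" and b': "b' i \<noteq> 0" for i using a(2) b(2) by (auto simp: a'_def b'_def)
    let ?v = "\<lambda>i. a' i *\<^sub>R v i" and ?w = "\<lambda>i. b' i *\<^sub>R v0 i"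
    have vc: "?v \<in> conf (Suc ?n)" and wc: "?w \<in> conf (Suc ?n)" using scale_conf[OF v a'] scale_conf[OF v0 b'] .
    have top: "u ?n = - (\<Sum>i<?n. u i)" if "(\<Sum>i\<le>?n. u i) = 0" for u :: "nat \<Rightarrow> real^'n"
      using that by (simp add: lessThan_Suc_atMost[symmetric] eq_neg_iff_add_eq_0 add.commute)
    have vtop: "?v ?n = - (\<Sum>i<?n. ?v i)" by (rule top) (use a(1) in \<open>simp add: a'_def\<close>)
    have wtop: "?w ?n = - (\<Sum>i<?n. ?w i)" by (rule top) (use b(1) in \<open>simp add: b'_def\<close>)
    let ?A = "colmat (omit ?n ?v)" and ?B = "colmat (omit ?n ?w)"
    have A: "?A \<in> GLn" and B: "?B \<in> GLn" using vc wc by (auto intro!: colmat_GLn omit_conf)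
    define g where "g = ?A ** matrix_inv ?B"
    have g: "g \<in> GLn" using A B by (simp add: g_def GLn_mult GLn_inv)
    have gi: "g *v ?w i = ?v i" if i: "i < ?n" for i
    proof -
      have "?w i = ?B *v axis (enumb i) 1" "?v i = ?A *v axis (enumb i) 1"
        using i by (simp_all add: colmat_axis omit_def)
      then show ?thesis by (simp add: g_def matrix_vector_mul_assoc matrix_inv_cancel[OF B])
    qed
    have gtop: "g *v ?w ?n = ?v ?n"
      unfolding vtop wtop using gi
      by (simp add: linear_neg[OF matrix_vector_mul_linear] linear_sum[OF matrix_vector_mul_linear])
    have geq: "(\<lambda>i. g *v ?w i) = ?v"
    proof
      fix i
      show "g *v ?w i = ?v i"
        using gi gtop conf_zero[OF v] conf_zero[OF v0] by (cases i ?n rule: linorder_cases) auto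
    qed
    have transfer: "G v (left_mult 0 g x0) = eps g * G v0 x0" if G: "G \<in> mixed (Suc ?n) 0" for G
    proof -
      have "G v (left_mult 0 g x0) = G ?v (left_mult 0 g x0)"
        by (rule mixed_scale[OF G a' v left_mult_tuples[OF g x0], symmetric])
      also have "\<dots> = eps g * G ?w x0" using mixed_equiv[OF G g wc x0] unfolding geq .
      also have "G ?w x0 = G v0 x0" by (rule mixed_scale[OF G b' v0 x0])
      finally show ?thesis .
    qed
    have "eul v = eps g * eul v0" using transfer[OF eul_mixed[OF n]] by simp
    then have "F v0 x0 * eul v0 * eul v = eps g * F v0 x0 * (eul v0 * eul v0)" by (simp add: ac_simps)
    also have "\<dots> = F v (left_mult 0 g x0)" using transfer[OF F] eul_nonzero[OF v0] by simp
    also have "\<dots> = F v x" by (rule indep[OF v left_mult_tuples[OF g x0] x])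
    finally show ?thesis ..
  qed
  then show ?thesis by blast
qed

subsection \<open>The zigzag\<close>

text \<open>\<open>biclosed\<close> modulo \<open>good\<close> is the degree \<open>q\<close>
  cohomology of the complex of \<open>dV\<close>-closed functions of \<open>k\<close> points. For
  \<open>k = 1\<close> these are the functions constant in the point, which gives the bounded
  cohomology; exactness of the columns relates the place \<open>(k, q + 1)\<close> to
  \<open>(k + 1, q)\<close>.\<close>

definition biclosed :: "nat \<Rightarrow> nat \<Rightarrow> ((nat \<Rightarrow> real^'n) \<Rightarrow> (nat \<Rightarrow> real^'n^'n) \<Rightarrow> real) \<Rightarrow> bool" where
  "biclosed k q F \<longleftrightarrow> F \<in> mixed k q \<and> (\<forall>v\<in>conf (Suc k). \<forall>x\<in>tuples q. dV k F v x = 0) \<and>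
     (\<forall>v\<in>conf k. \<forall>x\<in>tuples (Suc q). dG q F v x = 0)"

definition good :: "nat \<Rightarrow> nat \<Rightarrow> ((nat \<Rightarrow> real^'n) \<Rightarrow> (nat \<Rightarrow> real^'n^'n) \<Rightarrow> real) \<Rightarrow> bool" where
  "good k q F \<longleftrightarrow> (if q = 0 then (\<forall>v\<in>conf k. \<forall>x\<in>tuples 0. F v x = 0)
     else (\<exists>G\<in>mixed k (q - 1). (\<forall>v\<in>conf (Suc k). \<forall>x\<in>tuples (q - 1). dV k G v x = 0) \<and>
       (\<forall>v\<in>conf k. \<forall>x\<in>tuples q. F v x = dG (q - 1) G v x)))"

lemma good_SucI:
  assumes "G \<in> mixed k q" "\<And>v x. v \<in> conf (Suc k) \<Longrightarrow> x \<in> tuples q \<Longrightarrow> dV k G v x = 0"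
    "\<And>v x. v \<in> conf k \<Longrightarrow> x \<in> tuples (Suc q) \<Longrightarrow> F v x = dG q G v x"
  shows "good k (Suc q) F"
  unfolding good_def using assms by auto

lemma good_SucE:
  assumes "good k (Suc q) F"
  obtains G where "G \<in> mixed k q" "\<And>v x. v \<in> conf (Suc k) \<Longrightarrow> x \<in> tuples q \<Longrightarrow> dV k G v x = 0"
    "\<And>v x. v \<in> conf k \<Longrightarrow> x \<in> tuples (Suc q) \<Longrightarrow> F v x = dG q G v x"
  using assms unfolding good_def by auto

lemma good_cong:
  assumes "good k q F" "\<And>v x. v \<in> conf k \<Longrightarrow> x \<in> tuples q \<Longrightarrow> F v x = F' v x"
  shows "good k q F'"
proof (cases q)
  case 0
  then show ?thesis using assms by (simp add: good_def)
next
  case (Suc r)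
  from assms(1)[unfolded Suc] obtain G where G: "G \<in> mixed k r" "\<And>v x. v \<in> conf (Suc k) \<Longrightarrow> x \<in> tuples r \<Longrightarrow> dV k G v x = 0"
    "\<And>v x. v \<in> conf k \<Longrightarrow> x \<in> tuples (Suc r) \<Longrightarrow> F v x = dG r G v x"
    by (rule good_SucE) blast
  show ?thesis unfolding Suc
    by (rule good_SucI[OF G(1,2)]) (use G(3) assms(2) Suc in auto)
qed

text \<open>The primitive \<open>G\<close> is made \<open>dV\<close>-closed by subtracting a
  \<open>dG\<close>-boundary: if \<open>dV k G\<close> is \<open>dG\<close> of a closed
  \<open>G'\<close>, a \<open>dV\<close>-primitive of \<open>G'\<close> supplies the
  correction.\<close>

lemma good_lift:
  fixes F G :: "(nat \<Rightarrow> real^'n) \<Rightarrow> (nat \<Rightarrow> real^'n^'n) \<Rightarrow> real"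
  assumes G: "G \<in> mixed k q" and FG: "\<And>v x. v \<in> conf k \<Longrightarrow> x \<in> tuples (Suc q) \<Longrightarrow> F v x = dG q G v x"
    and good: "good (Suc k) q (dV k G)"
  shows "good k (Suc q) F"
proof (cases q)
  case 0
  show ?thesis
    by (rule good_SucI[OF G _ FG]) (use good 0 in \<open>auto simp: good_def\<close>)
next
  case (Suc r)
  from good[unfolded Suc] obtain G' where G': "G' \<in> mixed (Suc k) r"
    "\<And>v x. v \<in> conf (Suc (Suc k)) \<Longrightarrow> x \<in> tuples r \<Longrightarrow> dV (Suc k) G' v x = 0"
    "\<And>v x. v \<in> conf (Suc k) \<Longrightarrow> x \<in> tuples (Suc r) \<Longrightarrow> dV k G v x = dG r G' v x"
    by (rule good_SucE) blast
  define E where "E = contract k G'"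
  have E: "E \<in> mixed k r" unfolding E_def by (rule contract_mixed[OF G'(1)])
  have dE: "dV k E v x = G' v x" if "v \<in> conf (Suc k)" "x \<in> tuples r" for v x
    unfolding E_def by (rule dV_contract[OF G'(1,2) that])
  let ?F = "\<lambda>v x. 1 * G v x + (-1) * dG r E v x"
  show ?thesis
  proof (rule good_SucI)
    show "?F \<in> mixed k q" using G dG_mixed[OF E] Suc by (intro mixed_lin) auto
    fix v :: "nat \<Rightarrow> real^'n" and x :: "nat \<Rightarrow> real^'n^'n"
    show "dV k ?F v x = 0" if v: "v \<in> conf (Suc k)" and x: "x \<in> tuples q"
    proof -
      have x': "x \<in> tuples (Suc r)" using x Suc by simp
      have "dG r (dV k E) v x = dG r G' v x" by (rule dG_cong[OF dE v x'])
      then show ?thesis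
        unfolding dV_lin using G'(3)[OF v x'] by (simp add: dG_dV)
    qed
    show "F v x = dG q ?F v x" if "v \<in> conf k" "x \<in> tuples (Suc q)"
      unfolding dG_lin using FG[OF that] Suc by (simp add: dG_dG)
  qed
qed

lemma biclosed_dV:
  fixes G :: "(nat \<Rightarrow> real^'n) \<Rightarrow> (nat \<Rightarrow> real^'n^'n) \<Rightarrow> real"
  assumes G: "G \<in> mixed k q" and F: "biclosed k (Suc q) F"
    and FG: "\<And>v x. v \<in> conf k \<Longrightarrow> x \<in> tuples (Suc q) \<Longrightarrow> F v x = dG q G v x"
  shows "biclosed (Suc k) q (dV k G)"
  unfolding biclosed_def
proof (intro conjI ballI)
  show "dV k G \<in> mixed (Suc k) q" by (rule dV_mixed[OF G])
  show "dV (Suc k) (dV k G) v x = 0" for v x by (rule dV_dV)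
  fix v :: "nat \<Rightarrow> real^'n" and x :: "nat \<Rightarrow> real^'n^'n" assume vx: "v \<in> conf (Suc k)" "x \<in> tuples (Suc q)"
  have "dG q (dV k G) v x = dV k F v x"
    unfolding dG_dV by (rule dV_cong[OF _ vx]) (simp add: FG)
  then show "dG q (dV k G) v x = 0" using F vx by (simp add: biclosed_def)
qed

lemma biclosed_column_exact:
  fixes F :: "(nat \<Rightarrow> real^'n) \<Rightarrow> (nat \<Rightarrow> real^'n^'n) \<Rightarrow> real"
  assumes F: "biclosed k (Suc q) F" and k: "1 \<le> k" "k \<le> CARD('n)"
  obtains G where "G \<in> mixed k q" "\<And>v x. v \<in> conf k \<Longrightarrow> x \<in> tuples (Suc q) \<Longrightarrow> F v x = dG q G v x"
    "biclosed (Suc k) q (dV k G)"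
proof -
  have "F \<in> mixed k (Suc q)" "\<And>v x. v \<in> conf k \<Longrightarrow> x \<in> tuples (Suc (Suc q)) \<Longrightarrow> dG (Suc q) F v x = 0"
    using F by (auto simp: biclosed_def)
  from column_exact[OF this(1) k this(2)] obtain G where G: "G \<in> mixed k q"
    "\<And>v x. v \<in> conf k \<Longrightarrow> x \<in> tuples (Suc q) \<Longrightarrow> F v x = dG q G v x" by blast
  show thesis by (rule that[OF G biclosed_dV[OF G(1) F G(2)]])
qed

text \<open>Moving from \<open>(k, q + 1)\<close> to \<open>(k + 1, q)\<close> keeps the sum, so the
  chase ends in degree 0 of a column with at most n points, where only 0 is closed.\<close>

lemma good_below_top:
  fixes F :: "(nat \<Rightarrow> real^'n) \<Rightarrow> (nat \<Rightarrow> real^'n^'n) \<Rightarrow> real"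
  shows "1 \<le> k \<Longrightarrow> k + q \<le> CARD('n) \<Longrightarrow> biclosed k q F \<Longrightarrow> good k q F"
proof (induction q arbitrary: k F)
  case 0
  then show ?case unfolding good_def biclosed_def using column_exact_0[of F k] by simp
next
  case (Suc q)
  obtain G where G: "G \<in> mixed k q" "\<And>v x. v \<in> conf k \<Longrightarrow> x \<in> tuples (Suc q) \<Longrightarrow> F v x = dG q G v x"
    "biclosed (Suc k) q (dV k G)"
    by (rule biclosed_column_exact[OF Suc.prems(3,1)]) (use Suc.prems(2) in auto)
  show ?case by (rule good_lift[OF G(1,2) Suc.IH[OF _ _ G(3)]]) (use Suc.prems in auto)
qed

text \<open>The same moves with sum n + 1 end at the invariants of n + 1 points, and the induction
  carries their generator back. The combinations are written with \<open>1 *\<close> and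
  \<open>(-t) *\<close> to have the shape of \<open>mixed_lin\<close>, \<open>dV_lin\<close> and
  \<open>dG_lin\<close>.\<close>

lemma top_one_dimensional:
  assumes n: "even CARD('n)"
  shows "1 \<le> k \<Longrightarrow> k + q = Suc CARD('n) \<Longrightarrow>
    \<exists>c :: (nat \<Rightarrow> real^'n) \<Rightarrow> (nat \<Rightarrow> real^'n^'n) \<Rightarrow> real. biclosed k q c \<and> \<not> good k q c \<and>
      (\<forall>F. biclosed k q F \<longrightarrow> (\<exists>t. good k q (\<lambda>v x. 1 * F v x + (-t) * c v x)))"
proof (induction q arbitrary: k)
  case 0
  then have k: "k = Suc CARD('n)" by simp
  let ?c = "\<lambda>(v :: nat \<Rightarrow> real^'n) (x :: nat \<Rightarrow> real^'n^'n). eul v"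
  have "biclosed k 0 ?c"
    unfolding biclosed_def k
  proof (intro conjI ballI)
    show "?c \<in> mixed (Suc CARD('n)) 0" by (rule eul_mixed[OF n])
    show "dV (Suc CARD('n)) ?c v x = 0" if "v \<in> conf (Suc (Suc CARD('n)))" for v x
      unfolding dV_def by (rule eul_cocycle[OF n that])
    show "dG 0 ?c v x = 0" for v x by (simp add: dG_def cobd_def)
  qed
  moreover have "\<not> good k 0 ?c"
  proof
    assume g: "good k 0 ?c"
    obtain v :: "nat \<Rightarrow> real^'n" where v: "v \<in> conf k" using conf_nonempty by blast
    have "(\<lambda>i. if i = 0 then mat 1 else 0 :: real^'n^'n) \<in> tuples 0" by (auto simp: tuples_iff)
    then have "eul v = 0" using g v by (auto simp: good_def)
    then show False using eul_nonzero[of v] v k by simp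
  qed
  moreover have "\<exists>t. good k 0 (\<lambda>v x. 1 * F v x + (-t) * ?c v x)" if "biclosed k 0 F" for F
  proof -
    obtain t where "\<And>v x. v \<in> conf k \<Longrightarrow> x \<in> tuples 0 \<Longrightarrow> F v x = t * eul v"
      using top_invariants[OF n, of F] \<open>biclosed k 0 F\<close> unfolding biclosed_def k by auto
    then show ?thesis by (intro exI[of _ t]) (simp add: good_def)
  qed
  ultimately show ?case by blast
next
  case (Suc q)
  obtain c' :: "(nat \<Rightarrow> real^'n) \<Rightarrow> (nat \<Rightarrow> real^'n^'n) \<Rightarrow> real" where c': "biclosed (Suc k) q c'" "\<not> good (Suc k) q c'"
    "\<And>F. biclosed (Suc k) q F \<Longrightarrow> \<exists>t. good (Suc k) q (\<lambda>v x. 1 * F v x + (-t) * c' v x)"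
    using Suc.IH[of "Suc k"] Suc.prems by auto
  have k: "1 \<le> k" "k \<le> CARD('n)" using Suc.prems by auto
  have c'm: "c' \<in> mixed (Suc k) q" using c'(1) by (simp add: biclosed_def)
  \<comment> \<open>A \<open>dV\<close>-primitive of the old generator; its \<open>dG\<close> is the
    new generator.\<close>
  define E where "E = contract k c'"
  have E: "E \<in> mixed k q" unfolding E_def by (rule contract_mixed[OF c'm])
  have dE: "dV k E v x = c' v x" if "v \<in> conf (Suc k)" "x \<in> tuples q" for v x
    unfolding E_def by (rule dV_contract[OF c'm _ that]) (use c'(1) in \<open>simp add: biclosed_def\<close>)
  have "biclosed k (Suc q) (dG q E)"
    unfolding biclosed_def
  proof (intro conjI ballI)
    show "dG q E \<in> mixed k (Suc q)" by (rule dG_mixed[OF E])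
    show "dG (Suc q) (dG q E) v x = 0" for v x by (rule dG_dG)
    fix v :: "nat \<Rightarrow> real^'n" and x :: "nat \<Rightarrow> real^'n^'n" assume vx: "v \<in> conf (Suc k)" "x \<in> tuples (Suc q)"
    have "dG q (dV k E) v x = dG q c' v x" by (rule dG_cong[OF dE vx])
    then show "dV k (dG q E) v x = 0" using c'(1) vx by (simp add: biclosed_def dG_dV)
  qed
  moreover have "\<not> good k (Suc q) (dG q E)"
  proof
    assume "good k (Suc q) (dG q E)"
    then obtain F' where F': "F' \<in> mixed k q" "\<And>v x. v \<in> conf (Suc k) \<Longrightarrow> x \<in> tuples q \<Longrightarrow> dV k F' v x = 0"
      "\<And>v x. v \<in> conf k \<Longrightarrow> x \<in> tuples (Suc q) \<Longrightarrow> dG q E v x = dG q F' v x"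
      by (rule good_SucE) blast
    \<comment> \<open>\<open>?M\<close> is closed in the group direction and its \<open>dV\<close>
      is \<open>c'\<close>. Column exactness makes \<open>?M\<close> zero in degree 0 and otherwise
      \<open>dG\<close> of some \<open>N\<close>, which exhibits \<open>c'\<close> as
      \<open>dG\<close> of the closed function \<open>dV k N\<close>.\<close>
    let ?M = "\<lambda>v x. 1 * E v x + (-1) * F' v x"
    have M: "?M \<in> mixed k q" by (rule mixed_lin[OF E F'(1)])
    have dM: "dG q ?M v x = 0" if "v \<in> conf k" "x \<in> tuples (Suc q)" for v x
      unfolding dG_lin using F'(3)[OF that] by simp
    have dVM: "dV k ?M v x = c' v x" if "v \<in> conf (Suc k)" "x \<in> tuples q" for v x
      unfolding dV_lin using dE[OF that] F'(2)[OF that] by simp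
    have "good (Suc k) q c'"
    proof (cases q)
      case 0
      have "?M v x = 0" if "v \<in> conf k" "x \<in> tuples 0" for v x
        by (rule column_exact_0[OF M[unfolded 0] k(2) _ that]) (use dM 0 in auto)
      then have "dV k ?M v x = dV k (\<lambda>_ _. 0) v x" if "v \<in> conf (Suc k)" "x \<in> tuples 0" for v x
        by (rule dV_cong[OF _ that])
      then show ?thesis using dVM 0 by (simp add: good_def dV_def)
    next
      case (Suc r)
      obtain N where N: "N \<in> mixed k r" "\<And>v x. v \<in> conf k \<Longrightarrow> x \<in> tuples (Suc r) \<Longrightarrow> ?M v x = dG r N v x"
        using column_exact[OF M[unfolded Suc] k dM[unfolded Suc]] by blast
      show ?thesis unfolding Suc
      proof (rule good_SucI)
        show "dV k N \<in> mixed (Suc k) r" by (rule dV_mixed[OF N(1)])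
        show "dV (Suc k) (dV k N) v x = 0" for v x by (rule dV_dV)
        fix v :: "nat \<Rightarrow> real^'n" and x :: "nat \<Rightarrow> real^'n^'n" assume vx: "v \<in> conf (Suc k)" "x \<in> tuples (Suc r)"
        have "dV k ?M v x = dV k (dG r N) v x" by (rule dV_cong[OF N(2) vx])
        then show "c' v x = dG r (dV k N) v x" using dVM[OF vx(1)] vx(2) Suc by (simp add: dG_dV)
      qed
    qed
    then show False using c'(2) by simp
  qed
  moreover have "\<exists>t. good k (Suc q) (\<lambda>v x. 1 * F v x + (-t) * dG q E v x)" if F: "biclosed k (Suc q) F" for F
  proof -
    obtain G where G: "G \<in> mixed k q" "\<And>v x. v \<in> conf k \<Longrightarrow> x \<in> tuples (Suc q) \<Longrightarrow> F v x = dG q G v x"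
      "biclosed (Suc k) q (dV k G)"
      by (rule biclosed_column_exact[OF F k]) blast
    obtain t where t: "good (Suc k) q (\<lambda>v x. 1 * dV k G v x + (-t) * c' v x)" using c'(3)[OF G(3)] by blast
    \<comment> \<open>Subtracting \<open>t * E\<close> from the primitive of \<open>F\<close> makes
      its \<open>dV\<close> good, as \<open>good_lift\<close> requires.\<close>
    let ?G = "\<lambda>v x. 1 * G v x + (-t) * E v x"
    have "good (Suc k) q (dV k ?G)"
      by (rule good_cong[OF t]) (simp add: dV_lin[of k 1 G "- t" E, simplified] dE)
    then have "good k (Suc q) (\<lambda>v x. 1 * F v x + (-t) * dG q E v x)"
      by (rule good_lift[OF mixed_lin[OF G(1) E], rotated]) (simp add: dG_lin[of q 1 G "- t" E, simplified] G(2))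
    then show ?thesis by blast
  qed
  ultimately show ?case by blast
qed

section \<open>Bounded cohomology as the case of one point\<close>

lemma cochains_eq_CH: "cochains q = CH GLn q"
  by (auto simp: cochains_def CH_def CB_def bounded_iff)

lemma cochain_mixed_0:
  fixes z :: "(nat \<Rightarrow> real^'n^'n) \<Rightarrow> real"
  assumes z: "z \<in> cochains q"
  shows "(\<lambda>_ x. z x) \<in> mixed 0 q"
proof -
  have zC: "z \<in> CB q" using z by (simp add: cochains_eq_CH CH_def)
  obtain C where C: "\<And>x. x \<in> tuples q \<Longrightarrow> \<bar>z x\<bar> \<le> C" using CB_bound[OF zC] by blast
  show ?thesis
    by (rule mixedI[where C = C]) (use z C in \<open>auto simp: cochains_eq_CH CH_def intro!: CB_tendsto[OF zC]\<close>)
qed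

lemma mixed_0_cochain:
  fixes F :: "(nat \<Rightarrow> real^'n) \<Rightarrow> (nat \<Rightarrow> real^'n^'n) \<Rightarrow> real"
  assumes F: "F \<in> mixed 0 q"
  shows "F (\<lambda>_. 0) \<in> cochains q"
proof -
  have 0: "(\<lambda>_. 0 :: real^'n) \<in> conf 0" by (simp add: conf_0)
  obtain C where C: "\<And>v x. v \<in> conf 0 \<Longrightarrow> x \<in> tuples q \<Longrightarrow> \<bar>F v x\<bar> \<le> C" using mixed_bound[OF F] by blast
  have "F (\<lambda>_. 0) \<in> CB q"
    by (rule CB_I[where C = C]) (auto intro!: C 0 mixed_tendsto[OF F])
  moreover have "F (\<lambda>_. 0) (left_mult q g x) = eps g * F (\<lambda>_. 0) x" if "g \<in> GLn" "x \<in> tuples q" for g x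
    using mixed_equiv[OF F that(1) 0 that(2)] by simp
  ultimately show ?thesis by (simp add: cochains_eq_CH CH_def)
qed

lemma dV_0: "dV 0 F v x = F (omit 0 v) x"
  by (simp add: dV_def)

lemma omit_conf_1: "v \<in> conf 1 \<Longrightarrow> omit 0 v = (\<lambda>_. 0)"
  using omit_conf[of v 0 0] by (simp add: conf_0)

lemma cocycle_biclosed:
  fixes z :: "(nat \<Rightarrow> real^'n^'n) \<Rightarrow> real"
  assumes "is_cocycle q z"
  shows "biclosed 1 q (\<lambda>(_ :: nat \<Rightarrow> real^'n) x. z x)"
proof -
  have z: "z \<in> cochains q" "\<And>x. x \<in> tuples (Suc q) \<Longrightarrow> cobd q z x = 0" using assms by (auto simp: is_cocycle_def)
  have eq: "dV 0 (\<lambda>_ x. z x) = (\<lambda>(_ :: nat \<Rightarrow> real^'n) x. z x)" by (simp add: dV_def fun_eq_iff)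
  have "(\<lambda>(_ :: nat \<Rightarrow> real^'n) x. z x) \<in> mixed 1 q"
    using dV_mixed[OF cochain_mixed_0[OF z(1)]] unfolding eq by simp
  then show ?thesis using z(2) by (simp add: biclosed_def dV_def dG_def)
qed

text \<open>A \<open>dV\<close>-closed function of one point does not depend on the point, and
  averaging over a random point recovers it as a cochain on the group.\<close>

lemma good_iff_coboundary:
  fixes z :: "(nat \<Rightarrow> real^'n^'n) \<Rightarrow> real"
  shows "good 1 q (\<lambda>(_ :: nat \<Rightarrow> real^'n) x. z x) \<longleftrightarrow> is_coboundary q z"
proof (cases q)
  case 0
  then show ?thesis using conf_nonempty[of 1, where 'n = 'n] by (auto simp: good_def is_coboundary_def)
next
  case (Suc r)
  obtain v :: "nat \<Rightarrow> real^'n" where v: "v \<in> conf 1" using conf_nonempty by blast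
  show ?thesis
  proof
    assume "good 1 q (\<lambda>(_ :: nat \<Rightarrow> real^'n) x. z x)"
    from this[unfolded Suc] obtain G :: "(nat \<Rightarrow> real^'n) \<Rightarrow> (nat \<Rightarrow> real^'n^'n) \<Rightarrow> real" where G: "G \<in> mixed 1 r"
      "\<And>v x. v \<in> conf (Suc 1) \<Longrightarrow> x \<in> tuples r \<Longrightarrow> dV 1 G v x = 0"
      "\<And>v x. v \<in> conf 1 \<Longrightarrow> x \<in> tuples (Suc r) \<Longrightarrow> z x = dG r G v x"
      by (rule good_SucE) blast
    define h where "h = contract 0 G (\<lambda>_. 0)"
    have h: "h \<in> cochains r" unfolding h_def by (rule mixed_0_cochain[OF contract_mixed]) (use G(1) in simp)
    have "h x = G v x" if x: "x \<in> tuples r" for x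
      using dV_contract[of G 0 r v x] G(1,2) v x by (simp add: dV_0 omit_conf_1[OF v] h_def)
    then have "cobd r h x = dG r G v x" if "x \<in> tuples (Suc r)" for x
      unfolding dG_def cobd_def by (intro sum.cong) (auto simp: omit_tuples[OF that])
    then have "\<forall>x\<in>tuples (Suc r). z x = cobd r h x" using G(3)[OF v] by simp
    then show "is_coboundary q z" unfolding is_coboundary_def using Suc h by auto
  next
    assume "is_coboundary q z"
    then obtain h where h: "h \<in> cochains r" "\<And>x. x \<in> tuples (Suc r) \<Longrightarrow> z x = cobd r h x"
      using Suc by (auto simp: is_coboundary_def)
    have eq: "dV 0 (\<lambda>_ x. h x) = (\<lambda>(_ :: nat \<Rightarrow> real^'n) x. h x)" by (simp add: dV_def fun_eq_iff)
    have "(\<lambda>(_ :: nat \<Rightarrow> real^'n) x. h x) \<in> mixed 1 r"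
      using dV_mixed[OF cochain_mixed_0[OF h(1)]] unfolding eq by simp
    then show "good 1 q (\<lambda>(_ :: nat \<Rightarrow> real^'n) x. z x)"
      unfolding Suc by (rule good_SucI) (auto simp: dV_def dG_def h(2))
  qed
qed

theorem theorem7p1:
  assumes "even CARD('n::finite)"
  shows "Hb_one_dim TYPE('n) CARD('n) \<and> (\<forall>q < CARD('n). Hb_vanishes TYPE('n) q)"
proof (intro conjI allI impI)
  fix q assume q: "q < CARD('n)"
  show "Hb_vanishes TYPE('n) q"
    unfolding Hb_vanishes_def
  proof (intro allI impI)
    fix z :: "(nat \<Rightarrow> real^'n^'n) \<Rightarrow> real" assume "is_cocycle q z"
    then have "good 1 q (\<lambda>(_ :: nat \<Rightarrow> real^'n) x. z x)"
      using q by (intro good_below_top cocycle_biclosed) auto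
    then show "is_coboundary q z" by (simp only: good_iff_coboundary)
  qed
next
  let ?n = "CARD('n)"
  obtain c1 :: "(nat \<Rightarrow> real^'n) \<Rightarrow> (nat \<Rightarrow> real^'n^'n) \<Rightarrow> real" where c1: "biclosed 1 ?n c1" "\<not> good 1 ?n c1"
    "\<And>F. biclosed 1 ?n F \<Longrightarrow> \<exists>t. good 1 ?n (\<lambda>v x. 1 * F v x + (-t) * c1 v x)"
    using top_one_dimensional[OF assms, of 1 ?n] by auto
  obtain v :: "nat \<Rightarrow> real^'n" where v: "v \<in> conf 1" using conf_nonempty by blast
  \<comment> \<open>\<open>c1\<close> is \<open>dV\<close>-closed, hence constant in its point;
    averaging extracts the cochain.\<close>
  define c where "c = contract 0 c1 (\<lambda>_. 0)"
  have c: "c \<in> cochains ?n"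
    unfolding c_def by (rule mixed_0_cochain[OF contract_mixed]) (use c1(1) in \<open>simp add: biclosed_def\<close>)
  have cc1: "c1 v x = c x" if "v \<in> conf 1" "x \<in> tuples ?n" for v x
    using dV_contract[of c1 0 ?n v x] c1(1) that by (simp add: dV_0 omit_conf_1[OF that(1)] c_def biclosed_def)
  have "cobd ?n c x = 0" if x: "x \<in> tuples (Suc ?n)" for x
  proof -
    have "cobd ?n c x = dG ?n c1 v x"
      unfolding dG_def cobd_def by (intro sum.cong) (auto simp: cc1[OF v] omit_tuples[OF x])
    then show ?thesis using c1(1) v x by (simp add: biclosed_def)
  qed
  then have "is_cocycle ?n c" using c by (simp add: is_cocycle_def)
  moreover have "\<not> is_coboundary ?n c"
  proof
    assume "is_coboundary ?n c"
    then have "good 1 ?n (\<lambda>(_ :: nat \<Rightarrow> real^'n) x. c x)" by (simp only: good_iff_coboundary)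
    then have "good 1 ?n c1" by (rule good_cong) (simp add: cc1)
    then show False using c1(2) by simp
  qed
  moreover have "\<exists>t. is_coboundary ?n (\<lambda>x. z x - t * c x)" if z: "is_cocycle ?n z" for z
  proof -
    obtain t where "good 1 ?n (\<lambda>(v :: nat \<Rightarrow> real^'n) x. 1 * z x + (-t) * c1 v x)"
      using c1(3)[OF cocycle_biclosed[OF z]] by blast
    then have "good 1 ?n (\<lambda>(_ :: nat \<Rightarrow> real^'n) x. z x - t * c x)"
      by (rule good_cong) (simp add: cc1)
    then show ?thesis unfolding good_iff_coboundary by blast
  qed
  ultimately show "Hb_one_dim TYPE('n) ?n" unfolding Hb_one_dim_def by blast
qed

end
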